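(* Let $b \ge 2$ and $k \ge 2$ be integers. There exist an effectively computable real number $c$, depending at most on $b$, and an effectively computable absolute real number $C$ such that every sufficiently large positive integer $n$ which is not divisible by $b$ and whose representation in base $b$ has exactly $k$ nonzero digits satisfies $$ \frac{\log \log n}{k} \le c + \log k + \omega(n)\bigl(C + \log \log P[n]\bigr) + \log \log \bigl(k \log P[n]\bigr). $$
   Context: For a positive integer $n$, $P[n]$ denotes the greatest prime factor of $n$ (with $P[1]=1$) and $\omega(n)$ denotes the number of distinct prime factors of $n$. *)

theory Defs
  imports Complex_Main "HOL-Computational_Algebra.Primes"
begin

definition greatest_prime_factor :: "nat \<Rightarrow> nat" where
  "greatest_prime_factor n = (if n \<le> 1 then 1 else Max (prime_factors n))"

definition num_prime_factors :: "nat \<Rightarrow> nat" where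
  "num_prime_factors n = card (prime_factors n)"

definition digit :: "nat \<Rightarrow> nat \<Rightarrow> nat \<Rightarrow> nat" where
  "digit b n i = (n div b ^ i) mod b"

definition num_nonzero_digits :: "nat \<Rightarrow> nat \<Rightarrow> nat" where
  "num_nonzero_digits b n = card {i. digit b n i \<noteq> 0}"

text \<open>
  Kleene's total recursive functions. In \<open>total_recursive n f\<close> the number \<open>n\<close> is the arity: only the
  values of \<open>f\<close> on lists of length \<open>n\<close> are meaningful. Minimisation is applied to regular
  functions only, so no partial functions are needed.
\<close>

inductive total_recursive :: "nat \<Rightarrow> (nat list \<Rightarrow> nat) \<Rightarrow> bool" where
  zero: "total_recursive n (\<lambda>_. 0)"
| succ: "total_recursive 1 (\<lambda>xs. Suc (hd xs))"
| proj: "i < n \<Longrightarrow> total_recursive n (\<lambda>xs. xs ! i)"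
| comp: "total_recursive (length fs) g \<Longrightarrow> (\<And>f. f \<in> set fs \<Longrightarrow> total_recursive n f) \<Longrightarrow>
    total_recursive n (\<lambda>xs. g (map (\<lambda>f. f xs) fs))"
| prim_rec: "total_recursive n f \<Longrightarrow> total_recursive (Suc (Suc n)) g \<Longrightarrow>
    total_recursive (Suc n) (\<lambda>xs. rec_nat (f (tl xs)) (\<lambda>y r. g (y # r # tl xs)) (hd xs))"
| minimise: "total_recursive (Suc n) f \<Longrightarrow>
    (\<And>xs. length xs = n \<Longrightarrow> \<exists>y. f (y # xs) = 0) \<Longrightarrow>
    total_recursive n (\<lambda>xs. LEAST y. f (y # xs) = 0)"

text \<open>
  A real number is effectively computable if some algorithm produces, for each \<open>m\<close>, a rational
  approximation with error at most \<open>1 / 2 ^ m\<close>; the rational is coded as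
  \<open>(p - q) / (r + 1)\<close> with natural numbers \<open>p\<close>, \<open>q\<close>, \<open>r\<close>. For a real number depending on a
  parameter \<open>b\<close>, a single algorithm takes \<open>b\<close> and \<open>m\<close> as input.
\<close>

definition computable_real :: "real \<Rightarrow> bool" where
  "computable_real x \<longleftrightarrow> (\<exists>p q r.
     total_recursive 1 p \<and> total_recursive 1 q \<and> total_recursive 1 r \<and>
     (\<forall>m. \<bar>x - (real (p [m]) - real (q [m])) / real (Suc (r [m]))\<bar> \<le> 1 / 2 ^ m))"

definition computable_real_fun :: "(nat \<Rightarrow> real) \<Rightarrow> bool" where
  "computable_real_fun c \<longleftrightarrow> (\<exists>p q r.
     total_recursive 2 p \<and> total_recursive 2 q \<and> total_recursive 2 r \<and>
     (\<forall>b m. \<bar>c b - (real (p [b, m]) - real (q [b, m])) / real (Suc (r [b, m]))\<bar> \<le> 1 / 2 ^ m))"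

end

theory Submission
  imports Defs "HOL-Library.FuncSet"
begin

text \<open>
  Let the nonzero digits of \<open>n\<close> sit at the positions \<open>m\<^sub>1 > \<dots> > m\<^sub>k = 0\<close>. The truncation
  \<open>N = n div b ^ m\<^sub>j\<close> is so close to \<open>n / b ^ m\<^sub>j\<close> that \<open>ln n - m\<^sub>j * ln b - ln N\<close> is at most
  about \<open>b ^ (m\<^sub>j\<^sub>+\<^sub>1 - m\<^sub>1)\<close>. It is a nonzero integral linear form in the logarithms of the primes
  dividing \<open>n * b\<close> and of one further integer of logarithm at most \<open>ln N\<close>. A Baker type lower bound
  therefore gives \<open>m\<^sub>1 - m\<^sub>j\<^sub>+\<^sub>1 \<le> A * (m\<^sub>1 - m\<^sub>j + 1)\<close>, and \<open>k - 1\<close> applications bound \<open>ln n\<close>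
  by \<open>A ^ (k - 1) * ln b\<close>.

  The bound needed is \<open>A = (K * ln P) ^ \<omega> * (ln n) ^ (2 * \<delta>)\<close> up to a constant, where \<open>K\<close> may depend
  on \<open>k\<close> and \<open>\<delta>\<close> is of order \<open>1 / k\<^sup>2\<close>: the passage from the exponent \<open>k - 1\<close> to \<open>k\<close> absorbs
  the power of \<open>ln n\<close>, and a large \<open>\<omega>\<close> forces \<open>ln (ln P)\<close> to be large, which absorbs \<open>K\<close>.

  The lower bound is proved by Baker's method with exponential sums
  \<open>\<Sum> c(l) * \<gamma>(l) ^ \<tau> * exp (ell l * z)\<close>. The exponent vectors \<open>l\<close> are restricted to a thin slab
  on which the frequency \<open>ell l\<close> is almost constant. This costs only a factor \<open>(ln n) ^ \<delta>\<close> in the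
  number of coefficients, but lets each interpolation step gain that same factor per zero, so that
  no factor \<open>\<omega> ^ \<omega>\<close> is lost. No zero estimate is needed: extrapolating to points with denominator
  \<open>2 ^ (J + 1)\<close> and using the independence of square roots, one splits the sum by the residues of
  \<open>l\<close> modulo \<open>2 ^ (J + 1)\<close>, until a single term is left.
\<close>

section \<open>Siegel's lemma\<close>

lemma siegel_lemma:
  fixes A :: "'e \<Rightarrow> 'u \<Rightarrow> int" and K :: nat
  assumes fin: "finite U" "finite Q" and ne: "U \<noteq> {}"
    and card: "2 * card Q \<le> card U" and K: "K \<ge> 1"
    and A: "\<And>e l. e \<in> Q \<Longrightarrow> l \<in> U \<Longrightarrow> \<bar>A e l\<bar> \<le> int K"
  obtains c where "\<exists>l\<in>U. c l \<noteq> (0::int)" "\<And>l. l \<in> U \<Longrightarrow> \<bar>c l\<bar> \<le> int (2 * card U * K)"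
    "\<And>e. e \<in> Q \<Longrightarrow> (\<Sum>l\<in>U. A e l * c l) = 0"
proof -
  define N where "N = card U"
  define X where "X = 2 * N * K"
  have N1: "N \<ge> 1" using fin ne by (simp add: N_def Suc_leI card_gt_0_iff)
  have X1: "X \<ge> 1" using N1 K by (simp add: X_def)
  define V where "V = (\<Pi>\<^sub>E l\<in>U. {0..int X})"
  define F where "F = (\<lambda>v. \<lambda>e\<in>Q. \<Sum>l\<in>U. A e l * v l)"
  define R where "R = (\<Pi>\<^sub>E e\<in>Q. {- int (N * K * X)..int (N * K * X)})"
  have finR: "finite R" unfolding R_def using fin by (intro finite_PiE) auto
  have "F v \<in> R" if v: "v \<in> V" for v
  proof -
    have "\<bar>\<Sum>l\<in>U. A e l * v l\<bar> \<le> int (N * K * X)" if e: "e \<in> Q" for e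
    proof -
      have "\<bar>\<Sum>l\<in>U. A e l * v l\<bar> \<le> (\<Sum>l\<in>U. \<bar>A e l * v l\<bar>)" by (rule sum_abs)
      also have "\<dots> \<le> (\<Sum>l\<in>U. int (K * X))"
      proof (rule sum_mono)
        fix l assume l: "l \<in> U"
        have "\<bar>v l\<bar> \<le> int X" using v l unfolding V_def by (auto dest!: PiE_mem)
        then show "\<bar>A e l * v l\<bar> \<le> int (K * X)"
          using A[OF e l] by (simp add: abs_mult mult_mono)
      qed
      finally show ?thesis by (simp add: N_def)
    qed
    then show ?thesis unfolding F_def R_def by (force simp: abs_le_iff)
  qed
  then have sub: "F ` V \<subseteq> R" by auto
  have cV: "card V = (X + 1) ^ N"
    unfolding V_def using fin by (simp add: card_PiE N_def nat_add_distrib)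
  have "card R = (2 * (N * K * X) + 1) ^ card Q"
    unfolding R_def using fin by (simp add: card_PiE nat_add_distrib nat_mult_distrib mult_ac)
  also have "2 * (N * K * X) + 1 = X\<^sup>2 + 1" by (simp add: X_def power2_eq_square)
  finally have cR: "card R = (X\<^sup>2 + 1) ^ card Q" .
  have "(X\<^sup>2 + 1) ^ card Q < (X + 1) ^ N"
  proof (cases "card Q = 0")
    case True
    then show ?thesis using X1 N1 using one_less_power[of "X + 1" N] by simp
  next
    case False
    have "X\<^sup>2 + 1 < (X + 1)\<^sup>2" using X1 by (simp add: power2_eq_square)
    then have "(X\<^sup>2 + 1) ^ card Q < ((X + 1)\<^sup>2) ^ card Q"
      using False by (intro power_strict_mono) auto
    also have "\<dots> = (X + 1) ^ (2 * card Q)" by (simp add: power_mult)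
    also have "\<dots> \<le> (X + 1) ^ N" using card by (intro power_increasing) (auto simp: N_def)
    finally show ?thesis .
  qed
  then have "card (F ` V) < card V"
    using card_mono[OF finR sub] cV cR by linarith
  then have "\<not> inj_on F V" by (rule pigeonhole)
  then obtain v w where vw: "v \<in> V" "w \<in> V" "F v = F w" "v \<noteq> w" unfolding inj_on_def by auto
  define c where "c = (\<lambda>l. v l - w l)"
  show ?thesis
  proof (rule that[of c])
    show "\<exists>l\<in>U. c l \<noteq> 0"
      using vw PiE_ext[of v U _ w] unfolding V_def c_def by (metis eq_iff_diff_eq_0)
    show "\<bar>c l\<bar> \<le> int (2 * card U * K)" if "l \<in> U" for l
      using vw that PiE_mem[of v U _ l] PiE_mem[of w U _ l]
      unfolding V_def c_def X_def N_def by force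
    show "(\<Sum>l\<in>U. A e l * c l) = 0" if e: "e \<in> Q" for e
      using fun_cong[OF vw(3), of e] e by (simp add: F_def c_def right_diff_distrib sum_subtractf)
  qed
qed

definition multi_indices :: "'a set \<Rightarrow> nat \<Rightarrow> ('a \<Rightarrow> nat) set" where
  "multi_indices A T = {\<tau>. (\<forall>i. i \<notin> A \<longrightarrow> \<tau> i = 0) \<and> sum \<tau> A \<le> T}"

lemma card_multi_indices:
  assumes "finite A"
  shows "finite (multi_indices A T) \<and> card (multi_indices A T) \<le> (T + card A) choose (card A)"
  using assms
proof (induction A arbitrary: T rule: finite_induct)
  case empty
  have "multi_indices ({} :: 'a set) T = {\<lambda>_. 0}" by (auto simp: multi_indices_def)
  then show ?case by simp
next
  case (insert x A)
  have sub: "multi_indices (insert x A) T \<subseteq> (\<Union>j\<le>T. (\<lambda>\<tau>. \<tau>(x := j)) ` multi_indices A (T - j))"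
  proof
    fix \<tau> assume t: "\<tau> \<in> multi_indices (insert x A) T"
    have s: "\<tau> x + sum \<tau> A \<le> T" and z: "\<And>i. i \<noteq> x \<Longrightarrow> i \<notin> A \<Longrightarrow> \<tau> i = 0"
      using t insert.hyps by (auto simp: multi_indices_def)
    have "sum (\<tau>(x := 0)) A = sum \<tau> A" using insert.hyps by (intro sum.cong) auto
    then have "\<tau>(x := 0) \<in> multi_indices A (T - \<tau> x)" using s z by (auto simp: multi_indices_def)
    moreover have "\<tau> = (\<tau>(x := 0))(x := \<tau> x)" by auto
    ultimately show "\<tau> \<in> (\<Union>j\<le>T. (\<lambda>\<tau>. \<tau>(x := j)) ` multi_indices A (T - j))"
      using s by (metis (no_types, lifting) UN_iff add_leD1 atMost_iff image_eqI)
  qed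
  have fin: "finite (\<Union>j\<le>T. (\<lambda>\<tau>. \<tau>(x := j)) ` multi_indices A (T - j))"
    using insert.IH by auto
  have "card (multi_indices (insert x A) T) \<le> card (\<Union>j\<le>T. (\<lambda>\<tau>. \<tau>(x := j)) ` multi_indices A (T - j))"
    by (rule card_mono[OF fin sub])
  also have "\<dots> \<le> (\<Sum>j\<le>T. card ((\<lambda>\<tau>. \<tau>(x := j)) ` multi_indices A (T - j)))"
    by (rule card_UN_le) simp
  also have "\<dots> \<le> (\<Sum>j\<le>T. (T - j + card A) choose card A)"
    using insert.IH by (intro sum_mono) (meson card_image_le order_trans)
  also have "\<dots> = (\<Sum>j\<le>T. (card A + j) choose card A)"
    by (rule sum.reindex_bij_witness[where i="\<lambda>j. T - j" and j="\<lambda>j. T - j"]) (auto simp: add.commute)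
  also have "\<dots> = (card A + T + 1) choose (card A + 1)" by (rule choose_rising_sum(1))
  also have "\<dots> = (T + card (insert x A)) choose card (insert x A)"
    using insert.hyps by (simp add: add.commute del: binomial_Suc_Suc)
  finally show ?case using finite_subset[OF sub fin] by simp
qed

section \<open>Hermite interpolation of exponential sums\<close>

fun complete_sym :: "nat \<Rightarrow> real list \<Rightarrow> real" where
  "complete_sym 0 ys = 1"
| "complete_sym (Suc j) [] = 0"
| "complete_sym (Suc j) (y # ys) = complete_sym (Suc j) ys + y * complete_sym j (y # ys)"

lemma complete_sym_diff:
  "(x - y) * complete_sym j (x # y # ys) = complete_sym (Suc j) (x # ys) - complete_sym (Suc j) (y # ys)"
proof (induction j)
  case 0
  then show ?case by simp
next
  case (Suc j)
  have "(x - y) * complete_sym (Suc j) (x # y # ys)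
      = (x - y) * complete_sym (Suc j) (y # ys) + x * ((x - y) * complete_sym j (x # y # ys))"
    by (simp add: algebra_simps)
  then show ?case unfolding Suc.IH by (simp add: algebra_simps)
qed

lemma complete_sym_swap: "complete_sym j (x # y # ys) = complete_sym j (y # x # ys)"
proof (cases "x = y")
  case False
  have "(x - y) * complete_sym j (x # y # ys) = (x - y) * complete_sym j (y # x # ys)"
    using complete_sym_diff[of x y j ys] complete_sym_diff[of y x j ys] by (simp add: algebra_simps)
  then show ?thesis using False by simp
qed simp

lemma complete_sym_Cons_cong:
  assumes "\<And>j. complete_sym j xs = complete_sym j ys"
  shows "complete_sym j (z # xs) = complete_sym j (z # ys)"
  by (induction j) (simp_all add: assms)

lemma complete_sym_move: "complete_sym j (xs @ z # ys) = complete_sym j (z # xs @ ys)"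
proof (induction xs arbitrary: j)
  case (Cons x xs)
  have "complete_sym j (x # (xs @ z # ys)) = complete_sym j (x # z # xs @ ys)"
    by (rule complete_sym_Cons_cong) (rule Cons.IH)
  then show ?case by (simp add: complete_sym_swap)
qed simp

lemma complete_sym_mset: "mset xs = mset ys \<Longrightarrow> complete_sym j xs = complete_sym j ys"
proof (induction xs arbitrary: j ys)
  case (Cons x xs)
  have "x \<in> set ys" using Cons.prems by (metis list.set_intros(1) set_mset_mset)
  then obtain u v where ys: "ys = u @ x # v" by (meson split_list)
  have "mset xs = mset (u @ v)" using Cons.prems by (simp add: ys)
  then have "complete_sym j (x # xs) = complete_sym j (x # u @ v)"
    by (intro complete_sym_Cons_cong Cons.IH)
  then show ?case by (simp add: ys complete_sym_move)
qed simp

lemma complete_sym_replicate: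
  "complete_sym j (replicate (Suc k) y) = real ((j + k) choose k) * y ^ j"
proof (induction k arbitrary: j)
  case 0
  show ?case by (induction j) simp_all
next
  case (Suc k)
  show ?case
  proof (induction j)
    case (Suc j)
    have "complete_sym (Suc j) (replicate (Suc (Suc k)) y)
       = complete_sym (Suc j) (replicate (Suc k) y) + y * complete_sym j (replicate (Suc (Suc k)) y)"
      by simp
    also have "\<dots> = real ((Suc j + k) choose k) * y ^ Suc j + y * (real ((j + Suc k) choose Suc k) * y ^ j)"
      by (simp only: Suc.IH \<open>\<And>j. complete_sym j (replicate (Suc k) y) = real ((j + k) choose k) * y ^ j\<close>)
    also have "\<dots> = real ((Suc j + Suc k) choose Suc k) * y ^ Suc j"
      by (simp add: algebra_simps)
    finally show ?case .
  qed simp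
qed

lemma complete_sym_bound:
  assumes "\<forall>y\<in>set ys. \<bar>y\<bar> \<le> W" "W \<ge> 0"
  shows "\<bar>complete_sym j ys\<bar> \<le> complete_sym j (replicate (length ys) W)"
  using assms
proof (induction j ys rule: complete_sym.induct)
  case (3 j y ys)
  have "\<bar>y * complete_sym j (y # ys)\<bar> \<le> W * complete_sym j (replicate (length (y # ys)) W)"
    using 3 by (auto simp: abs_mult intro!: mult_mono)
  moreover have "\<bar>complete_sym (Suc j) ys\<bar> \<le> complete_sym (Suc j) (replicate (length ys) W)"
    using 3 by auto
  ultimately show ?case by simp
qed auto

definition exp_dd_term :: "real \<Rightarrow> real list \<Rightarrow> nat \<Rightarrow> real" where
  "exp_dd_term \<theta> ys j = \<theta> ^ (j + (length ys - 1)) / fact (j + (length ys - 1)) * complete_sym j ys"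

text \<open>The divided difference of \<open>z \<mapsto> exp (\<theta> * z)\<close> at the nodes \<open>ys\<close>, repetitions allowed.\<close>
definition exp_dd :: "real \<Rightarrow> real list \<Rightarrow> real" where
  "exp_dd \<theta> ys = (\<Sum>j. exp_dd_term \<theta> ys j)"

lemma exp_dd_term_replicate:
  "exp_dd_term \<theta> (replicate (Suc k) y) j = \<theta> ^ k / fact k * ((\<theta> * y) ^ j /\<^sub>R fact j)"
proof -
  have "real ((j + k) choose k) = fact (j + k) / (fact k * fact j)"
    by (simp add: binomial_fact)
  then show ?thesis
    unfolding exp_dd_term_def complete_sym_replicate
    by (simp add: power_add power_mult_distrib field_simps)
qed

lemma exp_dd_replicate: "exp_dd \<theta> (replicate (Suc k) y) = \<theta> ^ k / fact k * exp (\<theta> * y)"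
  unfolding exp_dd_def exp_dd_term_replicate exp_def
  by (rule suminf_mult) (rule summable_exp_generic)

lemma exp_dd_term_bound:
  assumes "\<forall>y\<in>set ys. \<bar>y\<bar> \<le> W" "W \<ge> 0" "length ys = Suc k"
  shows "\<bar>exp_dd_term \<theta> ys j\<bar> \<le> exp_dd_term \<bar>\<theta>\<bar> (replicate (Suc k) W) j"
  using complete_sym_bound[OF assms(1,2), of j] assms(3)
  unfolding exp_dd_term_def by (simp add: abs_mult power_abs divide_right_mono mult_left_mono del: replicate_Suc)

lemma summable_exp_dd_replicate: "summable (exp_dd_term \<theta> (replicate (Suc k) y))"
  unfolding exp_dd_term_replicate[abs_def] by (intro summable_mult summable_exp_generic)

lemma summable_exp_dd:
  assumes "ys \<noteq> []"
  shows "summable (exp_dd_term \<theta> ys)"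
proof -
  obtain k where k: "length ys = Suc k" using assms by (cases ys) auto
  define W where "W = (\<Sum>y\<leftarrow>ys. \<bar>y\<bar>)"
  have "\<bar>y\<bar> \<le> W" if "y \<in> set ys" for y
    unfolding W_def using that by (intro member_le_sum_list) auto
  moreover have "W \<ge> 0" unfolding W_def by (intro sum_list_nonneg) auto
  ultimately show ?thesis
    using exp_dd_term_bound[OF _ _ k]
    by (intro summable_comparison_test'[OF summable_exp_dd_replicate[of "\<bar>\<theta>\<bar>" k W]]) auto
qed

lemma exp_dd_bound:
  assumes "\<forall>y\<in>set ys. \<bar>y\<bar> \<le> W" "W \<ge> 0" "length ys = Suc k"
  shows "\<bar>exp_dd \<theta> ys\<bar> \<le> \<bar>\<theta>\<bar> ^ k / fact k * exp (\<bar>\<theta>\<bar> * W)"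
proof -
  have "norm (suminf (exp_dd_term \<theta> ys)) \<le> suminf (exp_dd_term \<bar>\<theta>\<bar> (replicate (Suc k) W))"
    using exp_dd_term_bound[OF assms]
    by (intro norm_suminf_le summable_exp_dd_replicate) auto
  then show ?thesis using exp_dd_replicate[of "\<bar>\<theta>\<bar>" k W] by (simp add: exp_dd_def)
qed

lemma exp_dd_diff: "(x - y) * exp_dd \<theta> (x # y # ys) = exp_dd \<theta> (x # ys) - exp_dd \<theta> (y # ys)"
proof -
  have s: "summable (exp_dd_term \<theta> (x # ys))" "summable (exp_dd_term \<theta> (y # ys))"
    by (simp_all add: summable_exp_dd)
  have "(x - y) * exp_dd_term \<theta> (x # y # ys) j
      = exp_dd_term \<theta> (x # ys) (Suc j) - exp_dd_term \<theta> (y # ys) (Suc j)" for j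
    using complete_sym_diff[of x y j ys] unfolding exp_dd_term_def
    by (simp add: mult.left_commute[of "x - y"] right_diff_distrib diff_divide_distrib del: complete_sym.simps fact_Suc power_Suc)
  then have "(x - y) * exp_dd \<theta> (x # y # ys)
      = (\<Sum>j. exp_dd_term \<theta> (x # ys) (Suc j) - exp_dd_term \<theta> (y # ys) (Suc j))"
    unfolding exp_dd_def by (subst suminf_mult[symmetric]) (simp_all add: summable_exp_dd)
  also have "\<dots> = (\<Sum>j. exp_dd_term \<theta> (x # ys) (Suc j)) - (\<Sum>j. exp_dd_term \<theta> (y # ys) (Suc j))"
    using s by (intro suminf_diff[symmetric]) (simp_all add: summable_Suc_iff)
  also have "\<dots> = exp_dd \<theta> (x # ys) - exp_dd \<theta> (y # ys)"
    unfolding exp_dd_def using suminf_split_head[OF s(1)] suminf_split_head[OF s(2)]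
    by (simp add: exp_dd_term_def)
  finally show ?thesis .
qed

lemma exp_dd_mset: "mset xs = mset ys \<Longrightarrow> exp_dd \<theta> xs = exp_dd \<theta> ys"
  unfolding exp_dd_def exp_dd_term_def
  using complete_sym_mset[of xs ys] mset_eq_length[of xs ys] by simp

lemma repeated_node_list:
  assumes "finite F"
  shows "\<exists>ys :: 'a list. length ys = t * card F \<and> set ys \<subseteq> F \<and> (\<forall>x. count (mset ys) x \<le> t)"
  using assms
proof (induction F rule: finite_induct)
  case (insert x F)
  then obtain ys where ys: "length ys = t * card F" "set ys \<subseteq> F" "\<forall>x. count (mset ys) x \<le> t" by blast
  have "count (mset ys) x = 0" using ys(2) insert.hyps by auto
  then have "length (replicate t x @ ys) = t * card (insert x F) \<and> set (replicate t x @ ys) \<subseteq> insert x F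
      \<and> (\<forall>z. count (mset (replicate t x @ ys)) z \<le> t)"
    using ys insert.hyps by auto
  then show ?case by blast
qed (simp add: exI[of _ "[]"])

lemma exp_sum_dd_small:
  fixes b \<theta> :: "'l \<Rightarrow> real"
  assumes gap: "\<And>x y. x \<in> F \<Longrightarrow> y \<in> F \<Longrightarrow> x \<noteq> y \<Longrightarrow> d \<le> \<bar>x - y\<bar>" and d: "0 < d" "d \<le> 2"
    and small: "\<And>x j. x \<in> F \<Longrightarrow> j < t \<Longrightarrow> \<bar>\<Sum>l\<in>U. b l * \<theta> l ^ j * exp (\<theta> l * x)\<bar> \<le> \<epsilon>"
    and "length ys = Suc k" "set ys \<subseteq> F" "\<forall>x. count (mset ys) x \<le> t"
  shows "\<bar>\<Sum>l\<in>U. b l * exp_dd (\<theta> l) ys\<bar> \<le> \<epsilon> * (2 / d) ^ k"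
  using assms(5-)
proof (induction k arbitrary: ys)
  case 0
  then obtain y where y: "ys = [y]" by (metis Suc_length_conv length_0_conv)
  have "0 < t" using 0(3)[rule_format, of y] y by simp
  then show ?case using small[of y 0] exp_dd_replicate[of _ 0 y] 0 y by simp
next
  case (Suc k)
  show ?case
  proof (cases "\<exists>x y zs. x \<noteq> y \<and> mset ys = mset (x # y # zs)")
    case True
    then obtain x y zs where xy: "x \<noteq> y" and ms: "mset ys = mset (x # y # zs)" by blast
    have st: "set ys = set (x # y # zs)" using ms by (metis set_mset_mset)
    have xF: "x \<in> F" "y \<in> F" using st Suc.prems(2) by auto
    have len: "length zs = k" using ms Suc.prems(1) mset_eq_length by fastforce
    have c: "count (mset (x # y # zs)) z \<le> t" for z using Suc.prems(3) ms by metis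
    have c1: "count (mset (x # zs)) z \<le> t" for z
      using c[of z] by (auto split: if_splits)
    have c2: "count (mset (y # zs)) z \<le> t" for z
      using c[of z] by (auto split: if_splits)
    have b1: "\<bar>\<Sum>l\<in>U. b l * exp_dd (\<theta> l) (x # zs)\<bar> \<le> \<epsilon> * (2 / d) ^ k"
      using st Suc.prems(2) len c1 by (intro Suc.IH) auto
    have b2: "\<bar>\<Sum>l\<in>U. b l * exp_dd (\<theta> l) (y # zs)\<bar> \<le> \<epsilon> * (2 / d) ^ k"
      using st Suc.prems(2) len c2 by (intro Suc.IH) auto
    have "(x - y) * (\<Sum>l\<in>U. b l * exp_dd (\<theta> l) ys)
        = (\<Sum>l\<in>U. b l * ((x - y) * exp_dd (\<theta> l) (x # y # zs)))"
      by (simp add: sum_distrib_left mult.left_commute exp_dd_mset[OF ms])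
    also have "\<dots> = (\<Sum>l\<in>U. b l * exp_dd (\<theta> l) (x # zs)) - (\<Sum>l\<in>U. b l * exp_dd (\<theta> l) (y # zs))"
      by (simp add: exp_dd_diff right_diff_distrib sum_subtractf)
    finally have eq: "(x - y) * (\<Sum>l\<in>U. b l * exp_dd (\<theta> l) ys) = \<dots>" .
    have "d * \<bar>\<Sum>l\<in>U. b l * exp_dd (\<theta> l) ys\<bar> \<le> \<bar>x - y\<bar> * \<bar>\<Sum>l\<in>U. b l * exp_dd (\<theta> l) ys\<bar>"
      using gap[OF xF xy] by (intro mult_right_mono) auto
    also have "\<dots> = \<bar>(x - y) * (\<Sum>l\<in>U. b l * exp_dd (\<theta> l) ys)\<bar>" by (simp add: abs_mult)
    also have "\<dots> \<le> 2 * (\<epsilon> * (2 / d) ^ k)" unfolding eq using b1 b2 by linarith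
    finally show ?thesis using d by (simp add: field_simps)
  next
    case False
    obtain y zs where y: "ys = y # zs" using Suc.prems(1) by (cases ys) auto
    have "z = y" if z: "z \<in> set zs" for z
    proof (rule ccontr)
      assume "z \<noteq> y"
      moreover obtain u v where "zs = u @ z # v" using z by (meson split_list)
      then have "mset ys = mset (z # y # (u @ v))" by (simp add: y)
      ultimately show False using False by blast
    qed
    then have "zs = replicate (length zs) y" by (simp add: replicate_length_same)
    then have ysr: "ys = replicate (Suc (Suc k)) y" using Suc.prems(1) y by (metis length_Cons nat.inject replicate_Suc)
    have t: "Suc k < t" using Suc.prems(3)[rule_format, of y] unfolding ysr by simp
    have "\<bar>\<Sum>l\<in>U. b l * exp_dd (\<theta> l) ys\<bar> = \<bar>(\<Sum>l\<in>U. b l * \<theta> l ^ Suc k * exp (\<theta> l * y)) / fact (Suc k)\<bar>"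
      unfolding ysr exp_dd_replicate by (simp add: sum_divide_distrib mult.assoc del: fact_Suc power_Suc)
    also have "\<dots> = \<bar>\<Sum>l\<in>U. b l * \<theta> l ^ Suc k * exp (\<theta> l * y)\<bar> / fact (Suc k)"
      by (simp add: abs_divide del: fact_Suc power_Suc)
    also have "\<dots> \<le> \<epsilon> / fact (Suc k)"
      using small[OF _ t, of y] Suc.prems(2) y by (intro divide_right_mono) auto
    also have "\<dots> \<le> \<epsilon> / 1"
      using small[OF _ t, of y] Suc.prems(2) y by (intro divide_left_mono) (auto simp del: fact_Suc power_Suc intro: order_trans[OF abs_ge_zero])
    also have "\<dots> \<le> \<epsilon> * (2 / d) ^ Suc k"
    proof -
      have "(1::real) \<le> (2 / d) ^ Suc k" using d by (intro one_le_power) simp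
      moreover have "0 \<le> \<epsilon>" using small[OF _ t, of y] Suc.prems(2) y by (auto intro: order_trans[OF abs_ge_zero])
      ultimately show ?thesis using mult_left_mono[of 1 "(2 / d) ^ Suc k" \<epsilon>] by simp
    qed
    finally show ?thesis .
  qed
qed

text \<open>Newton interpolation of \<open>w \<mapsto> \<Sum> b l * exp (\<theta> l * w)\<close> at the nodes \<open>F\<close>, each taken
  \<open>t\<close> times: the first summand bounds the remainder, the second one the interpolation polynomial.\<close>
lemma exp_sum_hermite_bound:
  fixes b \<theta> :: "'l \<Rightarrow> real"
  assumes gap: "\<And>x y. x \<in> F \<Longrightarrow> y \<in> F \<Longrightarrow> x \<noteq> y \<Longrightarrow> d \<le> \<bar>x - y\<bar>" and d: "0 < d" "d \<le> 2"
    and small: "\<And>x j. x \<in> F \<Longrightarrow> j < t \<Longrightarrow> \<bar>\<Sum>l\<in>U. b l * \<theta> l ^ j * exp (\<theta> l * x)\<bar> \<le> \<epsilon>"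
    and F: "finite F" "F \<subseteq> {0..W}" and w: "w \<in> {0..W}" and W: "W \<ge> 1" and eps: "\<epsilon> \<ge> 0"
    and th: "\<And>l. l \<in> U \<Longrightarrow> \<bar>\<theta> l\<bar> \<le> X" and X: "X \<ge> 0"
    and Z: "Z = t * card F"
  shows "\<bar>\<Sum>l\<in>U. b l * exp (\<theta> l * w)\<bar>
    \<le> (\<Sum>l\<in>U. \<bar>b l\<bar>) * ((X * W) ^ Z / fact Z * exp (X * W)) + \<epsilon> * real Z * (2 * W / d) ^ Z"
proof -
  define D where "D = (\<lambda>ys. \<Sum>l\<in>U. b l * exp_dd (\<theta> l) ys)"
  obtain ys where ys: "length ys = Z" "set ys \<subseteq> F" "\<forall>x. count (mset ys) x \<le> t"
    using repeated_node_list[OF F(1), of t] Z by blast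
  have dW: "1 \<le> 2 * W / d" using d W by simp
  have rec: "\<bar>D (w # zs)\<bar> \<le> \<bar>D (y # zs)\<bar> + W * \<bar>D (w # y # zs)\<bar>" if "y \<in> F" for y zs
  proof -
    have "D (w # zs) = D (y # zs) + (w - y) * D (w # y # zs)"
      unfolding D_def sum_distrib_left by (simp add: mult.left_commute[of "w - y"] exp_dd_diff right_diff_distrib sum_subtractf)
    moreover have "\<bar>(w - y) * D (w # y # zs)\<bar> \<le> W * \<bar>D (w # y # zs)\<bar>"
      unfolding abs_mult using subsetD[OF F(2) that] w by (intro mult_right_mono) auto
    ultimately show ?thesis by linarith
  qed
  have main: "\<bar>D [w]\<bar> \<le> real k * (\<epsilon> * (2 * W / d) ^ Z) + W ^ k * \<bar>D (w # rev (take k ys))\<bar>" if "k \<le> Z" for k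
    using that
  proof (induction k)
    case (Suc k)
    define y where "y = ys ! k"
    have tk: "rev (take (Suc k) ys) = y # rev (take k ys)"
      using Suc.prems ys(1) by (simp add: take_Suc_conv_app_nth y_def)
    have yF: "y \<in> F" using ys Suc.prems by (auto simp: y_def)
    have ms: "mset (y # rev (take k ys)) \<subseteq># mset ys"
      using tk by (metis append_take_drop_id mset_append mset_rev mset_subset_eq_add_left)
    have "\<bar>D (y # rev (take k ys))\<bar> \<le> \<epsilon> * (2 / d) ^ k"
      unfolding D_def
    proof (rule exp_sum_dd_small[OF gap d small])
      show "length (y # rev (take k ys)) = Suc k" using Suc.prems ys(1) by simp
      show "set (y # rev (take k ys)) \<subseteq> F" using yF ys(2) set_take_subset[of k ys] by auto
      show "\<forall>x. count (mset (y # rev (take k ys))) x \<le> t"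
        using ms ys(3) by (meson le_trans mset_subset_eq_count)
    qed auto
    then have "W ^ k * \<bar>D (y # rev (take k ys))\<bar> \<le> W ^ k * (\<epsilon> * (2 / d) ^ k)"
      using W by (intro mult_left_mono) auto
    also have "\<dots> = \<epsilon> * (2 * W / d) ^ k" by (simp add: power_mult_distrib power_divide)
    also have "\<dots> \<le> \<epsilon> * (2 * W / d) ^ Z"
      using dW eps Suc.prems by (intro mult_left_mono power_increasing) auto
    finally have 1: "W ^ k * \<bar>D (y # rev (take k ys))\<bar> \<le> \<epsilon> * (2 * W / d) ^ Z" .
    have "W ^ k * \<bar>D (w # rev (take k ys))\<bar>
        \<le> W ^ k * (\<bar>D (y # rev (take k ys))\<bar> + W * \<bar>D (w # y # rev (take k ys))\<bar>)"
      using W rec[OF yF] by (intro mult_left_mono) auto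
    also have "\<dots> = W ^ k * \<bar>D (y # rev (take k ys))\<bar> + W ^ Suc k * \<bar>D (w # y # rev (take k ys))\<bar>"
      by (simp add: algebra_simps)
    finally have 2: "W ^ k * \<bar>D (w # rev (take k ys))\<bar> \<le> \<dots>" .
    have IH: "\<bar>D [w]\<bar> \<le> real k * (\<epsilon> * (2 * W / d) ^ Z) + W ^ k * \<bar>D (w # rev (take k ys))\<bar>"
      using Suc by simp
    have "real (Suc k) * (\<epsilon> * (2 * W / d) ^ Z) = real k * (\<epsilon> * (2 * W / d) ^ Z) + \<epsilon> * (2 * W / d) ^ Z"
      by (simp add: algebra_simps)
    with IH 1 2 show ?case unfolding tk by linarith
  qed (simp add: D_def)
  have "\<bar>D (w # rev ys)\<bar> \<le> (\<Sum>l\<in>U. \<bar>b l\<bar> * (X ^ Z / fact Z * exp (X * W)))"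
    unfolding D_def
  proof (intro order_trans[OF sum_abs] sum_mono)
    fix l assume l: "l \<in> U"
    have "\<bar>exp_dd (\<theta> l) (w # rev ys)\<bar> \<le> \<bar>\<theta> l\<bar> ^ Z / fact Z * exp (\<bar>\<theta> l\<bar> * W)"
      using ys F w W by (intro exp_dd_bound) force+
    also have "\<dots> \<le> X ^ Z / fact Z * exp (X * W)"
      using th[OF l] X W by (intro mult_mono divide_right_mono power_mono) auto
    finally show "\<bar>b l * exp_dd (\<theta> l) (w # rev ys)\<bar> \<le> \<bar>b l\<bar> * (X ^ Z / fact Z * exp (X * W))"
      unfolding abs_mult by (rule mult_left_mono) simp
  qed
  then have "W ^ Z * \<bar>D (w # rev ys)\<bar> \<le> W ^ Z * (\<Sum>l\<in>U. \<bar>b l\<bar> * (X ^ Z / fact Z * exp (X * W)))"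
    using W by (intro mult_left_mono) auto
  also have "\<dots> = (\<Sum>l\<in>U. \<bar>b l\<bar>) * ((X * W) ^ Z / fact Z * exp (X * W))"
    unfolding sum_distrib_right[symmetric] power_mult_distrib by simp
  finally have "\<bar>D [w]\<bar> \<le> real Z * (\<epsilon> * (2 * W / d) ^ Z) + \<dots>"
    using main[of Z] ys(1) by simp
  moreover have "D [w] = (\<Sum>l\<in>U. b l * exp (\<theta> l * w))"
    unfolding D_def using exp_dd_replicate[of _ 0 w] by simp
  ultimately show ?thesis by (simp add: algebra_simps)
qed

section \<open>Rings generated by square roots\<close>

fun sqrt_field :: "nat list \<Rightarrow> real set" where
  "sqrt_field [] = \<rat>"
| "sqrt_field (\<alpha> # xs) = {x + y * sqrt (real \<alpha>) | x y. x \<in> sqrt_field xs \<and> y \<in> sqrt_field xs}"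

lemma sqrt_field_Rats: "q \<in> \<rat> \<Longrightarrow> q \<in> sqrt_field xs"
proof (induction xs)
  case (Cons \<alpha> xs)
  have "q = q + 0 * sqrt (real \<alpha>)" "0 \<in> sqrt_field ys" for ys
    by (simp, induction ys) (auto intro!: exI[of _ 0])
  then show ?case using Cons unfolding sqrt_field.simps by blast
qed simp

lemma sqrt_field_add: "x \<in> sqrt_field xs \<Longrightarrow> y \<in> sqrt_field xs \<Longrightarrow> x + y \<in> sqrt_field xs"
proof (induction xs arbitrary: x y)
  case (Cons \<alpha> xs)
  then obtain a b c d where "x = a + b * sqrt (real \<alpha>)" "y = c + d * sqrt (real \<alpha>)"
    and K: "a \<in> sqrt_field xs" "b \<in> sqrt_field xs" "c \<in> sqrt_field xs" "d \<in> sqrt_field xs" by auto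
  then have "x + y = (a + c) + (b + d) * sqrt (real \<alpha>)" by (simp add: algebra_simps)
  then show ?case using Cons.IH[OF K(1,3)] Cons.IH[OF K(2,4)] by auto
qed simp

lemma sqrt_field_mult: "x \<in> sqrt_field xs \<Longrightarrow> y \<in> sqrt_field xs \<Longrightarrow> x * y \<in> sqrt_field xs"
proof (induction xs arbitrary: x y)
  case (Cons \<alpha> xs)
  then obtain a b c d where eq: "x = a + b * sqrt (real \<alpha>)" "y = c + d * sqrt (real \<alpha>)"
    and K: "a \<in> sqrt_field xs" "b \<in> sqrt_field xs" "c \<in> sqrt_field xs" "d \<in> sqrt_field xs" by auto
  have "x * y = (a * c + real \<alpha> * (b * d)) + (a * d + b * c) * sqrt (real \<alpha>)"
    unfolding eq by (simp add: algebra_simps)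
  moreover have "real \<alpha> \<in> sqrt_field xs" by (rule sqrt_field_Rats) simp
  ultimately show ?case unfolding sqrt_field.simps
    using sqrt_field_add[OF Cons.IH[OF K(1,3)] Cons.IH[OF _ Cons.IH[OF K(2,4)]]]
      sqrt_field_add[OF Cons.IH[OF K(1,4)] Cons.IH[OF K(2,3)]] by blast
qed simp

lemma sqrt_field_uminus: "x \<in> sqrt_field xs \<Longrightarrow> - x \<in> sqrt_field xs"
  using sqrt_field_mult[of "-1" xs x] sqrt_field_Rats[of "-1" xs] by simp

lemma sqrt_field_diff: "x \<in> sqrt_field xs \<Longrightarrow> y \<in> sqrt_field xs \<Longrightarrow> x - y \<in> sqrt_field xs"
  using sqrt_field_add[of x xs "- y"] sqrt_field_uminus[of y xs] by simp

lemma sqrt_field_Cons_subset: "x \<in> sqrt_field xs \<Longrightarrow> x \<in> sqrt_field (\<alpha> # xs)"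
  using sqrt_field_Rats[of 0 xs] unfolding sqrt_field.simps
  by (intro CollectI exI[of _ x] exI[of _ 0]) simp

lemma sqrt_field_Cons_eq:
  assumes "sqrt (real \<alpha>) \<in> sqrt_field xs" and "x \<in> sqrt_field (\<alpha> # xs)"
  shows "x \<in> sqrt_field xs"
  using assms by (auto intro!: sqrt_field_add sqrt_field_mult)

lemma sqrt_field_inverse: "x \<in> sqrt_field xs \<Longrightarrow> inverse x \<in> sqrt_field xs"
proof (induction xs arbitrary: x)
  case (Cons \<alpha> xs)
  show ?case
  proof (cases "sqrt (real \<alpha>) \<in> sqrt_field xs")
    case True
    then show ?thesis
      using sqrt_field_Cons_eq[OF True Cons.prems] Cons.IH sqrt_field_Cons_subset by blast
  next
    case False
    obtain a b where x: "x = a + b * sqrt (real \<alpha>)" and K: "a \<in> sqrt_field xs" "b \<in> sqrt_field xs"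
      using Cons.prems by auto
    show ?thesis
    proof (cases "x = 0")
      case True
      then show ?thesis using sqrt_field_Rats[of 0 "\<alpha> # xs"] by simp
    next
      case nz: False
      define N where "N = a * a - real \<alpha> * (b * b)"
      have NK: "N \<in> sqrt_field xs"
        unfolding N_def by (intro sqrt_field_diff sqrt_field_mult K sqrt_field_Rats[OF Rats_of_nat])
      have fac: "N = x * (a - b * sqrt (real \<alpha>))"
        unfolding N_def x by (simp add: algebra_simps)
      have nz2: "a - b * sqrt (real \<alpha>) \<noteq> 0"
      proof
        assume 0: "a - b * sqrt (real \<alpha>) = 0"
        then have "b \<noteq> 0" using nz x by auto
        then have "sqrt (real \<alpha>) = a * inverse b" using 0 by (simp add: field_simps)
        then show False using False sqrt_field_mult[OF K(1) Cons.IH[OF K(2)]] by simp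
      qed
      have "inverse x = (a - b * sqrt (real \<alpha>)) * inverse N"
        using nz nz2 by (simp add: fac)
      then have "inverse x = a * inverse N + (- b * inverse N) * sqrt (real \<alpha>)"
        by (simp add: algebra_simps)
      then show ?thesis unfolding sqrt_field.simps
        using sqrt_field_mult[OF K(1) Cons.IH[OF NK]]
          sqrt_field_mult[OF sqrt_field_uminus[OF K(2)] Cons.IH[OF NK]] by blast
    qed
  qed
qed simp

lemma sqrt_Rats_imp_square:
  assumes "sqrt (real d) \<in> \<rat>"
  shows "\<exists>t::nat. d = t\<^sup>2"
proof -
  obtain m n :: nat where mn: "n \<noteq> 0" "\<bar>sqrt (real d)\<bar> = real m / real n" "coprime m n"
    using Rats_abs_nat_div_natE[OF assms] by metis
  have "real d = (real m / real n)\<^sup>2" using mn(2) by (metis abs_of_nonneg of_nat_0_le_iff real_sqrt_ge_zero real_sqrt_pow2)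
  then have "real (d * n\<^sup>2) = real (m\<^sup>2)" using mn(1) by (simp add: field_simps)
  then have eq: "d * n\<^sup>2 = m\<^sup>2" by (simp only: of_nat_eq_iff)
  then have "n dvd m" by (metis dvd_triv_right pow_divides_pow_iff zero_less_numeral pos2)
  then have "n = 1" using mn(3) by (metis coprime_absorb_right coprime_commute nat_dvd_1_iff_1)
  then show ?thesis using eq by auto
qed

definition nonsquare_mod :: "nat \<Rightarrow> nat set \<Rightarrow> bool" where
  "nonsquare_mod d I \<longleftrightarrow> (\<forall>J\<subseteq>I. \<not> (\<exists>t::nat. d * \<Prod>J = t\<^sup>2))"

lemma sqrt_notin_sqrt_field:
  assumes "nonsquare_mod d (set xs)" "distinct xs"
  shows "sqrt (real d) \<notin> sqrt_field xs"
  using assms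
proof (induction xs arbitrary: d)
  case Nil
  then show ?case using sqrt_Rats_imp_square[of d] by (auto simp: nonsquare_mod_def)
next
  case (Cons \<alpha> xs)
  have d: "sqrt (real d) \<notin> sqrt_field xs"
    using Cons.prems by (intro Cons.IH) (auto simp: nonsquare_mod_def)
  have "nonsquare_mod (d * \<alpha>) (set xs)"
    unfolding nonsquare_mod_def
  proof (intro allI impI)
    fix J assume J: "J \<subseteq> set xs"
    then have "\<alpha> \<notin> J" "finite J" using Cons.prems(2) by (auto intro: finite_subset)
    then have "d * \<alpha> * \<Prod>J = d * \<Prod>(insert \<alpha> J)" by simp
    then show "\<not> (\<exists>t. d * \<alpha> * \<Prod>J = t\<^sup>2)"
      using Cons.prems(1) J unfolding nonsquare_mod_def by (metis insert_mono list.simps(15))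
  qed
  then have da: "sqrt (real (d * \<alpha>)) \<notin> sqrt_field xs" using Cons.prems(2) by (intro Cons.IH) auto
  show ?case
  proof
    assume "sqrt (real d) \<in> sqrt_field (\<alpha> # xs)"
    then obtain x y where eq: "sqrt (real d) = x + y * sqrt (real \<alpha>)"
      and K: "x \<in> sqrt_field xs" "y \<in> sqrt_field xs" by auto
    have na: "sqrt (real \<alpha>) \<notin> sqrt_field xs"
      using d \<open>sqrt (real d) \<in> sqrt_field (\<alpha> # xs)\<close> sqrt_field_Cons_eq by blast
    have "real d = (x + y * sqrt (real \<alpha>)) * (x + y * sqrt (real \<alpha>))" by (simp flip: eq)
    also have "\<dots> = x * x + real \<alpha> * (y * y) + 2 * (x * y) * sqrt (real \<alpha>)"
      by (simp add: algebra_simps)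
    finally have sq: "real d - (x * x + real \<alpha> * (y * y)) = 2 * (x * y) * sqrt (real \<alpha>)" by simp
    have "x * y = 0"
    proof (rule ccontr)
      assume nz: "x * y \<noteq> 0"
      have "sqrt (real \<alpha>) = (real d - (x * x + real \<alpha> * (y * y))) * inverse (2 * (x * y))"
        unfolding sq using nz by (simp add: field_simps)
      also have "\<dots> \<in> sqrt_field xs"
        by (intro sqrt_field_mult sqrt_field_diff sqrt_field_add sqrt_field_inverse K
            sqrt_field_Rats[OF Rats_of_nat] sqrt_field_Rats[of 2]) simp
      finally show False using na by simp
    qed
    then show False
    proof (cases "y = 0")
      case True
      then show ?thesis using eq K d by simp
    next
      case False
      then have "x = 0" using \<open>x * y = 0\<close> by simp
      then have "sqrt (real (d * \<alpha>)) = y * real \<alpha>" using eq by (simp add: real_sqrt_mult)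
      then show ?thesis using da sqrt_field_mult[OF K(2) sqrt_field_Rats[of "real \<alpha>"]] by simp
    qed
  qed
qed

definition sign :: "bool \<Rightarrow> real" where "sign s = (if s then 1 else -1)"

lemma sign_simps [simp]: "sign True = 1" "sign False = -1" "sign s * sign s = 1" "\<bar>sign s\<bar> = 1"
  "sign (\<not> s) = - sign s"
  by (simp_all add: sign_def)

text \<open>Elements of the ring generated by the square roots of the entries of a list, together with
  their formal conjugates: \<open>X \<sigma>\<close> is the conjugate that multiplies the root of \<open>\<alpha>\<close> by \<open>sign (\<sigma> \<alpha>)\<close>.\<close>
fun conj_family :: "nat list \<Rightarrow> ((nat \<Rightarrow> bool) \<Rightarrow> real) \<Rightarrow> bool" where
  "conj_family [] X \<longleftrightarrow> (\<exists>z::int. \<forall>\<sigma>. X \<sigma> = of_int z)"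
| "conj_family (\<alpha> # xs) X \<longleftrightarrow> (\<exists>u v. conj_family xs u \<and> conj_family xs v \<and>
     (\<forall>\<sigma>. X \<sigma> = u \<sigma> + sign (\<sigma> \<alpha>) * sqrt (real \<alpha>) * v \<sigma>))"

lemma conj_family_of_int: "conj_family xs (\<lambda>_. of_int z)"
proof (induction xs arbitrary: z)
  case (Cons \<alpha> xs)
  show ?case unfolding conj_family.simps
    by (rule exI[of _ "\<lambda>_. of_int z"], rule exI[of _ "\<lambda>_. of_int 0"]) (use Cons[of 0] Cons[of z] in auto)
qed auto

lemma conj_family_add:
  "conj_family xs X \<Longrightarrow> conj_family xs Y \<Longrightarrow> conj_family xs (\<lambda>\<sigma>. X \<sigma> + Y \<sigma>)"
proof (induction xs arbitrary: X Y)
  case Nil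
  then obtain z z' :: int where "\<And>\<sigma>. X \<sigma> = of_int z" "\<And>\<sigma>. Y \<sigma> = of_int z'" by auto
  then show ?case by (auto intro!: exI[of _ "z + z'"])
next
  case (Cons \<alpha> xs)
  obtain u v where uv: "conj_family xs u" "conj_family xs v"
    "\<And>\<sigma>. X \<sigma> = u \<sigma> + sign (\<sigma> \<alpha>) * sqrt (real \<alpha>) * v \<sigma>" using Cons.prems(1) by auto
  obtain u' v' where uv': "conj_family xs u'" "conj_family xs v'"
    "\<And>\<sigma>. Y \<sigma> = u' \<sigma> + sign (\<sigma> \<alpha>) * sqrt (real \<alpha>) * v' \<sigma>" using Cons.prems(2) by auto
  show ?case unfolding conj_family.simps
    by (rule exI[of _ "\<lambda>\<sigma>. u \<sigma> + u' \<sigma>"], rule exI[of _ "\<lambda>\<sigma>. v \<sigma> + v' \<sigma>"])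
       (use Cons.IH uv uv' in \<open>auto simp: algebra_simps\<close>)
qed

lemma conj_family_mult:
  "conj_family xs X \<Longrightarrow> conj_family xs Y \<Longrightarrow> conj_family xs (\<lambda>\<sigma>. X \<sigma> * Y \<sigma>)"
proof (induction xs arbitrary: X Y)
  case Nil
  then obtain z z' :: int where "\<And>\<sigma>. X \<sigma> = of_int z" "\<And>\<sigma>. Y \<sigma> = of_int z'" by auto
  then show ?case by (auto intro!: exI[of _ "z * z'"])
next
  case (Cons \<alpha> xs)
  obtain u v where uv: "conj_family xs u" "conj_family xs v"
    "\<And>\<sigma>. X \<sigma> = u \<sigma> + sign (\<sigma> \<alpha>) * sqrt (real \<alpha>) * v \<sigma>" using Cons.prems(1) by auto
  obtain u' v' where uv': "conj_family xs u'" "conj_family xs v'"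
    "\<And>\<sigma>. Y \<sigma> = u' \<sigma> + sign (\<sigma> \<alpha>) * sqrt (real \<alpha>) * v' \<sigma>" using Cons.prems(2) by auto
  have "X \<sigma> * Y \<sigma> = (u \<sigma> * u' \<sigma> + of_int (int \<alpha>) * (v \<sigma> * v' \<sigma>))
      + sign (\<sigma> \<alpha>) * sqrt (real \<alpha>) * (u \<sigma> * v' \<sigma> + v \<sigma> * u' \<sigma>)" for \<sigma>
  proof -
    have "(sign (\<sigma> \<alpha>) * sqrt (real \<alpha>)) * (sign (\<sigma> \<alpha>) * sqrt (real \<alpha>)) = real \<alpha>"
      by (simp add: sign_def)
    moreover have "(a + s * b) * (c + s * d) = a * c + (s * s) * (b * d) + s * (a * d + b * c)"
      for a b c d s :: real by (simp add: algebra_simps)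
    ultimately show ?thesis unfolding uv(3) uv'(3) by simp
  qed
  moreover have "conj_family xs (\<lambda>\<sigma>. u \<sigma> * u' \<sigma> + of_int (int \<alpha>) * (v \<sigma> * v' \<sigma>))"
    by (intro conj_family_add Cons.IH uv uv' conj_family_of_int)
  moreover have "conj_family xs (\<lambda>\<sigma>. u \<sigma> * v' \<sigma> + v \<sigma> * u' \<sigma>)"
    by (intro conj_family_add Cons.IH uv uv' conj_family_of_int)
  ultimately show ?case unfolding conj_family.simps by blast
qed

lemma conj_family_sum:
  assumes "finite A" "\<And>a. a \<in> A \<Longrightarrow> conj_family xs (X a)"
  shows "conj_family xs (\<lambda>\<sigma>. \<Sum>a\<in>A. X a \<sigma>)"
  using assms
proof (induction A rule: finite_induct)
  case empty
  then show ?case using conj_family_of_int[of xs 0] by simp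
qed (simp add: conj_family_add)

lemma conj_family_prod:
  assumes "finite A" "\<And>a. a \<in> A \<Longrightarrow> conj_family xs (X a)"
  shows "conj_family xs (\<lambda>\<sigma>. \<Prod>a\<in>A. X a \<sigma>)"
  using assms
proof (induction A rule: finite_induct)
  case empty
  then show ?case using conj_family_of_int[of xs 1] by simp
qed (simp add: conj_family_mult)

lemma conj_family_power: "conj_family xs X \<Longrightarrow> conj_family xs (\<lambda>\<sigma>. X \<sigma> ^ n)"
  using conj_family_prod[of "{..<n}" xs "\<lambda>_. X"] by simp

lemma conj_family_root: "\<alpha> \<in> set xs \<Longrightarrow> conj_family xs (\<lambda>\<sigma>. sign (\<sigma> \<alpha>) * sqrt (real \<alpha>))"
proof (induction xs)
  case (Cons \<beta> xs)
  show ?case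
  proof (cases "\<alpha> = \<beta>")
    case True
    show ?thesis unfolding conj_family.simps True
      by (rule exI[of _ "\<lambda>_. of_int 0"], rule exI[of _ "\<lambda>_. of_int 1"])
         (use conj_family_of_int[of xs 0] conj_family_of_int[of xs 1] in auto)
  next
    case False
    then have "conj_family xs (\<lambda>\<sigma>. sign (\<sigma> \<alpha>) * sqrt (real \<alpha>))" using Cons by simp
    then show ?thesis unfolding conj_family.simps
      by (intro exI[of _ "\<lambda>\<sigma>. sign (\<sigma> \<alpha>) * sqrt (real \<alpha>)"] exI[of _ "\<lambda>_. of_int 0"])
         (use conj_family_of_int[of xs 0] conj_family_of_int[of xs 1] in auto)
  qed
qed simp

lemma conj_family_cong:
  assumes "conj_family xs X" "\<And>\<alpha>. \<alpha> \<in> set xs \<Longrightarrow> \<sigma> \<alpha> = \<sigma>' \<alpha>"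
  shows "X \<sigma> = X \<sigma>'"
  using assms
proof (induction xs arbitrary: X)
  case (Cons \<alpha> xs)
  obtain u v where uv: "conj_family xs u" "conj_family xs v"
    "\<And>\<sigma>. X \<sigma> = u \<sigma> + sign (\<sigma> \<alpha>) * sqrt (real \<alpha>) * v \<sigma>" using Cons.prems(1) by auto
  have "u \<sigma> = u \<sigma>'" "v \<sigma> = v \<sigma>'" using uv Cons by auto
  then show ?case using uv(3) Cons.prems(2) by simp
qed auto

lemma conj_family_in_sqrt_field: "conj_family xs X \<Longrightarrow> X \<sigma> \<in> sqrt_field xs"
proof (induction xs arbitrary: X)
  case (Cons \<alpha> xs)
  obtain u v where uv: "conj_family xs u" "conj_family xs v"
    "\<And>\<sigma>. X \<sigma> = u \<sigma> + sign (\<sigma> \<alpha>) * sqrt (real \<alpha>) * v \<sigma>" using Cons.prems by auto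
  have "X \<sigma> = u \<sigma> + (sign (\<sigma> \<alpha>) * v \<sigma>) * sqrt (real \<alpha>)" using uv(3) by simp
  moreover have "sign (\<sigma> \<alpha>) * v \<sigma> \<in> sqrt_field xs"
    by (intro sqrt_field_mult Cons.IH uv sqrt_field_Rats[of "sign (\<sigma> \<alpha>)"]) (auto simp: sign_def)
  ultimately show ?case using Cons.IH[OF uv(1)] by auto
qed auto

definition square_independent :: "nat set \<Rightarrow> bool" where
  "square_independent I \<longleftrightarrow> (\<forall>J\<subseteq>I. J \<noteq> {} \<longrightarrow> \<not> (\<exists>t::nat. \<Prod>J = t\<^sup>2))"

lemma square_independent_Cons:
  assumes "square_independent (set (\<alpha> # xs))" "distinct (\<alpha> # xs)"
  shows "sqrt (real \<alpha>) \<notin> sqrt_field xs"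
proof (rule sqrt_notin_sqrt_field)
  show "nonsquare_mod \<alpha> (set xs)" unfolding nonsquare_mod_def
  proof (intro allI impI)
    fix J assume J: "J \<subseteq> set xs"
    then have "\<alpha> * \<Prod>J = \<Prod>(insert \<alpha> J)"
      using assms(2) by (subst prod.insert) (auto intro: finite_subset)
    moreover have "insert \<alpha> J \<subseteq> set (\<alpha> # xs)" using J by auto
    ultimately show "\<not> (\<exists>t. \<alpha> * \<Prod>J = t\<^sup>2)"
      using assms(1) unfolding square_independent_def by (metis insert_not_empty)
  qed
qed (use assms in auto)

lemma square_independent_subset: "square_independent I \<Longrightarrow> J \<subseteq> I \<Longrightarrow> square_independent J"
  unfolding square_independent_def by blast

lemma conj_family_zero:
  assumes "square_independent (set xs)" "distinct xs" "conj_family xs X" "X \<sigma> = 0"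
  shows "X \<sigma>' = 0"
  using assms
proof (induction xs arbitrary: X)
  case (Cons \<alpha> xs)
  obtain u v where uv: "conj_family xs u" "conj_family xs v"
    "\<And>\<sigma>. X \<sigma> = u \<sigma> + sign (\<sigma> \<alpha>) * sqrt (real \<alpha>) * v \<sigma>" using Cons.prems(3) by auto
  have ind: "square_independent (set xs)" "distinct xs"
    using Cons.prems(1,2) square_independent_subset[OF Cons.prems(1), of "set xs"] by auto
  have K: "u \<sigma> \<in> sqrt_field xs" "v \<sigma> \<in> sqrt_field xs"
    using uv conj_family_in_sqrt_field by auto
  have 0: "u \<sigma> + sign (\<sigma> \<alpha>) * sqrt (real \<alpha>) * v \<sigma> = 0" using uv(3)[of \<sigma>] Cons.prems(4) by simp
  have "v \<sigma> = 0"
  proof (rule ccontr)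
    assume "v \<sigma> \<noteq> 0"
    then have "sqrt (real \<alpha>) = - sign (\<sigma> \<alpha>) * u \<sigma> * inverse (v \<sigma>)"
      using 0 by (cases "\<sigma> \<alpha>") (auto simp: field_simps)
    also have "\<dots> \<in> sqrt_field xs"
      by (intro sqrt_field_mult sqrt_field_inverse K sqrt_field_uminus sqrt_field_Rats[of "sign (\<sigma> \<alpha>)"]) (auto simp: sign_def)
    finally show False using square_independent_Cons[OF Cons.prems(1,2)] by simp
  qed
  then have "u \<sigma> = 0" using 0 by simp
  have "u \<sigma>' = 0" by (rule Cons.IH[OF ind uv(1) \<open>u \<sigma> = 0\<close>])
  moreover have "v \<sigma>' = 0" by (rule Cons.IH[OF ind uv(2) \<open>v \<sigma> = 0\<close>])
  ultimately show ?case using uv(3) by simp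
qed auto

lemma conj_family_lower_bound:
  assumes "square_independent (set xs)" "distinct xs" "conj_family xs X" "X \<sigma> \<noteq> 0"
    and "\<And>\<sigma>. \<bar>X \<sigma>\<bar> \<le> C" "C \<ge> 1"
  shows "\<bar>X \<sigma>\<bar> * C ^ (2 ^ length xs - 1) \<ge> 1"
  using assms
proof (induction xs arbitrary: X C)
  case Nil
  then obtain z :: int where "X \<sigma> = of_int z" by auto
  then have "\<bar>X \<sigma>\<bar> \<ge> 1" using Nil.prems(4) by simp
  then show ?case by simp
next
  case (Cons \<alpha> xs)
  obtain u v where uv: "conj_family xs u" "conj_family xs v"
    "\<And>\<sigma>. X \<sigma> = u \<sigma> + sign (\<sigma> \<alpha>) * sqrt (real \<alpha>) * v \<sigma>" using Cons.prems(3) by auto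
  have ind: "square_independent (set xs)" "distinct xs"
    using Cons.prems(1,2) square_independent_subset[OF Cons.prems(1), of "set xs"] by auto
  define flip where "flip \<sigma> = \<sigma>(\<alpha> := \<not> \<sigma> \<alpha>)" for \<sigma> :: "nat \<Rightarrow> bool"
  define Y where "Y \<sigma> = X \<sigma> * X (flip \<sigma>)" for \<sigma>
  have fl: "u (flip \<sigma>) = u \<sigma>" "v (flip \<sigma>) = v \<sigma>" for \<sigma>
    by (rule conj_family_cong[OF uv(1)] conj_family_cong[OF uv(2)]; use Cons.prems(2) in \<open>auto simp: flip_def\<close>)+
  have Y: "Y \<sigma> = u \<sigma> * u \<sigma> + of_int (- int \<alpha>) * (v \<sigma> * v \<sigma>)" for \<sigma>
  proof -
    have "X (flip \<sigma>) = u \<sigma> - sign (\<sigma> \<alpha>) * sqrt (real \<alpha>) * v \<sigma>"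
      unfolding uv(3) fl by (simp add: flip_def)
    moreover have "(sign (\<sigma> \<alpha>) * sqrt (real \<alpha>)) * (sign (\<sigma> \<alpha>) * sqrt (real \<alpha>)) = real \<alpha>"
      by (simp add: sign_def)
    moreover have "(a + s * b) * (a - s * b) = a * a - (s * s) * (b * b)"
      for a b s :: real by (simp add: algebra_simps)
    ultimately show ?thesis unfolding Y_def uv(3)[of \<sigma>] by simp
  qed
  have cfY: "conj_family xs Y"
    unfolding Y[abs_def] by (intro conj_family_add conj_family_mult uv conj_family_of_int)
  have Xf: "X (flip \<sigma>) \<noteq> 0"
    using conj_family_zero[OF Cons.prems(1-3)] Cons.prems(4) by blast
  then have Y0: "Y \<sigma> \<noteq> 0" using Cons.prems(4) by (simp add: Y_def)
  have "\<bar>Y \<sigma>\<bar> \<le> C\<^sup>2" for \<sigma>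
    unfolding Y_def abs_mult power2_eq_square using Cons.prems(5,6) by (intro mult_mono) auto
  then have "1 \<le> \<bar>Y \<sigma>\<bar> * (C\<^sup>2) ^ (2 ^ length xs - 1)"
    using Cons.prems(6) by (intro Cons.IH[OF ind cfY Y0]) auto
  also have "\<dots> = \<bar>X \<sigma>\<bar> * (\<bar>X (flip \<sigma>)\<bar> * C ^ (2 * (2 ^ length xs - 1)))"
    by (simp add: Y_def abs_mult flip: power_mult)
  also have "\<dots> \<le> \<bar>X \<sigma>\<bar> * (C * C ^ (2 * (2 ^ length xs - 1)))"
    using Cons.prems(5,6) by (intro mult_left_mono mult_right_mono) auto
  also have "C * C ^ (2 * (2 ^ length xs - 1)) = C ^ Suc (2 * (2 ^ length xs - 1))" by simp
  also have "Suc (2 * (2 ^ length xs - 1)) = 2 ^ length (\<alpha> # xs) - 1"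
    by (cases "2 ^ length xs :: nat") auto
  finally show ?case .
qed

section \<open>Linear forms in logarithms\<close>

lemma abs_exp_minus_one_le:
  fixes y :: real
  assumes "\<bar>y\<bar> \<le> 1"
  shows "\<bar>exp y - 1\<bar> \<le> 2 * \<bar>y\<bar>"
proof (cases "y \<ge> 0")
  case True
  have "y\<^sup>2 \<le> y" using True assms by (simp add: power2_eq_square mult_left_le)
  then show ?thesis using exp_bound[of y] exp_ge_add_one_self[of y] True assms by linarith
next
  case False
  then have "exp y \<le> 1" by simp
  then show ?thesis using exp_ge_add_one_self[of y] False by linarith
qed

lemma power_div_fact_le_exp:
  fixes x :: real
  assumes "x \<ge> 0"
  shows "x ^ n / fact n \<le> exp x"
proof -
  have "sum (\<lambda>n. x ^ n /\<^sub>R fact n) {n} \<le> suminf (\<lambda>n. x ^ n /\<^sub>R fact n)"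
    using assms by (intro sum_le_suminf summable_exp_generic) auto
  then show ?thesis by (simp add: exp_def field_simps)
qed

locale linear_form =
  fixes I :: "nat set" and a :: "nat \<Rightarrow> int" and p0 :: nat
  assumes finI: "finite I" and ge2: "\<And>\<alpha>. \<alpha> \<in> I \<Longrightarrow> \<alpha> \<ge> 2"
    and p0: "p0 \<in> I" and ap0: "a p0 \<noteq> 0"
begin

definition ell :: "(nat \<Rightarrow> nat) \<Rightarrow> real" where
  "ell l = (\<Sum>\<alpha>\<in>I. real (l \<alpha>) * ln (real \<alpha>))"

definition Lam :: real where
  "Lam = (\<Sum>\<alpha>\<in>I. of_int (a \<alpha>) * ln (real \<alpha>))"

definition gam :: "nat \<Rightarrow> (nat \<Rightarrow> nat) \<Rightarrow> int" where
  "gam \<alpha> l = a p0 * int (l \<alpha>) - a \<alpha> * int (l p0)"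

definition wt :: "(nat \<Rightarrow> nat) \<Rightarrow> (nat \<Rightarrow> nat) \<Rightarrow> int" where
  "wt \<tau> l = (\<Prod>\<alpha>\<in>I - {p0}. gam \<alpha> l ^ \<tau> \<alpha>)"

definition tot :: "(nat \<Rightarrow> nat) \<Rightarrow> nat" where
  "tot \<tau> = sum \<tau> (I - {p0})"

definition ev :: "((nat \<Rightarrow> nat) \<Rightarrow> int) \<Rightarrow> (nat \<Rightarrow> nat) set \<Rightarrow> (nat \<Rightarrow> nat) \<Rightarrow> real \<Rightarrow> real" where
  "ev c U \<tau> x = (\<Sum>l\<in>U. of_int (c l * wt \<tau> l) * exp (ell l * x))"

text \<open>The frequency \<open>ell l\<close> with \<open>ln p0\<close> eliminated by means of \<open>Lam = 0\<close>. It is linear in the integers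
  \<open>gam \<alpha> l\<close>, so differentiating the sum with frequencies \<open>red l\<close> only raises the degree of the
  weights \<open>wt \<tau> l\<close>.\<close>
definition red :: "(nat \<Rightarrow> nat) \<Rightarrow> real" where
  "red l = ell l - real (l p0) * Lam / of_int (a p0)"

lemma red_eq: "red l = (\<Sum>\<alpha>\<in>I - {p0}. of_int (gam \<alpha> l) * (ln (real \<alpha>) / of_int (a p0)))"
proof -
  have e: "ell l = real (l p0) * ln (real p0) + (\<Sum>\<alpha>\<in>I - {p0}. real (l \<alpha>) * ln (real \<alpha>))"
    unfolding ell_def by (rule sum.remove[OF finI p0])
  have L: "Lam = of_int (a p0) * ln (real p0) + (\<Sum>\<alpha>\<in>I - {p0}. of_int (a \<alpha>) * ln (real \<alpha>))"
    unfolding Lam_def by (rule sum.remove[OF finI p0])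
  have "of_int (a p0) * (\<Sum>\<alpha>\<in>I - {p0}. of_int (gam \<alpha> l) * (ln (real \<alpha>) / of_int (a p0)))
      = (\<Sum>\<alpha>\<in>I - {p0}. of_int (gam \<alpha> l) * ln (real \<alpha>))"
    unfolding sum_distrib_left using ap0 by (intro sum.cong) auto
  also have "\<dots> = of_int (a p0) * (\<Sum>\<alpha>\<in>I - {p0}. real (l \<alpha>) * ln (real \<alpha>))
      - real (l p0) * (\<Sum>\<alpha>\<in>I - {p0}. of_int (a \<alpha>) * ln (real \<alpha>))"
    unfolding sum_distrib_left by (simp add: gam_def sum_subtractf[symmetric] algebra_simps)
  also have "\<dots> = of_int (a p0) * red l"
    unfolding red_def using e L ap0 by (simp add: field_simps)
  finally show ?thesis using ap0 by simp
qed

lemma wt_upd: "\<alpha> \<in> I - {p0} \<Longrightarrow> wt (\<tau>(\<alpha> := Suc (\<tau> \<alpha>))) l = wt \<tau> l * gam \<alpha> l"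
proof -
  assume \<alpha>: "\<alpha> \<in> I - {p0}"
  have fin: "finite (I - {p0})" using finI by simp
  have "(\<Prod>\<beta>\<in>I - {p0} - {\<alpha>}. gam \<beta> l ^ (\<tau>(\<alpha> := Suc (\<tau> \<alpha>))) \<beta>) = (\<Prod>\<beta>\<in>I - {p0} - {\<alpha>}. gam \<beta> l ^ \<tau> \<beta>)"
    by (intro prod.cong) auto
  then show ?thesis
    unfolding wt_def prod.remove[OF fin \<alpha>] by simp
qed

lemma tot_upd: "\<alpha> \<in> I - {p0} \<Longrightarrow> tot (\<tau>(\<alpha> := Suc (\<tau> \<alpha>))) = Suc (tot \<tau>)"
proof -
  assume \<alpha>: "\<alpha> \<in> I - {p0}"
  have fin: "finite (I - {p0})" using finI by simp
  have "sum (\<tau>(\<alpha> := Suc (\<tau> \<alpha>))) (I - {p0} - {\<alpha>}) = sum \<tau> (I - {p0} - {\<alpha>})"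
    by (intro sum.cong) auto
  then show ?thesis unfolding tot_def sum.remove[OF fin \<alpha>] by simp
qed

lemma ev_power_zero:
  assumes zero: "\<And>\<tau>. tot \<tau> \<le> D \<Longrightarrow> ev c U \<tau> x = 0" and "tot \<tau> + j \<le> D"
  shows "(\<Sum>l\<in>U. of_int (c l * wt \<tau> l) * (red l - u) ^ j * exp (ell l * x)) = 0"
  using assms(2)
proof (induction j arbitrary: \<tau>)
  case 0
  then show ?case using zero[of \<tau>] by (simp add: ev_def)
next
  case (Suc j)
  define f where "f \<tau> l = of_int (c l * wt \<tau> l) * (red l - u) ^ j * exp (ell l * x)" for \<tau> l
  have IH: "(\<Sum>l\<in>U. f \<tau>' l) = 0" if "tot \<tau>' + j \<le> D" for \<tau>'
    unfolding f_def by (rule Suc.IH[OF that])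
  have "of_int (c l * wt \<tau> l) * (red l - u) ^ Suc j * exp (ell l * x)
      = (\<Sum>\<alpha>\<in>I - {p0}. ln (real \<alpha>) / of_int (a p0) * f (\<tau>(\<alpha> := Suc (\<tau> \<alpha>))) l) - u * f \<tau> l" for l
  proof -
    have "of_int (c l * wt \<tau> l) * (red l - u) ^ Suc j * exp (ell l * x) = red l * f \<tau> l - u * f \<tau> l"
      by (simp add: f_def algebra_simps)
    also have "red l * f \<tau> l = (\<Sum>\<alpha>\<in>I - {p0}. ln (real \<alpha>) / of_int (a p0) * f (\<tau>(\<alpha> := Suc (\<tau> \<alpha>))) l)"
      unfolding red_eq sum_distrib_right
      by (intro sum.cong refl) (simp add: f_def wt_upd algebra_simps)
    finally show ?thesis .
  qed
  then have "(\<Sum>l\<in>U. of_int (c l * wt \<tau> l) * (red l - u) ^ Suc j * exp (ell l * x))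
      = (\<Sum>\<alpha>\<in>I - {p0}. ln (real \<alpha>) / of_int (a p0) * (\<Sum>l\<in>U. f (\<tau>(\<alpha> := Suc (\<tau> \<alpha>))) l)) - u * (\<Sum>l\<in>U. f \<tau> l)"
    by (simp add: sum_subtractf sum_distrib_left sum.swap[of _ U])
  also have "\<dots> = 0" using Suc.prems IH by (simp add: tot_upd)
  finally show ?case .
qed

lemma extrapolate:
  assumes U: "\<And>l. l \<in> U \<Longrightarrow> u \<le> ell l \<and> ell l \<le> u + X \<and> real (l p0) \<le> D"
    and F: "finite F" "F \<subseteq> {0..W}" and w: "w \<in> {0..W}" and W: "W \<ge> 1"
    and gap: "\<And>x y. x \<in> F \<Longrightarrow> y \<in> F \<Longrightarrow> x \<noteq> y \<Longrightarrow> d \<le> \<bar>x - y\<bar>" and d: "0 < d" "d \<le> 2"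
    and zero: "\<And>\<tau> x. tot \<tau> \<le> Dz \<Longrightarrow> x \<in> F \<Longrightarrow> ev c U \<tau> x = 0" and \<tau>: "tot \<tau> + t \<le> Dz"
    and Mc: "(\<Sum>l\<in>U. \<bar>of_int (c l * wt \<tau> l)\<bar>) \<le> Mc"
    and X: "X \<ge> 0" "2 * X \<le> Xm" "1 \<le> Xm" and D: "D * \<bar>Lam\<bar> \<le> X" "D * \<bar>Lam\<bar> * W \<le> 1" "D \<ge> 0"
    and Z: "Z = t * card F" and eta: "\<eta> = 2 * (D * \<bar>Lam\<bar> * W) * exp (X * W)"
  shows "\<bar>ev c U \<tau> w\<bar> * exp (- (u * w))
    \<le> Mc * ((2 * X * W) ^ Z / fact Z * exp (2 * X * W)) + Mc * \<eta> * (real Z * (2 * W / d * Xm) ^ Z + 1)"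
proof -
  define b where "b l = (of_int (c l * wt \<tau> l) :: real)" for l
  define \<theta> where "\<theta> l = red l - u" for l
  have Mc0: "Mc \<ge> 0" by (rule order_trans[OF _ Mc]) (simp add: sum_nonneg)
  have \<kappa>: "\<bar>real (l p0) * Lam / of_int (a p0)\<bar> \<le> D * \<bar>Lam\<bar>" if "l \<in> U" for l
  proof -
    have "\<bar>real (l p0) * Lam / of_int (a p0)\<bar> = real (l p0) * \<bar>Lam\<bar> / \<bar>of_int (a p0)\<bar>"
      by (simp add: abs_mult)
    also have "\<dots> \<le> real (l p0) * \<bar>Lam\<bar> / 1"
      using ap0 by (intro divide_left_mono) auto
    also have "\<dots> \<le> D * \<bar>Lam\<bar>" using U[OF that] by (simp add: mult_right_mono)
    finally show ?thesis .
  qed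
  have \<theta>: "\<bar>\<theta> l\<bar> \<le> 2 * X" if "l \<in> U" for l
  proof -
    have "u \<le> ell l" "ell l \<le> u + X" using U[OF that] by auto
    moreover define q where "q = real (l p0) * Lam / of_int (a p0)"
    moreover have "\<bar>q\<bar> \<le> X" using \<kappa>[OF that] D(1) unfolding q_def by (rule order_trans)
    ultimately show ?thesis using X(1) unfolding \<theta>_def red_def q_def[symmetric] by linarith
  qed
  have diff: "\<bar>exp (\<theta> l * x) - exp ((ell l - u) * x)\<bar> \<le> \<eta>" if l: "l \<in> U" and x: "x \<in> {0..W}" for l x
  proof -
    define y where "y = - (real (l p0) * Lam / of_int (a p0)) * x"
    have "\<bar>y\<bar> \<le> D * \<bar>Lam\<bar> * W"
      unfolding y_def abs_mult abs_minus_cancel using \<kappa>[OF l] x W D(3) by (intro mult_mono) auto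
    then have y: "\<bar>exp y - 1\<bar> \<le> 2 * (D * \<bar>Lam\<bar> * W)"
      using abs_exp_minus_one_le[of y] D(2) by linarith
    have "exp (\<theta> l * x) - exp ((ell l - u) * x) = exp ((ell l - u) * x) * (exp y - 1)"
      unfolding \<theta>_def red_def y_def by (simp add: algebra_simps flip: exp_add)
    then have "\<bar>exp (\<theta> l * x) - exp ((ell l - u) * x)\<bar> = exp ((ell l - u) * x) * \<bar>exp y - 1\<bar>"
      by (simp add: abs_mult)
    also have "\<dots> \<le> exp (X * W) * (2 * (D * \<bar>Lam\<bar> * W))"
      using U[OF l] x X W by (intro mult_mono y) (auto intro!: mult_mono)
    finally show ?thesis by (simp add: eta mult.commute)
  qed
  have eta0: "\<eta> \<ge> 0" unfolding eta using D W by simp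
  have small: "\<bar>\<Sum>l\<in>U. b l * \<theta> l ^ j * exp (\<theta> l * x)\<bar> \<le> Mc * \<eta> * Xm ^ t" if x: "x \<in> F" and j: "j < t" for x j
  proof -
    have xW: "x \<in> {0..W}" using x F by auto
    have "(\<Sum>l\<in>U. b l * \<theta> l ^ j * exp (ell l * x)) = 0"
      unfolding b_def \<theta>_def using \<tau> j by (intro ev_power_zero[where D = Dz] zero x) auto
    then have "(\<Sum>l\<in>U. b l * \<theta> l ^ j * exp ((ell l - u) * x)) = 0"
      by (simp add: left_diff_distrib exp_diff sum_divide_distrib[symmetric])
    then have "\<bar>\<Sum>l\<in>U. b l * \<theta> l ^ j * exp (\<theta> l * x)\<bar>
        = \<bar>\<Sum>l\<in>U. b l * \<theta> l ^ j * (exp (\<theta> l * x) - exp ((ell l - u) * x))\<bar>"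
      by (simp add: right_diff_distrib sum_subtractf)
    also have "\<dots> \<le> (\<Sum>l\<in>U. \<bar>b l\<bar> * (Xm ^ t * \<eta>))"
    proof (intro order_trans[OF sum_abs] sum_mono)
      fix l assume l: "l \<in> U"
      have "\<bar>\<theta> l\<bar> ^ j \<le> Xm ^ j" using \<theta>[OF l] X by (intro power_mono) auto
      also have "\<dots> \<le> Xm ^ t" using X j by (intro power_increasing) auto
      finally have "\<bar>\<theta> l ^ j * (exp (\<theta> l * x) - exp ((ell l - u) * x))\<bar> \<le> Xm ^ t * \<eta>"
        unfolding abs_mult power_abs using diff[OF l xW] X by (intro mult_mono) auto
      then show "\<bar>b l * \<theta> l ^ j * (exp (\<theta> l * x) - exp ((ell l - u) * x))\<bar> \<le> \<bar>b l\<bar> * (Xm ^ t * \<eta>)"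
        unfolding abs_mult mult.assoc by (intro mult_left_mono) auto
    qed
    also have "\<dots> \<le> Mc * (Xm ^ t * \<eta>)"
      unfolding sum_distrib_right[symmetric] using Mc X eta0 by (intro mult_right_mono) (auto simp: b_def)
    finally show ?thesis by (simp add: mult_ac)
  qed
  have "\<bar>\<Sum>l\<in>U. b l * exp (\<theta> l * w)\<bar> \<le> (\<Sum>l\<in>U. \<bar>b l\<bar>) * ((2 * X * W) ^ Z / fact Z * exp (2 * X * W))
      + Mc * \<eta> * Xm ^ t * real Z * (2 * W / d) ^ Z"
    using exp_sum_hermite_bound[OF gap d small F w W _ \<theta>, of t Z] X Z Mc0 eta0 by simp
  also have "\<dots> \<le> Mc * ((2 * X * W) ^ Z / fact Z * exp (2 * X * W)) + Mc * \<eta> * (real Z * (2 * W / d * Xm) ^ Z)"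
  proof (intro add_mono mult_right_mono)
    show "(\<Sum>l\<in>U. \<bar>b l\<bar>) \<le> Mc" using Mc by (simp add: b_def)
    show "0 \<le> (2 * X * W) ^ Z / fact Z * exp (2 * X * W)" using X W by simp
    show "Mc * \<eta> * Xm ^ t * real Z * (2 * W / d) ^ Z \<le> Mc * \<eta> * (real Z * (2 * W / d * Xm) ^ Z)"
    proof (cases "card F = 0")
      case True
      then show ?thesis using Z by simp
    next
      case False
      then have "Xm ^ t \<le> Xm ^ Z" using X Z by (intro power_increasing) auto
      then have "(Mc * \<eta> * real Z * (2 * W / d) ^ Z) * Xm ^ t \<le> (Mc * \<eta> * real Z * (2 * W / d) ^ Z) * Xm ^ Z"
        using Mc0 eta0 W d by (intro mult_left_mono) auto
      then show ?thesis unfolding power_mult_distrib[of _ Xm] by (simp only: mult_ac)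
    qed
  qed
  finally have 1: "\<bar>\<Sum>l\<in>U. b l * exp (\<theta> l * w)\<bar> \<le> \<dots>" .
  have "\<bar>(\<Sum>l\<in>U. b l * exp ((ell l - u) * w)) - (\<Sum>l\<in>U. b l * exp (\<theta> l * w))\<bar>
      = \<bar>\<Sum>l\<in>U. b l * (exp (\<theta> l * w) - exp ((ell l - u) * w))\<bar>"
    by (subst abs_minus_commute) (simp add: right_diff_distrib sum_subtractf)
  also have "\<dots> \<le> (\<Sum>l\<in>U. \<bar>b l\<bar> * \<eta>)"
    by (intro order_trans[OF sum_abs] sum_mono) (auto simp: abs_mult intro!: mult_left_mono diff w)
  also have "\<dots> \<le> Mc * \<eta>"
    unfolding sum_distrib_right[symmetric] using Mc eta0 by (intro mult_right_mono) (auto simp: b_def)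
  finally have 2: "\<bar>(\<Sum>l\<in>U. b l * exp ((ell l - u) * w)) - (\<Sum>l\<in>U. b l * exp (\<theta> l * w))\<bar> \<le> Mc * \<eta>" .
  have "\<bar>ev c U \<tau> w\<bar> * exp (- (u * w)) = \<bar>ev c U \<tau> w * exp (- (u * w))\<bar>" by (simp add: abs_mult)
  also have "ev c U \<tau> w * exp (- (u * w)) = (\<Sum>l\<in>U. b l * exp ((ell l - u) * w))"
    unfolding ev_def sum_distrib_right b_def by (intro sum.cong refl) (simp add: left_diff_distrib exp_diff exp_minus field_simps)
  finally have "\<bar>ev c U \<tau> w\<bar> * exp (- (u * w)) = \<bar>\<Sum>l\<in>U. b l * exp ((ell l - u) * w)\<bar>" .
  moreover have "Mc * \<eta> * (real Z * (2 * W / d * Xm) ^ Z + 1)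
      = Mc * \<eta> * (real Z * (2 * W / d * Xm) ^ Z) + Mc * \<eta>" by (simp add: algebra_simps)
  ultimately show ?thesis using 1 2 by linarith
qed

lemma exp_ell_split:
  assumes "\<And>\<alpha>. \<alpha> \<in> I \<Longrightarrow> l \<alpha> mod 2 ^ J = \<rho> \<alpha>"
  shows "exp (ell l * (real s / 2 ^ J)) = exp (ell \<rho> * (real s / 2 ^ J)) * real (\<Prod>\<alpha>\<in>I. \<alpha> ^ ((l \<alpha> div 2 ^ J) * s))"
    and "exp (ell l * (real s / 2 ^ Suc J)) = exp (ell \<rho> * (real s / 2 ^ Suc J))
      * (\<Prod>\<alpha>\<in>I. sqrt (real \<alpha>) ^ ((l \<alpha> div 2 ^ J) * s))"
proof -
  have l: "real (l \<alpha>) = real (\<rho> \<alpha>) + 2 ^ J * real (l \<alpha> div 2 ^ J)" if "\<alpha> \<in> I" for \<alpha>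
    using assms[OF that] by (metis add.commute mult_div_mod_eq of_nat_add of_nat_mult of_nat_numeral of_nat_power)
  have pos: "real \<alpha> > 0" if "\<alpha> \<in> I" for \<alpha> using ge2[OF that] by simp
  have e: "ell l = ell \<rho> + 2 ^ J * (\<Sum>\<alpha>\<in>I. real (l \<alpha> div 2 ^ J) * ln (real \<alpha>))"
    unfolding ell_def sum_distrib_left sum.distrib[symmetric]
    by (intro sum.cong refl) (simp add: l algebra_simps)
  have p: "exp (ln (real \<alpha>) * real n) = real \<alpha> ^ n" if "\<alpha> \<in> I" for \<alpha> n
    unfolding exp_of_nat2_mult using pos[OF that] by simp
  have q: "exp (ln (real \<alpha>) / 2 * real n) = sqrt (real \<alpha>) ^ n" if "\<alpha> \<in> I" for \<alpha> n
  proof -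
    have "exp (ln (real \<alpha>) / 2) = sqrt (real \<alpha>)"
      using pos[OF that] by (simp add: ln_sqrt[symmetric] del: ln_sqrt)
    then show ?thesis by (simp only: exp_of_nat2_mult)
  qed
  have "exp (ell l * (real s / 2 ^ J)) = exp (ell \<rho> * (real s / 2 ^ J))
      * exp (\<Sum>\<alpha>\<in>I. ln (real \<alpha>) * real ((l \<alpha> div 2 ^ J) * s))"
    unfolding e exp_add[symmetric] by (simp add: algebra_simps sum_distrib_left)
  also have "exp (\<Sum>\<alpha>\<in>I. ln (real \<alpha>) * real ((l \<alpha> div 2 ^ J) * s)) = (\<Prod>\<alpha>\<in>I. real \<alpha> ^ ((l \<alpha> div 2 ^ J) * s))"
    unfolding exp_sum[OF finI] by (intro prod.cong refl p)
  finally show "exp (ell l * (real s / 2 ^ J)) = exp (ell \<rho> * (real s / 2 ^ J)) * real (\<Prod>\<alpha>\<in>I. \<alpha> ^ ((l \<alpha> div 2 ^ J) * s))"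
    by simp
  have "exp (ell l * (real s / 2 ^ Suc J)) = exp (ell \<rho> * (real s / 2 ^ Suc J))
      * exp (\<Sum>\<alpha>\<in>I. ln (real \<alpha>) / 2 * real ((l \<alpha> div 2 ^ J) * s))"
    unfolding e exp_add[symmetric] by (simp add: algebra_simps sum_distrib_left sum_divide_distrib)
  also have "exp (\<Sum>\<alpha>\<in>I. ln (real \<alpha>) / 2 * real ((l \<alpha> div 2 ^ J) * s)) = (\<Prod>\<alpha>\<in>I. sqrt (real \<alpha>) ^ ((l \<alpha> div 2 ^ J) * s))"
    unfolding exp_sum[OF finI] by (intro prod.cong refl q)
  finally show "exp (ell l * (real s / 2 ^ Suc J)) = exp (ell \<rho> * (real s / 2 ^ Suc J))
      * (\<Prod>\<alpha>\<in>I. sqrt (real \<alpha>) ^ ((l \<alpha> div 2 ^ J) * s))" .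
qed

lemma ell_nonneg: "ell l \<ge> 0"
  unfolding ell_def using ge2 by (intro sum_nonneg mult_nonneg_nonneg) (auto intro!: ln_ge_zero dest!: ge2)

lemma ev_nonzero_ge_one:
  assumes "\<And>l \<alpha>. l \<in> U \<Longrightarrow> \<alpha> \<in> I \<Longrightarrow> l \<alpha> mod 2 ^ J = \<rho> \<alpha>" and "ev c U \<tau> (real s / 2 ^ J) \<noteq> 0"
  shows "\<bar>ev c U \<tau> (real s / 2 ^ J)\<bar> \<ge> 1"
proof -
  define z where "z = (\<Sum>l\<in>U. c l * wt \<tau> l * int (\<Prod>\<alpha>\<in>I. \<alpha> ^ ((l \<alpha> div 2 ^ J) * s)))"
  have eq: "ev c U \<tau> (real s / 2 ^ J) = exp (ell \<rho> * (real s / 2 ^ J)) * of_int z"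
    unfolding ev_def z_def of_int_sum sum_distrib_left
  proof (intro sum.cong refl)
    fix l assume l: "l \<in> U"
    show "of_int (c l * wt \<tau> l) * exp (ell l * (real s / 2 ^ J)) = exp (ell \<rho> * (real s / 2 ^ J))
        * of_int (c l * wt \<tau> l * int (\<Prod>\<alpha>\<in>I. \<alpha> ^ ((l \<alpha> div 2 ^ J) * s)))"
      by (subst exp_ell_split(1)[of l J \<rho> s]) (use assms(1)[OF l] in auto)
  qed
  then have "z \<noteq> 0" using assms(2) by auto
  then have "1 \<le> \<bar>of_int z :: real\<bar>" by simp
  moreover have "1 \<le> exp (ell \<rho> * (real s / 2 ^ J))" using ell_nonneg by simp
  ultimately show ?thesis unfolding eq abs_mult
    by (metis abs_exp_cancel mult_mono mult_1 abs_ge_zero zero_le_one order_trans)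
qed

end

lemma sign_sum_split:
  fixes f :: "'l \<Rightarrow> real" and g :: "'i \<Rightarrow> real" and e :: "'l \<Rightarrow> 'i \<Rightarrow> nat"
  assumes fin: "finite U" "finite I" and zero: "\<And>\<sigma>. (\<Sum>l\<in>U. f l * (\<Prod>\<alpha>\<in>I. (sign (\<sigma> \<alpha>) * g \<alpha>) ^ e l \<alpha>)) = 0"
  shows "(\<Sum>l | l \<in> U \<and> (\<forall>\<alpha>\<in>I. odd (e l \<alpha>) = \<epsilon> \<alpha>). f l * (\<Prod>\<alpha>\<in>I. g \<alpha> ^ e l \<alpha>)) = 0"
proof -
  define h where "h \<sigma> l = f l * (\<Prod>\<alpha>\<in>I. (sign (\<sigma> \<alpha>) * g \<alpha>) ^ e l \<alpha>)" for \<sigma> l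
  have "(\<Sum>l | l \<in> U \<and> (\<forall>\<alpha>\<in>K. odd (e l \<alpha>) = \<epsilon> \<alpha>). h \<sigma> l) = 0" if "K \<subseteq> I" for K \<sigma>
    using finite_subset[OF that fin(2)] that
  proof (induction K arbitrary: \<sigma> rule: finite_induct)
    case empty
    then show ?case using zero by (simp add: h_def)
  next
    case (insert \<beta> K)
    define V where "V = {l \<in> U. \<forall>\<alpha>\<in>K. odd (e l \<alpha>) = \<epsilon> \<alpha>}"
    define V1 where "V1 = {l \<in> V. odd (e l \<beta>) = \<epsilon> \<beta>}"
    have finV: "finite V" using fin by (simp add: V_def)
    define \<sigma>' where "\<sigma>' = \<sigma>(\<beta> := \<not> \<sigma> \<beta>)"
    have \<beta>: "\<beta> \<in> I" using insert.prems by simp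
    have flip: "h \<sigma>' l = (if odd (e l \<beta>) then -1 else 1) * h \<sigma> l" for l
    proof -
      have "(\<Prod>\<alpha>\<in>I - {\<beta>}. (sign (\<sigma>' \<alpha>) * g \<alpha>) ^ e l \<alpha>) = (\<Prod>\<alpha>\<in>I - {\<beta>}. (sign (\<sigma> \<alpha>) * g \<alpha>) ^ e l \<alpha>)"
        by (intro prod.cong) (auto simp: \<sigma>'_def)
      moreover have "(sign (\<sigma>' \<beta>) * g \<beta>) ^ e l \<beta> = (if odd (e l \<beta>) then -1 else 1) * (sign (\<sigma> \<beta>) * g \<beta>) ^ e l \<beta>"
        by (simp add: \<sigma>'_def)
      ultimately show ?thesis unfolding h_def prod.remove[OF fin(2) \<beta>] by simp
    qed
    have 0: "(\<Sum>l\<in>V. h \<sigma> l) = 0" "(\<Sum>l\<in>V. h \<sigma>' l) = 0"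
      using insert unfolding V_def by auto
    have "(\<Sum>l\<in>V. h \<sigma> l + (if \<epsilon> \<beta> then -1 else 1) * h \<sigma>' l) = 0"
      unfolding sum.distrib sum_distrib_left[symmetric] 0 by simp
    moreover have "(\<Sum>l\<in>V. h \<sigma> l + (if \<epsilon> \<beta> then -1 else 1) * h \<sigma>' l) = (\<Sum>l\<in>V. if odd (e l \<beta>) = \<epsilon> \<beta> then 2 * h \<sigma> l else 0)"
      by (intro sum.cong refl) (auto simp: flip)
    moreover have "\<dots> = 2 * (\<Sum>l\<in>V1. h \<sigma> l)"
      unfolding V1_def sum.inter_filter[OF finV] sum_distrib_left by (intro sum.cong) auto
    ultimately have "(\<Sum>l\<in>V1. h \<sigma> l) = 0" by simp
    moreover have "V1 = {l \<in> U. \<forall>\<alpha>\<in>insert \<beta> K. odd (e l \<alpha>) = \<epsilon> \<alpha>}"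
      unfolding V1_def V_def by auto
    ultimately show ?case by simp
  qed
  from this[of I "\<lambda>_. True"] show ?thesis by (simp add: h_def)
qed

locale baker = linear_form +
  fixes L :: "nat \<Rightarrow> nat" and m S B r :: nat and E Y :: real
  assumes sqi: "square_independent I" and r: "r = card I"
    and m: "m \<ge> 1" and S: "S \<ge> 1" and E: "E \<ge> 1" and Y: "Y \<ge> 1" and B1: "B \<ge> 1"
    and L: "\<And>\<alpha>. \<alpha> \<in> I \<Longrightarrow> L \<alpha> \<le> 2 ^ m" "\<And>\<alpha>. \<alpha> \<in> I \<Longrightarrow> real (L \<alpha>) * ln (real \<alpha>) \<le> Y"
    and B: "\<And>\<alpha>. \<alpha> \<in> I \<Longrightarrow> \<bar>a \<alpha>\<bar> \<le> int B"
begin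

definition G :: nat where "G = 2 * B * 2 ^ m"
definition W :: real where "W = real S * 4 ^ r"
definition X :: real where "X = Y / (W * E)"
definition T :: nat where "T = 4 * r * 2 ^ m"
definition Usz :: real where "Usz = 1 + 2 * real m * real r + 2 * real T * ln (real G) + real r * Y * real S"
definition box :: "(nat \<Rightarrow> nat) set" where "box = (\<Pi>\<^sub>E \<alpha>\<in>I. {..<L \<alpha>})"
definition Zm :: nat where "Zm = S * 4 ^ r * r * 2 ^ m"
definition Qf :: real where "Qf = 2 * W * 2 ^ m * (2 * Y + 1) * E"

lemma r1: "r \<ge> 1" using finI p0 r by (metis Suc_leI card_gt_0_iff empty_iff One_nat_def)

lemma G1: "G \<ge> 1" unfolding G_def using B1 by simp

lemma W1: "W \<ge> 1"
proof -
  have "1 * 1 \<le> real S * 4 ^ r" using S by (intro mult_mono) auto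
  then show ?thesis by (simp add: W_def)
qed

lemma X0: "X > 0" unfolding X_def using W1 E Y by simp

lemma XW: "X * W \<le> Y" "2 * X * W = 2 * Y / E" "2 * X \<le> 2 * Y + 1"
proof -
  show 1: "2 * X * W = 2 * Y / E" unfolding X_def using W1 E by (simp add: field_simps)
  have "Y / E \<le> Y / 1" using E Y by (intro divide_left_mono) auto
  then show 2: "X * W \<le> Y" using 1 by simp
  have "X * 1 \<le> X * W" using X0 W1 by (intro mult_left_mono) auto
  then show "2 * X \<le> 2 * Y + 1" using 2 Y by linarith
qed

lemma fin_box: "finite box" unfolding box_def using finI by (intro finite_PiE) auto

lemma box_le: "l \<in> box \<Longrightarrow> \<alpha> \<in> I \<Longrightarrow> l \<alpha> < L \<alpha>" unfolding box_def by (auto dest: PiE_mem)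

lemma card_box: "card box = (\<Prod>\<alpha>\<in>I. L \<alpha>)" unfolding box_def using finI by (simp add: card_PiE)

lemma card_box_le: "card box \<le> 2 ^ (m * r)"
proof -
  have "card box \<le> (\<Prod>\<alpha>\<in>I. 2 ^ m)" unfolding card_box by (intro prod_mono) (use L in auto)
  then show ?thesis by (simp add: r power_mult)
qed

lemma ell_box: "l \<in> box \<Longrightarrow> ell l \<le> real r * Y"
proof -
  assume l: "l \<in> box"
  have "ell l \<le> (\<Sum>\<alpha>\<in>I. Y)" unfolding ell_def
  proof (rule sum_mono)
    fix \<alpha> assume \<alpha>: "\<alpha> \<in> I"
    have "real (l \<alpha>) * ln (real \<alpha>) \<le> real (L \<alpha>) * ln (real \<alpha>)"
      using box_le[OF l \<alpha>] ge2[OF \<alpha>] by (intro mult_right_mono) auto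
    then show "real (l \<alpha>) * ln (real \<alpha>) \<le> Y" using L(2)[OF \<alpha>] by linarith
  qed
  then show ?thesis by (simp add: r)
qed

lemma gam_box: "l \<in> box \<Longrightarrow> \<alpha> \<in> I \<Longrightarrow> \<bar>gam \<alpha> l\<bar> \<le> int G"
proof -
  assume l: "l \<in> box" and \<alpha>: "\<alpha> \<in> I"
  have b: "int (l \<beta>) \<le> 2 ^ m" if "\<beta> \<in> I" for \<beta>
  proof -
    have "l \<beta> \<le> 2 ^ m" using box_le[OF l that] L(1)[OF that] by linarith
    then show ?thesis by (metis of_nat_le_iff of_nat_numeral of_nat_power)
  qed
  have "\<bar>gam \<alpha> l\<bar> \<le> \<bar>a p0\<bar> * int (l \<alpha>) + \<bar>a \<alpha>\<bar> * int (l p0)"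
    unfolding gam_def using abs_triangle_ineq4[of "a p0 * int (l \<alpha>)" "a \<alpha> * int (l p0)"] by (simp add: abs_mult)
  also have "\<dots> \<le> int B * 2 ^ m + int B * 2 ^ m"
    using B \<alpha> p0 b by (intro add_mono mult_mono) auto
  finally show ?thesis by (simp add: G_def)
qed

lemma wt_box:
  assumes "l \<in> box" "tot \<tau> \<le> T"
  shows "\<bar>wt \<tau> l\<bar> \<le> int G ^ T"
proof -
  have "\<bar>wt \<tau> l\<bar> = (\<Prod>\<alpha>\<in>I - {p0}. \<bar>gam \<alpha> l\<bar> ^ \<tau> \<alpha>)" by (simp add: wt_def abs_prod power_abs)
  also have "\<dots> \<le> (\<Prod>\<alpha>\<in>I - {p0}. int G ^ \<tau> \<alpha>)"
    using gam_box[OF assms(1)] by (intro prod_mono) (auto intro!: power_mono)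
  also have "\<dots> = int G ^ tot \<tau>" by (simp add: tot_def power_sum)
  also have "\<dots> \<le> int G ^ T" using assms(2) G1 by (intro power_increasing) auto
  finally show ?thesis .
qed

lemma slab_exists:
  assumes cnt: "(real r * W * E + 1) * (2 * real q) \<le> real (card box)" and q: "q \<ge> 1"
  obtains u Lset where "0 \<le> u" "u \<le> real r * Y" "Lset \<subseteq> box" "2 * q \<le> card Lset"
    "\<And>l. l \<in> Lset \<Longrightarrow> u \<le> ell l \<and> ell l \<le> u + X"
proof -
  define idx where "idx l = nat \<lfloor>ell l / X\<rfloor>" for l
  define N where "N = nat \<lfloor>real r * W * E\<rfloor> + 1"
  have WE: "W * E \<ge> 1" using W1 E by (metis mult_mono mult_1 zero_le_one order_trans)
  have "idx l < N" if "l \<in> box" for l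
  proof -
    have "ell l / X \<le> real r * Y / X" using ell_box[OF that] X0 by (intro divide_right_mono) auto
    also have "\<dots> = real r * W * E" unfolding X_def using Y W1 E by simp
    finally have "\<lfloor>ell l / X\<rfloor> \<le> \<lfloor>real r * W * E\<rfloor>" by (rule floor_mono)
    then show ?thesis unfolding idx_def N_def by (simp add: nat_mono le_imp_less_Suc)
  qed
  then have sub: "box = (\<Union>i<N. {l \<in> box. idx l = i})" by auto
  have "\<exists>i<N. 2 * q \<le> card {l \<in> box. idx l = i}"
  proof (rule ccontr)
    assume "\<not> ?thesis"
    then have lt: "card {l \<in> box. idx l = i} < 2 * q" if "i < N" for i using that by auto
    have "card box \<le> (\<Sum>i<N. card {l \<in> box. idx l = i})"
      by (subst sub) (rule card_UN_le, simp)
    also have "\<dots> < (\<Sum>i<N. 2 * q)" using lt by (intro sum_strict_mono) (auto simp: N_def)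
    finally have "card box < N * (2 * q)" by simp
    then have "real (card box) < real N * (2 * real q)" by (metis of_nat_less_iff of_nat_mult of_nat_numeral)
    moreover have "0 \<le> real r * W * E" using WE W1 E by simp
    then have "real N \<le> real r * W * E + 1" unfolding N_def by (simp add: of_nat_floor)
    then have "real N * (2 * real q) \<le> (real r * W * E + 1) * (2 * real q)" by (intro mult_right_mono) auto
    ultimately show False using cnt by linarith
  qed
  then obtain i where i: "2 * q \<le> card {l \<in> box. idx l = i}" by blast
  define u where "u = real i * X"
  have sl: "u \<le> ell l \<and> ell l \<le> u + X" if "l \<in> {l \<in> box. idx l = i}" for l
  proof -
    have nn: "0 \<le> ell l / X" using ell_nonneg X0 by simp
    have "real i = of_int \<lfloor>ell l / X\<rfloor>" using that nn unfolding idx_def by force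
    then have "real i \<le> ell l / X" "ell l / X \<le> real i + 1" by linarith+
    then show ?thesis unfolding u_def using X0 by (simp add: field_simps)
  qed
  have "{l \<in> box. idx l = i} \<noteq> {}" using i q by (metis card.empty le_zero_eq mult_is_0 not_one_le_zero zero_neq_numeral)
  then obtain l where l: "l \<in> {l \<in> box. idx l = i}" by blast
  show ?thesis
  proof (rule that[of u "{l \<in> box. idx l = i}"])
    show "0 \<le> u" unfolding u_def using X0 by simp
    show "u \<le> real r * Y" using sl[OF l] ell_box l by force
  qed (use i sl in auto)
qed

lemma exp_ell_nat: "exp (ell l * real s) = real (\<Prod>\<alpha>\<in>I. \<alpha> ^ (l \<alpha> * s))"
  using exp_ell_split(1)[of l 0 "\<lambda>_. 0" s] by (simp add: ell_def)

lemma auxiliary_function: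
  assumes Lset: "Lset \<subseteq> box" "2 * (((T + (r - 1)) choose (r - 1)) * S) \<le> card Lset" "Lset \<noteq> {}"
  obtains c where "\<exists>l\<in>Lset. c l \<noteq> 0"
    "\<And>\<tau> s. tot \<tau> \<le> T \<Longrightarrow> s < S \<Longrightarrow> ev c Lset \<tau> (real s) = 0"
    "\<And>\<tau> U. tot \<tau> \<le> T \<Longrightarrow> U \<subseteq> Lset \<Longrightarrow> (\<Sum>l\<in>U. \<bar>of_int (c l * wt \<tau> l)\<bar>) \<le> exp Usz"
proof -
  have fin: "finite Lset" using Lset fin_box finite_subset by auto
  define Q where "Q = multi_indices (I - {p0}) T \<times> {..<S}"
  define P where "P = (\<Prod>\<alpha>\<in>I. \<alpha> ^ (L \<alpha> * S))"
  define K where "K = G ^ T * P"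
  define A where "A e l = wt (fst e) l * int (\<Prod>\<alpha>\<in>I. \<alpha> ^ (l \<alpha> * snd e))" for e l
  have cI: "card (I - {p0}) = r - 1" using p0 finI r by simp
  have mi: "finite (multi_indices (I - {p0}) T)" "card (multi_indices (I - {p0}) T) \<le> (T + (r - 1)) choose (r - 1)"
    using card_multi_indices[of "I - {p0}" T] finI cI by auto
  have cQ: "2 * card Q \<le> card Lset"
    unfolding Q_def card_cartesian_product card_lessThan
    using Lset(2) mult_le_mono1[OF mi(2), of S] by linarith
  have P1: "P \<ge> 1" unfolding P_def using ge2 by (intro prod_ge_1) force
  have K1: "K \<ge> 1" unfolding K_def using P1 G1 by simp
  have A: "\<bar>A e l\<bar> \<le> int K" if e: "e \<in> Q" and l: "l \<in> Lset" for e l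
  proof -
    have lb: "l \<in> box" using l Lset by auto
    have "\<bar>wt (fst e) l\<bar> \<le> int G ^ T"
      using e by (intro wt_box lb) (auto simp: Q_def multi_indices_def tot_def)
    moreover have "(\<Prod>\<alpha>\<in>I. \<alpha> ^ (l \<alpha> * snd e)) \<le> P" unfolding P_def
      using ge2 box_le[OF lb] e by (intro prod_mono) (force simp: Q_def intro!: power_increasing mult_le_mono)
    then have "int (\<Prod>\<alpha>\<in>I. \<alpha> ^ (l \<alpha> * snd e)) \<le> int P" by (simp only: of_nat_le_iff)
    then have "\<bar>int (\<Prod>\<alpha>\<in>I. \<alpha> ^ (l \<alpha> * snd e))\<bar> \<le> int P" by (simp only: abs_of_nat)
    ultimately show ?thesis unfolding A_def K_def abs_mult of_nat_mult of_nat_power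
      by (intro mult_mono) (auto simp del: of_nat_prod)
  qed
  have finQ: "finite Q" using mi by (simp add: Q_def)
  obtain c where c: "\<exists>l\<in>Lset. c l \<noteq> (0::int)" "\<And>l. l \<in> Lset \<Longrightarrow> \<bar>c l\<bar> \<le> int (2 * card Lset * K)"
    "\<And>e. e \<in> Q \<Longrightarrow> (\<Sum>l\<in>Lset. A e l * c l) = 0"
    by (rule siegel_lemma[OF fin finQ Lset(3) cQ K1 A]) auto
  show ?thesis
  proof (rule that[of c])
    show "\<exists>l\<in>Lset. c l \<noteq> 0" by (rule c(1))
    show "ev c Lset \<tau> (real s) = 0" if \<tau>: "tot \<tau> \<le> T" and s: "s < S" for \<tau> s
    proof -
      define \<tau>' where "\<tau>' \<alpha> = (if \<alpha> \<in> I - {p0} then \<tau> \<alpha> else 0)" for \<alpha>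
      have w: "wt \<tau>' = wt \<tau>" unfolding wt_def \<tau>'_def by (intro ext prod.cong) auto
      have "sum \<tau>' (I - {p0}) = tot \<tau>" unfolding tot_def \<tau>'_def by (intro sum.cong) auto
      then have "(\<tau>', s) \<in> Q" using \<tau> s by (auto simp: Q_def multi_indices_def \<tau>'_def)
      from c(3)[OF this] have "(\<Sum>l\<in>Lset. wt \<tau> l * int (\<Prod>\<alpha>\<in>I. \<alpha> ^ (l \<alpha> * s)) * c l) = 0"
        by (simp add: A_def w)
      then have "real_of_int (\<Sum>l\<in>Lset. wt \<tau> l * int (\<Prod>\<alpha>\<in>I. \<alpha> ^ (l \<alpha> * s)) * c l) = 0" by simp
      then show ?thesis unfolding ev_def exp_ell_nat of_int_sum
        by (simp add: mult_ac)
    qed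
    show "(\<Sum>l\<in>U. \<bar>of_int (c l * wt \<tau> l)\<bar>) \<le> exp Usz" if \<tau>: "tot \<tau> \<le> T" and U: "U \<subseteq> Lset" for \<tau> U
    proof -
      define M where "M = real (2 ^ (m * r))"
      have M1: "M \<ge> 1" by (simp add: M_def)
      have cL: "real (card Lset) \<le> M"
        using card_mono[OF fin_box Lset(1)] card_box_le unfolding M_def by (meson le_trans of_nat_le_iff)
      have "(\<Sum>l\<in>U. \<bar>of_int (c l * wt \<tau> l) :: real\<bar>) \<le> (\<Sum>l\<in>Lset. \<bar>of_int (c l * wt \<tau> l)\<bar>)"
        using U fin by (intro sum_mono2) auto
      also have "\<dots> \<le> (\<Sum>l\<in>Lset. (2 * M * real K) * real G ^ T)"
      proof (rule sum_mono)
        fix l assume l: "l \<in> Lset"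
        have "\<bar>real_of_int (c l)\<bar> = real_of_int \<bar>c l\<bar>" by simp
        also have "\<dots> \<le> real_of_int (int (2 * card Lset * K))" using c(2)[OF l] by (simp only: of_int_le_iff)
        also have "\<dots> = 2 * real (card Lset) * real K" by simp
        also have "\<dots> \<le> 2 * M * real K" using cL by (intro mult_right_mono) auto
        finally have 1: "\<bar>real_of_int (c l)\<bar> \<le> 2 * M * real K" .
        have "\<bar>wt \<tau> l\<bar> \<le> int G ^ T" using l Lset \<tau> by (intro wt_box) auto
        then have "real_of_int \<bar>wt \<tau> l\<bar> \<le> real_of_int (int G ^ T)" by (simp only: of_int_le_iff)
        then have 2: "\<bar>real_of_int (wt \<tau> l)\<bar> \<le> real G ^ T" by simp
        show "\<bar>of_int (c l * wt \<tau> l)\<bar> \<le> (2 * M * real K) * real G ^ T"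
          unfolding of_int_mult abs_mult using 1 2 M1 by (intro mult_mono) auto
      qed
      also have "\<dots> = real (card Lset) * ((2 * M * real K) * real G ^ T)" by simp
      also have "\<dots> \<le> M * ((2 * M * real K) * real G ^ T)" using cL M1 by (intro mult_right_mono) auto
      also have "\<dots> = 2 * M\<^sup>2 * (real G ^ T)\<^sup>2 * real P" by (simp add: K_def power2_eq_square)
      also have "\<dots> \<le> exp 1 * exp (2 * real m * real r) * exp (2 * real T * ln (real G)) * exp (real r * Y * real S)"
      proof (intro mult_mono)
        show "(2::real) \<le> exp 1" using exp_ge_add_one_self[of "1::real"] by simp
        have "M\<^sup>2 = 2 ^ (m * r * 2)" by (simp add: M_def power_mult)
        also have "\<dots> \<le> exp 1 ^ (m * r * 2)" using exp_ge_add_one_self[of "1::real"] by (intro power_mono) auto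
        also have "\<dots> = exp (2 * real m * real r)" by (simp add: exp_of_nat_mult[symmetric] mult_ac)
        finally show "M\<^sup>2 \<le> exp (2 * real m * real r)" .
        have "real G ^ T = exp (real T * ln (real G))" using G1 by (simp add: exp_of_nat_mult)
        then show "(real G ^ T)\<^sup>2 \<le> exp (2 * real T * ln (real G))"
          by (simp add: power2_eq_square flip: exp_add)
        have "real P = exp (ell L * real S)" by (simp add: P_def exp_ell_nat)
        also have "ell L \<le> (\<Sum>\<alpha>\<in>I. Y)" unfolding ell_def by (intro sum_mono L)
        then have "exp (ell L * real S) \<le> exp (real r * Y * real S)" by (simp add: r mult_right_mono)
        finally show "real P \<le> exp (real r * Y * real S)" .
      qed auto
      also have "\<dots> = exp Usz" unfolding Usz_def by (simp add: exp_add)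
      finally show ?thesis .
    qed
  qed
qed

end

lemma card_odd_less:
  assumes "even n"
  shows "n \<le> 2 * card {s. s < n \<and> odd s}"
proof -
  obtain k where k: "n = 2 * k" using assms by blast
  have "card ((\<lambda>j. 2 * j + 1) ` {..<k}) = k" by (subst card_image) (auto simp: inj_on_def)
  moreover have "(\<lambda>j. 2 * j + 1) ` {..<k} \<subseteq> {s. s < n \<and> odd s}" using k by auto
  ultimately have "k \<le> card {s. s < n \<and> odd s}" by (metis card_mono finite_Collect_conjI finite_Collect_less_nat)
  then show ?thesis using k by simp
qed

locale baker_function = baker +
  fixes u :: real and Lset :: "(nat \<Rightarrow> nat) set" and c :: "(nat \<Rightarrow> nat) \<Rightarrow> int" and ls :: "nat \<Rightarrow> nat"
  assumes u: "0 \<le> u" "u \<le> real r * Y" and Lset: "Lset \<subseteq> box"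
    and slab: "\<And>l. l \<in> Lset \<Longrightarrow> u \<le> ell l \<and> ell l \<le> u + X"
    and zero0: "\<And>\<tau> s. tot \<tau> \<le> T \<Longrightarrow> s < S \<Longrightarrow> ev c Lset \<tau> (real s) = 0"
    and mass: "\<And>\<tau> U. tot \<tau> \<le> T \<Longrightarrow> U \<subseteq> Lset \<Longrightarrow> (\<Sum>l\<in>U. \<bar>of_int (c l * wt \<tau> l)\<bar>) \<le> exp Usz"
    and ls: "ls \<in> Lset" "c ls \<noteq> 0"
    and main_cond: "4 + 2 * Usz + 8 * Y + 8 * real r * Y * real S \<le> real S * 2 ^ m * ln E"
    and Lam_small: "2 * (2 ^ m * \<bar>Lam\<bar> * W) * exp Y * (real Zm + 1) * Qf ^ Zm \<le> 1"
begin

lemma Usz0: "Usz \<ge> 0"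
  unfolding Usz_def using G1 Y by simp

lemma point_bound:
  assumes U: "U \<subseteq> Lset" and A: "finite A" "\<And>s. s \<in> A \<Longrightarrow> real s / 2 ^ J \<le> W" and J: "J \<le> m"
    and w: "0 \<le> w" "w \<le> W"
    and zero: "\<And>\<tau> s. tot \<tau> \<le> Dz \<Longrightarrow> s \<in> A \<Longrightarrow> ev c U \<tau> (real s / 2 ^ J) = 0"
    and \<tau>: "tot \<tau> + t \<le> Dz" "tot \<tau> \<le> T" and Z: "Z = t * card A" "Z \<le> Zm"
  shows "\<bar>ev c U \<tau> w\<bar> * exp (- (u * w)) \<le> 2 * exp (Usz + 4 * Y - real Z * ln E)"
proof -
  define F where "F = (\<lambda>s. real s / 2 ^ J) ` A"
  define q where "q = 2 ^ m * \<bar>Lam\<bar> * W"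
  define \<eta> where "\<eta> = 2 * q * exp (X * W)"
  define Q1 where "Q1 = 2 * W / (1 / 2 ^ J) * (2 * Y + 1)"
  have q0: "q \<ge> 0" unfolding q_def using W1 by simp
  have "1 \<le> 2 * W" "(1::real) \<le> 2 ^ m" "1 \<le> 2 * Y + 1" using W1 Y by auto
  then have "1 * 1 * 1 * E \<le> 2 * W * 2 ^ m * (2 * Y + 1) * E"
    using E W1 Y by (intro mult_mono) auto
  then have QE: "E \<le> Qf" by (simp add: Qf_def)
  have Q1: "Q1 * E \<le> Qf" "1 \<le> Q1"
  proof -
    have "(2::real) ^ J \<le> 2 ^ m" using J by (intro power_increasing) auto
    then have "2 * W * 2 ^ J * (2 * Y + 1) * E \<le> 2 * W * 2 ^ m * (2 * Y + 1) * E"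
      using W1 Y E by (intro mult_right_mono mult_left_mono) auto
    then show "Q1 * E \<le> Qf" unfolding Q1_def Qf_def by simp
    have "1 * 1 * 1 \<le> 2 * W * 2 ^ J * (2 * Y + 1)" using W1 Y by (intro mult_mono) auto
    then show "1 \<le> Q1" unfolding Q1_def by simp
  qed
  have Zm1: "Zm \<ge> 1" unfolding Zm_def using S r1 by simp
  have small: "2 * q * exp Y * (real Zm + 1) * Qf ^ Zm \<le> 1" using Lam_small by (simp add: q_def)
  have qQ: "q * Qf \<le> 1"
  proof -
    have "Qf ^ 1 \<le> Qf ^ Zm" using QE E Zm1 by (intro power_increasing) auto
    then have "1 * q * 1 * 1 * Qf \<le> 2 * q * exp Y * (real Zm + 1) * Qf ^ Zm"
      using q0 Y QE E by (intro mult_mono) auto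
    then show ?thesis using small by simp
  qed
  have "q * E \<le> q * Qf" using QE q0 by (intro mult_left_mono) auto
  then have qE: "q * E \<le> Y" using qQ Y by linarith
  have q1: "q \<le> 1"
  proof -
    have "q * 1 \<le> q * Qf" using QE E q0 by (intro mult_left_mono) auto
    then show ?thesis using qQ by simp
  qed
  have cardF: "card F = card A" unfolding F_def by (rule card_image) (auto simp: inj_on_def)
  have ext: "\<bar>ev c U \<tau> w\<bar> * exp (- (u * w))
    \<le> exp Usz * ((2 * X * W) ^ Z / fact Z * exp (2 * X * W)) + exp Usz * \<eta> * (real Z * (2 * W / (1 / 2 ^ J) * (2 * Y + 1)) ^ Z + 1)"
  proof (rule extrapolate[where Dz = Dz and F = F and D = "2 ^ m" and d = "1 / 2 ^ J" and t = t])
    show "u \<le> ell l \<and> ell l \<le> u + X \<and> real (l p0) \<le> 2 ^ m" if "l \<in> U" for l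
    proof -
      have "l p0 \<le> 2 ^ m" using box_le[of l p0] L(1)[OF p0] p0 that U Lset by force
      then have "real (l p0) \<le> 2 ^ m" by (metis of_nat_le_iff of_nat_numeral of_nat_power)
      then show ?thesis using slab[of l] that U by auto
    qed
    show "finite F" using A by (simp add: F_def)
    show "F \<subseteq> {0..W}" using A by (auto simp: F_def)
    show "w \<in> {0..W}" using w by simp
    show "1 \<le> W" by (rule W1)
    show "1 / 2 ^ J \<le> \<bar>x - y\<bar>" if xy: "x \<in> F" "y \<in> F" "x \<noteq> y" for x y
    proof -
      obtain s s' where s: "x = real s / 2 ^ J" "y = real s' / 2 ^ J" using xy by (auto simp: F_def)
      then have "s \<noteq> s'" using xy by auto
      then have "1 \<le> \<bar>real s - real s'\<bar>" by linarith
      then have "1 / 2 ^ J \<le> \<bar>real s - real s'\<bar> / 2 ^ J" by (intro divide_right_mono) auto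
      then show ?thesis unfolding s by (simp add: diff_divide_distrib[symmetric])
    qed
    show "(0::real) < 1 / 2 ^ J" "1 / 2 ^ J \<le> (2::real)"
    proof -
      have "1 \<le> (2::real) ^ J" by simp
      then have "1 \<le> 2 * (2::real) ^ J" by linarith
      then show "1 / 2 ^ J \<le> (2::real)" by (simp add: divide_le_eq)
    qed simp
    show "ev c U \<tau> x = 0" if "tot \<tau> \<le> Dz" "x \<in> F" for \<tau> x using zero that by (auto simp: F_def)
    show "tot \<tau> + t \<le> Dz" by (rule \<tau>(1))
    show "(\<Sum>l\<in>U. \<bar>of_int (c l * wt \<tau> l)\<bar>) \<le> exp Usz" by (rule mass[OF \<tau>(2) U])
    show "0 \<le> X" "2 * X \<le> 2 * Y + 1" "1 \<le> 2 * Y + 1" using X0 XW Y by auto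
    show "2 ^ m * \<bar>Lam\<bar> \<le> X"
      using qE W1 E unfolding X_def q_def by (simp add: field_simps)
    show "2 ^ m * \<bar>Lam\<bar> * W \<le> 1" using q1 by (simp add: q_def)
    show "Z = t * card F" using Z cardF by simp
    show "\<eta> = 2 * (2 ^ m * \<bar>Lam\<bar> * W) * exp (X * W)" by (simp add: \<eta>_def q_def)
  qed auto
  have Einv: "exp (- (real Z * ln E)) = 1 / E ^ Z"
    using E by (simp add: exp_minus exp_of_nat_mult inverse_eq_divide)
  have t1: "(2 * X * W) ^ Z / fact Z * exp (2 * X * W) \<le> exp (4 * Y) * (1 / E ^ Z)"
  proof -
    have "(2 * X * W) ^ Z / fact Z = ((2 * Y) ^ Z / fact Z) * (1 / E ^ Z)"
      unfolding XW(2) by (simp add: power_divide)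
    also have "\<dots> \<le> exp (2 * Y) * (1 / E ^ Z)"
      using Y E by (intro mult_right_mono power_div_fact_le_exp) auto
    finally have "(2 * X * W) ^ Z / fact Z * exp (2 * X * W) \<le> exp (2 * Y) * (1 / E ^ Z) * exp (2 * Y)"
      using XW(1) E by (intro mult_mono) auto
    also have "\<dots> = exp (4 * Y) * (1 / E ^ Z)" by (simp flip: exp_add)
    finally show ?thesis .
  qed
  have t2: "\<eta> * (real Z * Q1 ^ Z + 1) \<le> 1 / E ^ Z"
  proof -
    have "real Z * Q1 ^ Z + 1 \<le> real Zm * Q1 ^ Z + 1 * Q1 ^ Z"
      using Z(2) Q1 one_le_power[of Q1 Z] by (intro add_mono mult_right_mono) auto
    then have a: "real Z * Q1 ^ Z + 1 \<le> (real Zm + 1) * Q1 ^ Z" by (simp add: algebra_simps)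
    have "Q1 ^ Z * E ^ Z \<le> Qf ^ Z" unfolding power_mult_distrib[symmetric] using Q1 E by (intro power_mono) auto
    also have "\<dots> \<le> Qf ^ Zm" using Z QE E by (intro power_increasing) auto
    finally have b: "Q1 ^ Z * E ^ Z \<le> Qf ^ Zm" .
    have "\<eta> * (real Z * Q1 ^ Z + 1) * E ^ Z \<le> (2 * q * exp Y) * ((real Zm + 1) * Q1 ^ Z) * E ^ Z"
      unfolding \<eta>_def using a XW(1) q0 E Q1 by (intro mult_mono mult_right_mono) auto
    also have "\<dots> = 2 * q * exp Y * (real Zm + 1) * (Q1 ^ Z * E ^ Z)" by (simp add: mult_ac)
    also have "\<dots> \<le> 2 * q * exp Y * (real Zm + 1) * Qf ^ Zm" using b q0 by (intro mult_left_mono) auto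
    finally have "\<eta> * (real Z * Q1 ^ Z + 1) * E ^ Z \<le> 1" using small by linarith
    then show ?thesis using E by (simp add: field_simps)
  qed
  have "\<bar>ev c U \<tau> w\<bar> * exp (- (u * w)) \<le> exp Usz * (exp (4 * Y) * (1 / E ^ Z)) + exp Usz * (1 / E ^ Z)"
    using ext mult_left_mono[OF t1, of "exp Usz"] mult_left_mono[OF t2, of "exp Usz"]
    unfolding Q1_def by (simp add: mult.assoc)
  also have "exp Usz * (1 / E ^ Z) \<le> exp Usz * (exp (4 * Y) * (1 / E ^ Z))"
  proof -
    have "1 * (1 / E ^ Z) \<le> exp (4 * Y) * (1 / E ^ Z)" using Y E by (intro mult_right_mono) auto
    then show ?thesis by (intro mult_left_mono) auto
  qed
  also have "exp Usz * (exp (4 * Y) * (1 / E ^ Z)) + exp Usz * (exp (4 * Y) * (1 / E ^ Z))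
      = 2 * exp (Usz + 4 * Y - real Z * ln E)"
    unfolding Einv[symmetric] by (simp add: exp_add exp_diff exp_minus divide_inverse)
  finally show ?thesis by simp
qed

definition cls :: "nat \<Rightarrow> (nat \<Rightarrow> nat) set" where
  "cls J = {l \<in> Lset. \<forall>\<alpha>\<in>I. l \<alpha> mod 2 ^ J = ls \<alpha> mod 2 ^ J}"

lemma cls_sub: "cls J \<subseteq> Lset" by (auto simp: cls_def)

lemma level_extrapolation:
  assumes J: "J \<le> m" and t: "t = 2 ^ (m - J)"
    and start: "\<And>\<tau> s. tot \<tau> \<le> 4 * r * t \<Longrightarrow> J = 0 \<or> odd s \<Longrightarrow> s < 2 ^ J * S \<Longrightarrow> ev c (cls J) \<tau> (real s / 2 ^ J) = 0"
    and "i \<le> r" "tot \<tau> \<le> (4 * r - i) * t" "i = 0 \<longrightarrow> J = 0 \<or> odd s" "s < 2 ^ J * S * 4 ^ i"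
  shows "ev c (cls J) \<tau> (real s / 2 ^ J) = 0"
  using assms(4-)
proof (induction i arbitrary: \<tau> s)
  case 0
  then show ?case by (intro start) auto
next
  case (Suc i)
  define A where "A = {s. s < 2 ^ J * S * 4 ^ i \<and> (i = 0 \<longrightarrow> J = 0 \<or> odd s)}"
  have finA: "finite A" by (simp add: A_def)
  have cA: "2 ^ J * S * 4 ^ i \<le> 2 * card A" "card A \<le> 2 ^ J * S * 4 ^ i"
  proof -
    have sub: "A \<subseteq> {..<2 ^ J * S * 4 ^ i}" by (auto simp: A_def)
    then show "card A \<le> 2 ^ J * S * 4 ^ i" by (metis card_lessThan card_mono finite_lessThan)
    show "2 ^ J * S * 4 ^ i \<le> 2 * card A"
    proof (cases "i = 0 \<and> J \<noteq> 0")
      case True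
      then have "A = {s. s < 2 ^ J * S * 4 ^ i \<and> odd s}" by (auto simp: A_def)
      moreover have "even (2 ^ J * S * 4 ^ i)" using True by simp
      ultimately show ?thesis using card_odd_less by metis
    next
      case False
      then have "A = {..<2 ^ J * S * 4 ^ i}" by (auto simp: A_def)
      then show ?thesis by simp
    qed
  qed
  have t2: "t * 2 ^ J = 2 ^ m" using J by (simp add: t flip: power_add)
  define Z where "Z = t * card A"
  have "Z \<le> t * (2 ^ J * S * 4 ^ i)" unfolding Z_def using cA by (intro mult_le_mono2)
  also have "\<dots> = 2 ^ m * S * 4 ^ i" using t2 by (metis mult.assoc)
  also have "\<dots> \<le> 2 ^ m * S * 4 ^ r" using Suc.prems by (intro mult_le_mono2 power_increasing) auto
  also have "\<dots> \<le> Zm" unfolding Zm_def using r1 by simp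
  finally have ZZ: "Z \<le> Zm" .
  have "2 ^ m * S * 4 ^ i \<le> 2 * Z"
    using mult_le_mono2[OF cA(1), of t] t2 unfolding Z_def by (metis mult.assoc mult.left_commute)
  then have Zge: "2 ^ m * real S * 4 ^ i \<le> 2 * real Z"
    by (metis (mono_tags, lifting) of_nat_le_iff of_nat_mult of_nat_numeral of_nat_power)
  define w where "w = real s / 2 ^ J"
  have "real s \<le> real (2 ^ J * S * 4 ^ Suc i)" using Suc.prems(4) by (simp only: of_nat_le_iff)
  then have w4: "w \<le> real S * 4 ^ Suc i" unfolding w_def by (simp add: field_simps)
  have "(4::real) ^ Suc i \<le> 4 ^ r" using Suc.prems(1) by (intro power_increasing) auto
  then have "real S * 4 ^ Suc i \<le> W" unfolding W_def by (intro mult_left_mono) auto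
  then have wW: "w \<le> W" using w4 by linarith
  have w0: "0 \<le> w" by (simp add: w_def)
  have tt: "tot \<tau> + t \<le> (4 * r - i) * t"
  proof -
    have "(4 * r - i) * t = (4 * r - Suc i) * t + t"
      using Suc.prems(1) by (metis Suc_diff_Suc Suc_leD add.commute le_trans less_eq_Suc_le mult_Suc nat_mult_1 le_add1 mult_le_mono1 one_le_numeral)
    then show ?thesis using Suc.prems(2) by simp
  qed
  have "(4 * r - i) * t \<le> T" unfolding T_def t using mult_le_mono[of "4 * r - i" "4 * r" "2 ^ (m - J)" "2 ^ m"] by simp
  then have tT: "tot \<tau> \<le> T" using tt by linarith
  have bound: "\<bar>ev c (cls J) \<tau> w\<bar> * exp (- (u * w)) \<le> 2 * exp (Usz + 4 * Y - real Z * ln E)"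
  proof (rule point_bound[OF cls_sub finA _ J w0 wW _ tt tT Z_def ZZ])
    show "real s' / 2 ^ J \<le> W" if "s' \<in> A" for s'
    proof -
      have "s' \<le> 2 ^ J * S * 4 ^ i" using that by (simp add: A_def)
      then have "real s' \<le> real (2 ^ J * S * 4 ^ i)" by (simp only: of_nat_le_iff)
      then have "real s' / 2 ^ J \<le> real S * 4 ^ i" by (simp add: field_simps)
      also have "\<dots> \<le> W" unfolding W_def using Suc.prems(1) by (intro mult_left_mono power_increasing) auto
      finally show ?thesis .
    qed
    show "ev c (cls J) \<tau>' (real s' / 2 ^ J) = 0" if "tot \<tau>' \<le> (4 * r - i) * t" "s' \<in> A" for \<tau>' s'
      using that Suc.prems(1) by (intro Suc.IH) (auto simp: A_def)
  qed
  show ?case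
  proof (rule ccontr)
    assume "ev c (cls J) \<tau> (real s / 2 ^ J) \<noteq> 0"
    then have "1 \<le> \<bar>ev c (cls J) \<tau> w\<bar>"
      unfolding w_def by (intro ev_nonzero_ge_one[where \<rho> = "\<lambda>\<alpha>. ls \<alpha> mod 2 ^ J"]) (auto simp: cls_def)
    then have "1 * exp (- (u * w)) \<le> \<bar>ev c (cls J) \<tau> w\<bar> * exp (- (u * w))" by (intro mult_right_mono) auto
    also have "\<dots> \<le> 2 * exp (Usz + 4 * Y - real Z * ln E)" by (rule bound)
    also have "\<dots> \<le> exp 1 * exp (Usz + 4 * Y - real Z * ln E)"
      using exp_ge_add_one_self[of "1::real"] by (intro mult_right_mono) auto
    finally have "- (u * w) \<le> 1 + (Usz + 4 * Y - real Z * ln E)" by (simp flip: exp_add)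
    moreover define V where "V = real r * Y * (real S * 4 ^ Suc i)"
    moreover have "u * w \<le> V" unfolding V_def using u w4 w0 by (intro mult_mono) auto
    moreover define ZE where "ZE = real Z * ln E"
    moreover have "(4 + 2 * Usz + 8 * Y) + 2 * V \<le> 2 * ZE"
    proof -
      have "1 * (4 + 2 * Usz + 8 * Y) \<le> 4 ^ i * (4 + 2 * Usz + 8 * Y)"
        using Usz0 Y by (intro mult_right_mono) auto
      then have "(4 + 2 * Usz + 8 * Y) + 2 * V \<le> 4 ^ i * (4 + 2 * Usz + 8 * Y + 8 * real r * Y * real S)"
        unfolding V_def by (simp add: algebra_simps)
      also have "\<dots> \<le> 4 ^ i * (real S * 2 ^ m * ln E)"
        using main_cond by (intro mult_left_mono) auto
      also have "\<dots> = (2 ^ m * real S * 4 ^ i) * ln E" by (simp add: mult_ac)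
      also have "\<dots> \<le> (2 * real Z) * ln E" using Zge E by (intro mult_right_mono) auto
      finally show ?thesis unfolding ZE_def by simp
    qed
    ultimately show False by linarith
  qed
qed

lemma level_step:
  assumes J: "J < m" and t: "t = 2 ^ (m - J)"
    and start: "\<And>\<tau> s. tot \<tau> \<le> 4 * r * t \<Longrightarrow> J = 0 \<or> odd s \<Longrightarrow> s < 2 ^ J * S \<Longrightarrow> ev c (cls J) \<tau> (real s / 2 ^ J) = 0"
    and \<tau>: "tot \<tau> \<le> 4 * r * 2 ^ (m - Suc J)" and s: "odd s" "s < 2 ^ Suc J * S"
  shows "ev c (cls (Suc J)) \<tau> (real s / 2 ^ Suc J) = 0"
proof -
  define w where "w = real s / 2 ^ Suc J"
  define \<rho> where "\<rho> \<alpha> = ls \<alpha> mod 2 ^ J" for \<alpha>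
  have \<rho>: "l \<alpha> mod 2 ^ J = \<rho> \<alpha>" if "l \<in> cls J" "\<alpha> \<in> I" for l \<alpha> using that by (auto simp: cls_def \<rho>_def)
  have w0: "0 \<le> w" by (simp add: w_def)
  have "real s \<le> real (2 ^ Suc J * S)" using s(2) by (simp only: of_nat_le_iff)
  then have wS: "w \<le> real S" unfolding w_def by (simp add: field_simps)
  have "real S * 1 \<le> W" unfolding W_def by (intro mult_left_mono) auto
  then have wW: "w \<le> W" using wS by linarith
  have tS: "t = 2 * 2 ^ (m - Suc J)" unfolding t using J by (metis Suc_diff_Suc power_Suc)
  have tau2: "tot \<tau> \<le> 2 * r * t" using \<tau> tS by simp
  have tT: "tot \<tau> \<le> T"
  proof -
    have "2 ^ (m - Suc J) \<le> (2::nat) ^ m" by (intro power_increasing) auto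
    then have "4 * r * 2 ^ (m - Suc J) \<le> T" unfolding T_def by (intro mult_le_mono2)
    then show ?thesis using \<tau> by linarith
  qed
  have t2: "t * 2 ^ J = 2 ^ m" using J by (simp add: t flip: power_add)
  have bound: "\<bar>ev c (cls J) \<tau> w\<bar> * exp (- (u * w)) \<le> 2 * exp (Usz + 4 * Y - real Zm * ln E)"
  proof (rule point_bound[where A = "{..<2 ^ J * S * 4 ^ r}" and Dz = "3 * r * t" and t = "r * t" and J = J])
    show "real s' / 2 ^ J \<le> W" if "s' \<in> {..<2 ^ J * S * 4 ^ r}" for s'
    proof -
      have "s' \<le> 2 ^ J * S * 4 ^ r" using that by simp
      then have "real s' \<le> real (2 ^ J * S * 4 ^ r)" by (simp only: of_nat_le_iff)
      then show ?thesis unfolding W_def by (simp add: field_simps)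
    qed
    show "ev c (cls J) \<tau>' (real s' / 2 ^ J) = 0" if "tot \<tau>' \<le> 3 * r * t" "s' \<in> {..<2 ^ J * S * 4 ^ r}" for \<tau>' s'
    proof (rule level_extrapolation[OF less_imp_le[OF J] t start])
      show "tot \<tau>' \<le> (4 * r - r) * t" using that by simp
    qed (use that r1 in auto)
    show "Zm = r * t * card {..<2 ^ J * S * 4 ^ r}" unfolding Zm_def using t2 by (simp add: mult_ac)
  qed (use J w0 wW tau2 tT cls_sub in \<open>auto simp: algebra_simps\<close>)
  define Xf where "Xf \<sigma> = (\<Sum>l\<in>cls J. of_int (c l * wt \<tau> l) * (\<Prod>\<alpha>\<in>I. (sign (\<sigma> \<alpha>) * sqrt (real \<alpha>)) ^ ((l \<alpha> div 2 ^ J) * s)))" for \<sigma>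
  have fincls: "finite (cls J)" using cls_sub Lset fin_box by (meson finite_subset)
  obtain xs where xs: "set xs = I" "distinct xs" using finite_distinct_list[OF finI] by blast
  have len: "length xs = r" using xs r distinct_card by force
  have evX: "ev c (cls J) \<tau> w = exp (ell \<rho> * w) * Xf (\<lambda>_. True)"
    unfolding ev_def Xf_def sum_distrib_left
  proof (intro sum.cong refl)
    fix l assume l: "l \<in> cls J"
    show "of_int (c l * wt \<tau> l) * exp (ell l * w) = exp (ell \<rho> * w) * (of_int (c l * wt \<tau> l)
        * (\<Prod>\<alpha>\<in>I. (sign True * sqrt (real \<alpha>)) ^ ((l \<alpha> div 2 ^ J) * s)))"
      unfolding w_def by (subst exp_ell_split(2)[of l J \<rho> s]) (use \<rho>[OF l] in auto)
  qed
  have cf: "conj_family xs Xf"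
    unfolding Xf_def
    by (intro conj_family_sum[OF fincls] conj_family_mult conj_family_of_int conj_family_prod[OF finI] conj_family_power conj_family_root)
       (use xs in auto)
  define C where "C = exp (Usz + real r * Y * real S)"
  have C1: "C \<ge> 1" unfolding C_def using Usz0 Y by simp
  have XC: "\<bar>Xf \<sigma>\<bar> \<le> C" for \<sigma>
  proof -
    have "\<bar>Xf \<sigma>\<bar> \<le> (\<Sum>l\<in>cls J. \<bar>of_int (c l * wt \<tau> l)\<bar> * exp (real r * Y * real S))"
      unfolding Xf_def
    proof (intro order_trans[OF sum_abs] sum_mono)
      fix l assume l: "l \<in> cls J"
      have "\<bar>\<Prod>\<alpha>\<in>I. (sign (\<sigma> \<alpha>) * sqrt (real \<alpha>)) ^ ((l \<alpha> div 2 ^ J) * s)\<bar>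
          = (\<Prod>\<alpha>\<in>I. sqrt (real \<alpha>) ^ ((l \<alpha> div 2 ^ J) * s))"
        by (simp add: abs_prod power_abs abs_mult)
      also have "\<dots> = 1 * \<dots>" by simp
      also have "\<dots> \<le> exp (ell \<rho> * w) * (\<Prod>\<alpha>\<in>I. sqrt (real \<alpha>) ^ ((l \<alpha> div 2 ^ J) * s))"
        using ell_nonneg w0 by (intro mult_right_mono prod_nonneg) auto
      also have "\<dots> = exp (ell l * w)"
        unfolding w_def by (subst exp_ell_split(2)[of l J \<rho> s]) (use \<rho>[OF l] in auto)
      also have "\<dots> \<le> exp (real r * Y * real S)"
      proof -
        have "ell l \<le> real r * Y" using l cls_sub Lset by (intro ell_box) auto
        then show ?thesis using wS w0 Y by (simp add: mult_mono)
      qed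
      finally show "\<bar>of_int (c l * wt \<tau> l) * (\<Prod>\<alpha>\<in>I. (sign (\<sigma> \<alpha>) * sqrt (real \<alpha>)) ^ ((l \<alpha> div 2 ^ J) * s))\<bar>
          \<le> \<bar>of_int (c l * wt \<tau> l)\<bar> * exp (real r * Y * real S)"
        unfolding abs_mult by (intro mult_left_mono) auto
    qed
    also have "\<dots> \<le> exp Usz * exp (real r * Y * real S)"
      unfolding sum_distrib_right[symmetric] by (intro mult_right_mono mass tT cls_sub) auto
    finally show ?thesis by (simp add: C_def exp_add)
  qed
  have X0: "Xf (\<lambda>_. True) = 0"
  proof (rule ccontr)
    assume nz: "Xf (\<lambda>_. True) \<noteq> 0"
    have "1 \<le> \<bar>Xf (\<lambda>_. True)\<bar> * C ^ (2 ^ r - 1)"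
      using conj_family_lower_bound[OF _ xs(2) cf nz XC C1] sqi xs len by simp
    also have "\<dots> \<le> \<bar>ev c (cls J) \<tau> w\<bar> * C ^ 2 ^ r"
    proof (intro mult_mono power_increasing)
      have "1 * \<bar>Xf (\<lambda>_. True)\<bar> \<le> exp (ell \<rho> * w) * \<bar>Xf (\<lambda>_. True)\<bar>"
        using ell_nonneg w0 by (intro mult_right_mono) auto
      then show "\<bar>Xf (\<lambda>_. True)\<bar> \<le> \<bar>ev c (cls J) \<tau> w\<bar>" by (simp add: evX abs_mult)
    qed (use C1 in auto)
    finally have 1: "1 \<le> \<bar>ev c (cls J) \<tau> w\<bar> * C ^ 2 ^ r" .
    have "exp (- (u * w)) \<le> \<bar>ev c (cls J) \<tau> w\<bar> * C ^ 2 ^ r * exp (- (u * w))"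
      using mult_right_mono[OF 1, of "exp (- (u * w))"] by simp
    also have "\<dots> = \<bar>ev c (cls J) \<tau> w\<bar> * exp (- (u * w)) * C ^ 2 ^ r" by simp
    also have "\<dots> \<le> 2 * exp (Usz + 4 * Y - real Zm * ln E) * C ^ 2 ^ r"
      using bound C1 by (intro mult_right_mono) auto
    also have "\<dots> \<le> exp 1 * exp (Usz + 4 * Y - real Zm * ln E) * C ^ 2 ^ r"
      using exp_ge_add_one_self[of "1::real"] C1 by (intro mult_right_mono) auto
    also have "C ^ 2 ^ r = exp (2 ^ r * (Usz + real r * Y * real S))"
      unfolding C_def by (simp add: exp_of_nat_mult[symmetric])
    finally have fin: "- (u * w) \<le> 1 + (Usz + 4 * Y - real Zm * ln E) + 2 ^ r * (Usz + real r * Y * real S)"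
      by (simp flip: exp_add)
    define V where "V = real r * Y * real S"
    define ZE where "ZE = real Zm * ln E"
    define Cq where "Cq = 2 ^ r * (Usz + V)"
    have "- (u * w) \<le> 1 + (Usz + 4 * Y - ZE) + Cq" using fin by (simp only: V_def ZE_def Cq_def)
    moreover have "u * w \<le> V" unfolding V_def using u wS w0 by (intro mult_mono) auto
    moreover have V0: "0 \<le> V" unfolding V_def using Y by simp
    moreover have "Cq + (4 + Usz + 8 * Y + 7 * V) \<le> ZE"
    proof -
      have "Cq \<le> 4 ^ r * (Usz + V)" unfolding Cq_def
        using Usz0 V0 by (intro mult_right_mono power_mono) auto
      moreover have "1 * (4 + Usz + 8 * Y + 7 * V) \<le> 4 ^ r * (4 + Usz + 8 * Y + 7 * V)"
        using Usz0 Y V0 by (intro mult_right_mono) auto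
      ultimately have "Cq + (4 + Usz + 8 * Y + 7 * V) \<le> 4 ^ r * (4 + 2 * Usz + 8 * Y + 8 * V)"
        by (simp add: algebra_simps)
      also have "\<dots> \<le> 4 ^ r * (real S * 2 ^ m * ln E)"
        using main_cond unfolding V_def by (intro mult_left_mono) (auto simp: mult.assoc)
      also have "\<dots> = (real S * 4 ^ r * 1 * 2 ^ m) * ln E" by (simp add: mult_ac)
      also have "\<dots> \<le> (real S * 4 ^ r * real r * 2 ^ m) * ln E"
        using E r1 by (intro mult_right_mono mult_left_mono) auto
      also have "\<dots> = ZE" by (simp add: Zm_def ZE_def)
      finally show ?thesis .
    qed
    ultimately show False using Usz0 Y by linarith
  qed
  have "Xf \<sigma> = 0" for \<sigma>
    using conj_family_zero[OF _ xs(2) cf X0] sqi xs by simp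
  then have "(\<Sum>l | l \<in> cls J \<and> (\<forall>\<alpha>\<in>I. odd (l \<alpha> div 2 ^ J * s) = odd (ls \<alpha> div 2 ^ J)).
      of_int (c l * wt \<tau> l) * (\<Prod>\<alpha>\<in>I. sqrt (real \<alpha>) ^ (l \<alpha> div 2 ^ J * s))) = 0"
    unfolding Xf_def by (intro sign_sum_split[OF fincls finI])
  also have "{l. l \<in> cls J \<and> (\<forall>\<alpha>\<in>I. odd (l \<alpha> div 2 ^ J * s) = odd (ls \<alpha> div 2 ^ J))} = cls (Suc J)"
  proof -
    have "(l \<alpha> mod 2 ^ Suc J = ls \<alpha> mod 2 ^ Suc J) \<longleftrightarrow>
        l \<alpha> mod 2 ^ J = ls \<alpha> mod 2 ^ J \<and> odd (l \<alpha> div 2 ^ J) = odd (ls \<alpha> div 2 ^ J)" for l \<alpha>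
    proof -
      have e: "x mod 2 ^ Suc J = 2 ^ J * (x div 2 ^ J mod 2) + x mod 2 ^ J" for x :: nat
        unfolding power_Suc2 by (rule mod_mult2_eq)
      have lt: "x mod 2 ^ J < 2 ^ J" for x :: nat by simp
      show ?thesis
      proof
        assume h: "l \<alpha> mod 2 ^ Suc J = ls \<alpha> mod 2 ^ Suc J"
        have "x mod 2 ^ Suc J mod 2 ^ J = x mod 2 ^ J" "x mod 2 ^ Suc J div 2 ^ J = x div 2 ^ J mod 2" for x :: nat
          unfolding e using lt[of x] by auto
        then have "l \<alpha> mod 2 ^ J = ls \<alpha> mod 2 ^ J" "l \<alpha> div 2 ^ J mod 2 = ls \<alpha> div 2 ^ J mod 2" using h by metis+
        then show "l \<alpha> mod 2 ^ J = ls \<alpha> mod 2 ^ J \<and> odd (l \<alpha> div 2 ^ J) = odd (ls \<alpha> div 2 ^ J)"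
          by (simp add: odd_iff_mod_2_eq_one)
      next
        assume h: "l \<alpha> mod 2 ^ J = ls \<alpha> mod 2 ^ J \<and> odd (l \<alpha> div 2 ^ J) = odd (ls \<alpha> div 2 ^ J)"
        then have "l \<alpha> div 2 ^ J mod 2 = ls \<alpha> div 2 ^ J mod 2" by (simp add: mod2_eq_if)
        then show "l \<alpha> mod 2 ^ Suc J = ls \<alpha> mod 2 ^ Suc J" unfolding e using h by simp
      qed
    qed
    then show ?thesis unfolding cls_def using s(1) by auto
  qed
  finally have sub0: "(\<Sum>l\<in>cls (Suc J). of_int (c l * wt \<tau> l) * (\<Prod>\<alpha>\<in>I. sqrt (real \<alpha>) ^ (l \<alpha> div 2 ^ J * s))) = 0" .
  have clsS: "cls (Suc J) \<subseteq> cls J"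
    unfolding cls_def using mod_mod_cancel[of "2 ^ J :: nat" "2 ^ Suc J"] by (auto simp: le_imp_power_dvd) (metis le_add2 le_imp_power_dvd mod_mod_cancel plus_1_eq_Suc power_Suc)
  have "ev c (cls (Suc J)) \<tau> w = exp (ell \<rho> * w) * (\<Sum>l\<in>cls (Suc J). of_int (c l * wt \<tau> l) * (\<Prod>\<alpha>\<in>I. sqrt (real \<alpha>) ^ (l \<alpha> div 2 ^ J * s)))"
    unfolding ev_def sum_distrib_left
  proof (intro sum.cong refl)
    fix l assume "l \<in> cls (Suc J)"
    then have l: "l \<in> cls J" using clsS by auto
    show "of_int (c l * wt \<tau> l) * exp (ell l * w) = exp (ell \<rho> * w) * (of_int (c l * wt \<tau> l)
        * (\<Prod>\<alpha>\<in>I. sqrt (real \<alpha>) ^ (l \<alpha> div 2 ^ J * s)))"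
      unfolding w_def by (subst exp_ell_split(2)[of l J \<rho> s]) (use \<rho>[OF l] in auto)
  qed
  then show ?thesis using sub0 by (simp add: w_def)
qed

lemma contradiction: False
proof -
  have lev: "ev c (cls J) \<tau> (real s / 2 ^ J) = 0"
    if "J \<le> m" "tot \<tau> \<le> 4 * r * 2 ^ (m - J)" "J = 0 \<or> odd s" "s < 2 ^ J * S" for J \<tau> s
    using that
  proof (induction J arbitrary: \<tau> s)
    case 0
    have "cls 0 = Lset" by (auto simp: cls_def)
    then show ?case using zero0[of \<tau> s] 0 by (simp add: T_def)
  next
    case (Suc J)
    show ?case
      by (rule level_step[OF _ refl]) (use Suc in auto)
  qed
  have clsm: "cls m = {ls}"
  proof -
    have "l = ls" if l: "l \<in> cls m" for l
    proof -
      have box: "l \<in> box" "ls \<in> box" using l ls cls_sub Lset by auto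
      have "l \<alpha> = ls \<alpha>" if "\<alpha> \<in> I" for \<alpha>
      proof -
        have "l \<alpha> < 2 ^ m" "ls \<alpha> < 2 ^ m"
          using box_le[OF box(1) that] box_le[OF box(2) that] L(1)[OF that] by linarith+
        moreover have "l \<alpha> mod 2 ^ m = ls \<alpha> mod 2 ^ m" using l that by (auto simp: cls_def)
        ultimately show ?thesis by simp
      qed
      then show ?thesis using box unfolding box_def by (intro PiE_ext[of l I _ ls]) auto
    qed
    then show ?thesis using ls by (auto simp: cls_def)
  qed
  have "1 < 2 ^ m * S" using m S by (metis One_nat_def Suc_le_eq less_le_trans mult.right_neutral mult_le_mono2 one_less_numeral_iff one_less_power semiring_norm(76))
  then have "ev c (cls m) (\<lambda>_. 0) (real 1 / 2 ^ m) = 0"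
    by (intro lev) (auto simp: tot_def)
  then show False using ls by (simp add: clsm ev_def wt_def)
qed

end

lemma (in baker) lower_bound:
  assumes count: "(real r * W * E + 1) * (2 * real (((T + (r - 1)) choose (r - 1)) * S)) \<le> real (card box)"
    and main: "4 + 2 * Usz + 8 * Y + 8 * real r * Y * real S \<le> real S * 2 ^ m * ln E"
  shows "1 < 2 * (2 ^ m * \<bar>Lam\<bar> * W) * exp Y * (real Zm + 1) * Qf ^ Zm"
proof (rule ccontr)
  assume "\<not> ?thesis"
  then have small: "2 * (2 ^ m * \<bar>Lam\<bar> * W) * exp Y * (real Zm + 1) * Qf ^ Zm \<le> 1" by simp
  define q where "q = ((T + (r - 1)) choose (r - 1)) * S"
  have q1: "q \<ge> 1" unfolding q_def using S by (simp add: Suc_le_eq)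
  obtain u Lset where us: "0 \<le> u" "u \<le> real r * Y" "Lset \<subseteq> box" "2 * q \<le> card Lset"
    "\<And>l. l \<in> Lset \<Longrightarrow> u \<le> ell l \<and> ell l \<le> u + X"
    using slab_exists[OF count[folded q_def] q1] by blast
  have ne: "Lset \<noteq> {}" using us(4) q1 by auto
  obtain c where c: "\<exists>l\<in>Lset. c l \<noteq> 0"
    "\<And>\<tau> s. tot \<tau> \<le> T \<Longrightarrow> s < S \<Longrightarrow> ev c Lset \<tau> (real s) = 0"
    "\<And>\<tau> U. tot \<tau> \<le> T \<Longrightarrow> U \<subseteq> Lset \<Longrightarrow> (\<Sum>l\<in>U. \<bar>of_int (c l * wt \<tau> l)\<bar>) \<le> exp Usz"
    using auxiliary_function[OF us(3) us(4)[unfolded q_def] ne] by blast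
  obtain ls where ls: "ls \<in> Lset" "c ls \<noteq> 0" using c(1) by blast
  have "baker_function I a p0 L m S B r E Y u Lset c ls"
    by (intro baker_function.intro baker_function_axioms.intro baker_axioms us c ls main small)
  then show False by (rule baker_function.contradiction)
qed

lemma binomial_box_bound:
  fixes n M :: nat
  assumes "M \<ge> 1"
  shows "real ((4 * (n + 1) * M + n) choose n) \<le> (28 * real M) ^ n"
proof (cases "n = 0")
  case False
  have "((4 * (n + 1) * M + n) choose n) * fact n \<le> (4 * (n + 1) * M + n) ^ n"
    by (rule binomial_fact_pow)
  also have "\<dots> \<le> (9 * n * M) ^ n"
  proof (rule power_mono)
    have "n \<le> n * M" "M \<le> n * M" using assms False by auto
    moreover have "4 * (n + 1) * M = 4 * (n * M) + 4 * M" by (simp add: algebra_simps)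
    moreover have "9 * n * M = 9 * (n * M)" by simp
    ultimately show "4 * (n + 1) * M + n \<le> 9 * n * M" by linarith
  qed simp
  finally have "real (((4 * (n + 1) * M + n) choose n) * fact n) \<le> real ((9 * n * M) ^ n)"
    by (simp only: of_nat_le_iff)
  then have "real ((4 * (n + 1) * M + n) choose n) \<le> (9 * real M) ^ n * (real n ^ n / fact n)"
    by (simp add: field_simps power_mult_distrib)
  also have "\<dots> \<le> (9 * real M) ^ n * exp 1 ^ n"
    using power_div_fact_le_exp[of "real n" n] by (intro mult_left_mono) (auto simp: exp_of_nat_mult[of n 1, simplified])
  also have "\<dots> \<le> (9 * real M) ^ n * 3 ^ n"
    using exp_le by (intro mult_left_mono power_mono) auto
  also have "\<dots> = (27 * real M) ^ n" unfolding power_mult_distrib[symmetric] by simp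
  also have "\<dots> \<le> (28 * real M) ^ n" by (intro power_mono) auto
  finally show ?thesis .
qed simp

lemma ln2_half: "(1 / 2 :: real) \<le> ln 2"
proof -
  have "ln (1 / 2 :: real) = - ln 2" by (subst ln_div) auto
  then show ?thesis using ln_le_minus_one[of "1 / 2 :: real"] by simp
qed

lemma linear_form_params:
  fixes \<delta> H :: real and D1 B :: nat
  assumes lf: "linear_form I a p0" and sq: "square_independent I"
    and B: "\<And>\<alpha>. \<alpha> \<in> I \<Longrightarrow> \<bar>a \<alpha>\<bar> \<le> int B" "1 \<le> B" "real B \<le> H\<^sup>2"
    and r: "real (card I) \<le> ln H" and \<delta>: "0 < \<delta>" "\<delta> \<le> 1" and D1: "320 / \<delta> \<le> real D1"
    and H: "ln (2 * real D1) \<le> ln H" "1 \<le> ln H" "2 \<le> H"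
    and K1: "K1 = 4 * (real D1)\<^sup>2 * 1792 * 36 / \<delta>"
    and N0: "N0 = (\<Prod>\<alpha>\<in>I. ln (real \<alpha>)) * exp (\<delta> * ln H) * K1 ^ card I"
    and small: "2 * N0 \<le> H"
  shows "exp (- (13 * ln H * (real D1 * 16 ^ card I * (2 * N0)))) \<le> \<bar>linear_form.Lam I a\<bar>"
proof -
  interpret linear_form I a p0 by (rule lf)
  define r where "r = card I"
  define x where "x = ln H"
  define h where "h = (\<Prod>\<alpha>\<in>I. ln (real \<alpha>))"
  define E where "E = exp (\<delta> * x)"
  have r1: "r \<ge> 1" unfolding r_def using finI p0 by (metis Suc_leI card_gt_0_iff empty_iff One_nat_def)
  have rx: "real r \<le> x" using r by (simp add: r_def x_def)
  have x1: "x \<ge> 1" using H by (simp add: x_def)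
  have E1: "E \<ge> 1" unfolding E_def using \<delta> x1 by simp
  have lnE: "ln E = \<delta> * x" by (simp add: E_def)
  have D1p: "320 \<le> real D1 * \<delta>" using D1 \<delta> by (simp add: field_simps)
  have D1b: "320 \<le> real D1"
  proof -
    have "real D1 * \<delta> \<le> real D1 * 1" using \<delta> by (intro mult_left_mono) auto
    then show ?thesis using D1p by simp
  qed
  have la: "1 / 2 \<le> ln (real \<alpha>)" if "\<alpha> \<in> I" for \<alpha>
  proof -
    have "ln 2 \<le> ln (real \<alpha>)" using ge2[OF that] by simp
    then show ?thesis using ln2_half by linarith
  qed
  have hge: "ln (real \<alpha>) \<le> h * 2 ^ r" if \<alpha>: "\<alpha> \<in> I" for \<alpha>
  proof -
    have "(1 / 2) ^ card (I - {\<alpha>}) \<le> (\<Prod>\<beta>\<in>I - {\<alpha>}. ln (real \<beta>))"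
      using prod_mono[of "I - {\<alpha>}" "\<lambda>_. 1 / 2" "\<lambda>\<beta>. ln (real \<beta>)"] la by simp
    moreover have "(1 / 2 :: real) ^ r \<le> (1 / 2) ^ card (I - {\<alpha>})"
      unfolding r_def by (intro power_decreasing card_mono finI) auto
    ultimately have "(1 / 2) ^ r \<le> (\<Prod>\<beta>\<in>I - {\<alpha>}. ln (real \<beta>))" by linarith
    then have "ln (real \<alpha>) * (1 / 2) ^ r \<le> h"
      unfolding h_def prod.remove[OF finI \<alpha>] using la[OF \<alpha>] by (intro mult_left_mono) auto
    then show ?thesis by (simp add: field_simps)
  qed
  have h0: "h > 0" unfolding h_def using la by (intro prod_pos) (smt (verit) divide_pos_pos)
  have K1d: "K1 * \<delta> / 36 = 4 * (real D1)\<^sup>2 * 1792" using K1 \<delta> by simp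
  have D1sq: "real D1 \<le> (real D1)\<^sup>2" using D1b by (simp add: power2_eq_square)
  have K1big: "4 * (real D1)\<^sup>2 * 1792 * 36 \<le> K1" unfolding K1 using \<delta> D1b
    by (simp add: le_divide_eq mult_left_le)
  then have K1b: "K1 \<ge> 4" using D1sq D1b by linarith
  have N0': "N0 = h * E * K1 ^ r" by (simp add: N0 h_def E_def x_def r_def)
  have Nge: "ln (real \<alpha>) * (72 / \<delta>) \<le> N0" if \<alpha>: "\<alpha> \<in> I" for \<alpha>
  proof -
    have "72 / \<delta> \<le> K1 / 2"
    proof -
      have "144 \<le> 4 * (real D1)\<^sup>2 * 1792 * 36" using D1sq D1b by linarith
      then have "144 / \<delta> \<le> K1" unfolding K1 using \<delta> by (intro divide_right_mono) auto
      then show ?thesis by simp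
    qed
    also have "\<dots> \<le> (K1 / 2) ^ r" using K1b r1 by (intro self_le_power) auto
    finally have "ln (real \<alpha>) * (72 / \<delta>) \<le> (h * 2 ^ r) * (K1 / 2) ^ r"
      using hge[OF \<alpha>] la[OF \<alpha>] h0 \<delta> by (intro mult_mono) auto
    also have "\<dots> = h * 1 * K1 ^ r" by (simp add: power_divide)
    also have "\<dots> \<le> N0" unfolding N0' using E1 h0 K1b by (intro mult_right_mono mult_left_mono) auto
    finally show ?thesis .
  qed
  have N36: "36 / \<delta> \<le> N0"
  proof -
    have "1 / 2 * (72 / \<delta>) \<le> ln (real p0) * (72 / \<delta>)" using la[OF p0] \<delta> by (intro mult_right_mono) auto
    then show ?thesis using Nge[OF p0] by simp
  qed
  have N1: "N0 > 1"
  proof -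
    have "36 \<le> 36 / \<delta>" using \<delta> by (simp add: le_divide_eq)
    then show ?thesis using N36 by linarith
  qed
  obtain m where m: "N0 \<le> 2 ^ m" "2 ^ m \<le> 2 * N0"
  proof -
    define m where "m = (LEAST m. N0 \<le> 2 ^ m)"
    have ex: "\<exists>m. N0 \<le> 2 ^ m" using real_arch_pow[of 2 N0] by (auto intro: less_imp_le)
    have 1: "N0 \<le> 2 ^ m" unfolding m_def by (rule LeastI_ex[OF ex])
    then have "m \<noteq> 0" using N1 by (intro notI) simp
    then obtain k where k: "m = Suc k" by (cases m) auto
    have "\<not> N0 \<le> 2 ^ k" using not_less_Least[of k "\<lambda>m. N0 \<le> 2 ^ m"] k m_def by auto
    then have "2 ^ m \<le> 2 * N0" using k by simp
    then show ?thesis by (rule that[OF 1])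
  qed
  have m1: "m \<ge> 1" using m(1) N1 by (cases m) auto
  have mH: "2 ^ m \<le> H" using m(2) small by linarith
  define c where "c = \<delta> / 36"
  define Y where "Y = c * 2 ^ m"
  define S where "S = D1 * r"
  define L where "L \<alpha> = nat \<lfloor>Y / ln (real \<alpha>)\<rfloor>" for \<alpha>
  have c0: "0 < c" "c \<le> 1 / 36" using \<delta> by (auto simp: c_def)
  have Yln: "2 * ln (real \<alpha>) \<le> Y" if "\<alpha> \<in> I" for \<alpha>
  proof -
    have "c * (ln (real \<alpha>) * (72 / \<delta>)) \<le> c * 2 ^ m" using Nge[OF that] m(1) c0 by (intro mult_left_mono) auto
    then show ?thesis unfolding Y_def c_def using \<delta> by simp
  qed
  have Y1: "Y \<ge> 1" using Yln[OF p0] la[OF p0] by linarith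
  have Ym: "Y \<le> 2 ^ m / 36" unfolding Y_def using c0 by simp
  have L2: "real (L \<alpha>) * ln (real \<alpha>) \<le> Y" "Y / (2 * ln (real \<alpha>)) \<le> real (L \<alpha>)" "L \<alpha> \<le> 2 ^ m" if \<alpha>: "\<alpha> \<in> I" for \<alpha>
  proof -
    have l0: "ln (real \<alpha>) > 0" using la[OF \<alpha>] by linarith
    define y where "y = Y / ln (real \<alpha>)"
    have y2: "y \<ge> 2" unfolding y_def using Yln[OF \<alpha>] l0 by (simp add: le_divide_eq)
    have Ly: "real (L \<alpha>) \<le> y" "y - 1 \<le> real (L \<alpha>)" using y2 unfolding L_def y_def[symmetric] by linarith+
    show "real (L \<alpha>) * ln (real \<alpha>) \<le> Y" using Ly(1) l0 unfolding y_def by (simp add: le_divide_eq)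
    have "Y / (2 * ln (real \<alpha>)) = y / 2" by (simp add: y_def)
    then show "Y / (2 * ln (real \<alpha>)) \<le> real (L \<alpha>)" using Ly(2) y2 by linarith
    have "y \<le> Y / (1 / 2)" unfolding y_def using la[OF \<alpha>] Y1 by (intro divide_left_mono) auto
    then have "y \<le> 2 * Y" by simp
    then have "y \<le> 2 ^ m" using Ym Y1 by linarith
    then have "real (L \<alpha>) \<le> 2 ^ m" using Ly(1) by linarith
    then show "L \<alpha> \<le> 2 ^ m" by (metis of_nat_le_iff of_nat_numeral of_nat_power)
  qed
  have S1: "S \<ge> 1" unfolding S_def using r1 D1b by (cases D1) auto
  interpret b: baker I a p0 L m S B r E Y
    by unfold_locales (use sq r_def m1 S1 E1 Y1 B L2 in auto)
  have rS: "real S = real D1 * real r" by (simp add: S_def)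
  have bW: "b.W = real D1 * real r * 4 ^ r" unfolding b.W_def rS by simp
  have bZ: "real b.Zm = real D1 * real r * 4 ^ r * real r * 2 ^ m" unfolding b.Zm_def by (simp add: rS)
  have lnG: "ln (real b.G) \<le> 4 * x"
  proof -
    have "real b.G = 2 * real B * 2 ^ m" by (simp add: b.G_def)
    also have "\<dots> \<le> H * H\<^sup>2 * H" using B(3) mH H by (intro mult_mono) auto
    also have "\<dots> = H ^ 4" by (simp add: power4_eq_xxxx power2_eq_square)
    finally have "ln (real b.G) \<le> ln (H ^ 4)" using b.G1 by (intro ln_mono) auto
    also have "\<dots> = 4 * x" using H by (simp add: ln_realpow x_def)
    finally show ?thesis .
  qed
  define M :: real where "M = 2 ^ m"
  have M1: "M \<ge> 1" by (simp add: M_def)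
  have mM: "real m \<le> M" unfolding M_def using of_nat_less_two_power[of m, where 'a = real] by simp
  have rM: "real r * M \<ge> 1" using mult_mono[of 1 "real r" 1 M] r1 M1 by simp
  have main: "4 + 2 * b.Usz + 8 * Y + 8 * real r * Y * real S \<le> real S * 2 ^ m * ln E"
  proof -
    have e1: "4 + 2 * b.Usz + 8 * Y + 8 * real r * Y * real S
        = 6 + 4 * (real m * real r) + 16 * (real r * M * ln (real b.G)) + 10 * (real r * Y * real S) + 8 * Y"
      unfolding b.Usz_def b.T_def M_def by (simp add: algebra_simps)
    have a1: "6 \<le> 6 * (real r * M * x)" using mult_mono[OF rM x1] x1 rM by simp
    have a2: "real m * real r \<le> real r * M * x"
    proof -
      have "real m * real r \<le> real r * M" using mult_right_mono[OF mM, of "real r"] by (simp add: mult.commute)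
      also have "\<dots> \<le> real r * M * x" using mult_left_mono[OF x1, of "real r * M"] rM by simp
      finally show ?thesis .
    qed
    have a3: "real r * M * ln (real b.G) \<le> 4 * (real r * M * x)"
      using mult_left_mono[OF lnG, of "real r * M"] rM by simp
    have a4: "8 * Y \<le> 8 * (real r * Y * real S)"
    proof -
      have "1 * Y * 1 \<le> real r * Y * real S" using r1 S1 Y1 by (intro mult_mono) auto
      then show ?thesis by simp
    qed
    have a5: "36 * (real r * Y * real S) \<le> real S * M * (\<delta> * x)"
    proof -
      have "36 * (real r * Y * real S) = real S * M * (\<delta> * real r)"
        unfolding Y_def c_def M_def by simp
      also have "\<dots> \<le> real S * M * (\<delta> * x)" using rx \<delta> M1 by (intro mult_left_mono) auto
      finally show ?thesis .
    qed
    have a6: "320 * (real r * M * x) \<le> real S * M * (\<delta> * x)"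
    proof -
      have "320 * (real r * M * x) \<le> (real D1 * \<delta>) * (real r * M * x)"
        using D1p rM x1 by (intro mult_right_mono) auto
      also have "\<dots> = real S * M * (\<delta> * x)" by (simp add: rS)
      finally show ?thesis .
    qed
    have pos: "0 \<le> real r * M * x" using rM x1 by simp
    have "4 + 2 * b.Usz + 8 * Y + 8 * real r * Y * real S \<le> real S * M * (\<delta> * x)"
      unfolding e1 using a1 a2 a3 a4 a5 a6 pos by linarith
    then show ?thesis unfolding lnE M_def .
  qed
  have count: "(real r * b.W * E + 1) * (2 * real (((b.T + (r - 1)) choose (r - 1)) * S)) \<le> real (card b.box)"
  proof -
    have r2: "real r \<le> 2 ^ r" using of_nat_less_two_power[of r, where 'a = real] by simp
    have W0: "1 \<le> b.W" by (rule b.W1)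
    have "1 * 1 * 1 \<le> real r * b.W * E" using r1 W0 E1 by (intro mult_mono) auto
    then have k1: "real r * b.W * E + 1 \<le> 2 * (real r * b.W * E)" by linarith
    have "real ((b.T + (r - 1)) choose (r - 1)) = real ((4 * ((r - 1) + 1) * 2 ^ m + (r - 1)) choose (r - 1))"
      unfolding b.T_def using r1 by simp
    also have "\<dots> \<le> (28 * M) ^ (r - 1)"
      using binomial_box_bound[of "2 ^ m" "r - 1"] by (simp add: M_def)
    finally have k2: "real ((b.T + (r - 1)) choose (r - 1)) \<le> (28 * M) ^ (r - 1)" .
    have "(real r * b.W * E + 1) * (2 * real (((b.T + (r - 1)) choose (r - 1)) * S))
        \<le> 2 * (real r * b.W * E) * (2 * ((28 * M) ^ (r - 1) * real S))"
      unfolding of_nat_mult using k1 k2 E1 W0 by (intro mult_mono mult_left_mono mult_right_mono) auto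
    also have "\<dots> = 4 * (real D1)\<^sup>2 * (real r ^ 3) * 4 ^ r * E * (28 * M) ^ (r - 1)"
      unfolding bW rS by (simp add: power2_eq_square power3_eq_cube)
    also have "\<dots> \<le> 4 * (real D1)\<^sup>2 * (2 ^ r) ^ 3 * 4 ^ r * E * (28 ^ r * M ^ (r - 1))"
    proof (intro mult_mono)
      show "real r ^ 3 \<le> (2 ^ r) ^ 3" using r2 by (intro power_mono) auto
      have "(28::real) ^ (r - 1) \<le> 28 ^ r" by (intro power_increasing) auto
      then show "(28 * M) ^ (r - 1) \<le> 28 ^ r * M ^ (r - 1)" unfolding power_mult_distrib using M1 by (intro mult_right_mono) auto
    qed (use E1 M1 in auto)
    also have "\<dots> = 4 * (real D1)\<^sup>2 * E * 896 ^ r * M ^ (r - 1)"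
    proof -
      have "(2 ^ r) ^ 3 * 4 ^ r * (28::real) ^ r = 896 ^ r"
      proof -
        have "((2::real) ^ r) ^ 3 = 8 ^ r" unfolding power_mult[symmetric] mult.commute[of r] unfolding power_mult by simp
        then show ?thesis by (simp only: power_mult_distrib[symmetric]) simp
      qed
      moreover have "4 * (real D1)\<^sup>2 * (2 ^ r) ^ 3 * 4 ^ r * E * (28 ^ r * M ^ (r - 1))
          = 4 * (real D1)\<^sup>2 * E * ((2 ^ r) ^ 3 * 4 ^ r * 28 ^ r) * M ^ (r - 1)" by (simp only: mult_ac)
      ultimately show ?thesis by simp
    qed
    also have "\<dots> \<le> (Y / 2) ^ r / h"
    proof -
      have "4 * (real D1)\<^sup>2 * 1792 ^ r \<le> (4 * (real D1)\<^sup>2) ^ r * 1792 ^ r"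
      proof (rule mult_right_mono)
        have "1 \<le> 4 * (real D1)\<^sup>2" using D1sq D1b by linarith
        then show "4 * (real D1)\<^sup>2 \<le> (4 * (real D1)\<^sup>2) ^ r" using r1 by (intro self_le_power) auto
      qed simp
      also have "\<dots> = (K1 * c) ^ r" using K1d unfolding c_def power_mult_distrib[symmetric] by simp
      finally have kk: "4 * (real D1)\<^sup>2 * 1792 ^ r \<le> (K1 * c) ^ r" .
      have "h * (4 * (real D1)\<^sup>2 * E * 896 ^ r * M ^ (r - 1)) = (4 * (real D1)\<^sup>2 * 1792 ^ r) * (h * E * M ^ (r - 1) / 2 ^ r)"
      proof -
        have "(1792::real) ^ r = 896 ^ r * 2 ^ r" unfolding power_mult_distrib[symmetric] by simp
        then show ?thesis by simp
      qed
      also have "\<dots> \<le> (K1 * c) ^ r * (h * E * M ^ (r - 1) / 2 ^ r)"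
        using h0 E1 M1 by (intro mult_right_mono kk) auto
      also have "\<dots> = N0 * ((c / 2) ^ r * M ^ (r - 1))"
        unfolding N0' by (simp add: power_mult_distrib power_divide)
      also have "\<dots> \<le> M * ((c / 2) ^ r * M ^ (r - 1))"
        using m(1) c0 M1 by (intro mult_right_mono) (auto simp: M_def)
      also have "\<dots> = (Y / 2) ^ r"
      proof -
        have "M * M ^ (r - 1) = M ^ r" using r1 by (metis Suc_diff_le diff_Suc_1 power_Suc One_nat_def)
        then show ?thesis unfolding Y_def M_def[symmetric] by (simp add: power_mult_distrib power_divide mult_ac)
      qed
      finally show ?thesis using h0 by (simp add: field_simps)
    qed
    also have "\<dots> = (\<Prod>\<alpha>\<in>I. Y / (2 * ln (real \<alpha>)))"
      unfolding h_def r_def by (simp add: prod_dividef prod.distrib power_divide)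
    also have "\<dots> \<le> (\<Prod>\<alpha>\<in>I. real (L \<alpha>))"
      using L2 Y1 la by (intro prod_mono) (force intro!: divide_nonneg_nonneg)
    also have "\<dots> = real (card b.box)" by (simp add: b.card_box)
    finally show ?thesis .
  qed
  have lb: "1 < 2 * (2 ^ m * \<bar>Lam\<bar> * b.W) * exp Y * (real b.Zm + 1) * b.Qf ^ b.Zm"
    by (rule b.lower_bound[OF count main])
  define Z where "Z = real b.Zm"
  have "1 \<le> b.Zm" unfolding b.Zm_def using S1 r1 by (simp add: Suc_le_eq)
  then have Z1: "1 \<le> Z" unfolding Z_def by simp
  have WZ: "b.W \<le> Z"
  proof -
    have "b.W * (1 * 1) \<le> b.W * (real r * M)" using b.W1 r1 M1 by (intro mult_left_mono mult_mono) auto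
    then show ?thesis unfolding Z_def bZ bW M_def by (simp add: mult_ac)
  qed
  have MZ: "M \<le> Z"
  proof -
    have "M * (1 * 1) \<le> M * (b.W * real r)" using b.W1 r1 M1 by (intro mult_left_mono mult_mono) auto
    then show ?thesis unfolding Z_def bZ bW M_def by (simp add: mult_ac)
  qed
  have Qf1: "1 \<le> b.Qf"
  proof -
    have "1 * 1 * 1 * 1 \<le> (2 * b.W) * 2 ^ m * (2 * Y + 1) * E" using b.W1 Y1 E1 by (intro mult_mono) auto
    then show ?thesis by (simp add: b.Qf_def)
  qed
  have r2: "real r \<le> 2 ^ r" using of_nat_less_two_power[of r, where 'a = real] by simp
  have lnQ: "ln b.Qf \<le> 8 * x"
  proof -
    have "2 * b.W \<le> 2 * real D1 * 8 ^ r"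
    proof -
      have "2 * b.W = 2 * real D1 * (real r * 4 ^ r)" by (simp add: bW)
      also have "\<dots> \<le> 2 * real D1 * (2 ^ r * 4 ^ r)" using r2 by (intro mult_left_mono mult_right_mono) auto
      finally show ?thesis unfolding power_mult_distrib[symmetric] by simp
    qed
    then have "b.Qf \<le> (2 * real D1 * 8 ^ r) * 2 ^ m * (2 * Y + 1) * E"
      unfolding b.Qf_def using Y1 E1 by (intro mult_right_mono) auto
    also have "\<dots> \<le> (H * exp (3 * x)) * H * H * exp x"
    proof (intro mult_mono)
      show "2 * real D1 \<le> H" using H D1b by (simp add: ln_le_cancel_iff)
      have "(8::real) ^ r \<le> exp 3 ^ r"
      proof (rule power_mono)
        have "(2::real) ^ 3 \<le> exp 1 ^ 3" using exp_ge_add_one_self[of "1::real"] by (intro power_mono) auto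
        then show "(8::real) \<le> exp 3" by (simp flip: exp_of_nat_mult)
      qed simp
      also have "\<dots> = exp (real r * 3)" by (rule exp_of_nat_mult[symmetric])
      also have "\<dots> \<le> exp (3 * x)" using rx by simp
      finally show "8 ^ r \<le> exp (3 * x)" .
      show "2 ^ m \<le> H" by (rule mH)
      have "1 \<le> (2::real) ^ m" by simp
      then show "2 * Y + 1 \<le> H" using Ym mH m1 self_le_power[of "2::real" m] by auto
      show "E \<le> exp x" unfolding E_def using \<delta> x1 by (simp add: mult_left_le_one_le)
    qed (use H Y1 E1 in auto)
    also have "\<dots> = exp (7 * x)"
    proof -
      have "H = exp x" using H by (simp add: x_def)
      then show ?thesis by (simp flip: exp_add)
    qed
    finally have "ln b.Qf \<le> ln (exp (7 * x))" using Qf1 by (intro ln_mono) auto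
    then show ?thesis using x1 by simp
  qed
  have Lnz: "\<bar>Lam\<bar> > 0" using lb by auto
  have "1 < exp 1 * (exp Z * \<bar>Lam\<bar> * exp Z) * exp Z * exp Z * exp (Z * (8 * x))"
  proof (rule less_le_trans[OF lb], intro mult_mono)
    show "(2::real) \<le> exp 1" using exp_ge_add_one_self[of "1::real"] by simp
    have ez: "y \<le> exp Z" if "y \<le> Z + 1" for y using that exp_ge_add_one_self[of Z] by linarith
    show "2 ^ m \<le> exp Z" by (rule ez) (use MZ in \<open>simp add: M_def\<close>)
    show "b.W \<le> exp Z" by (rule ez) (use WZ in simp)
    have "Y \<le> M" using Ym Y1 unfolding M_def by linarith
    then show "exp Y \<le> exp Z" using MZ by simp
    show "real b.Zm + 1 \<le> exp Z" by (rule ez) (simp add: Z_def)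
    have "b.Qf ^ b.Zm = exp (Z * ln b.Qf)" using Qf1 by (simp add: Z_def exp_of_nat_mult)
    also have "\<dots> \<le> exp (Z * (8 * x))" using lnQ Z1 by simp
    finally show "b.Qf ^ b.Zm \<le> exp (Z * (8 * x))" .
  qed (use b.W1 Qf1 in auto)
  also have "\<dots> = \<bar>Lam\<bar> * exp (1 + 4 * Z + Z * (8 * x))" by (simp add: exp_add mult_ac flip: exp_add)
  also have "\<dots> \<le> \<bar>Lam\<bar> * exp (13 * x * Z)"
  proof -
    have "1 + 4 * Z + Z * (8 * x) \<le> Z * x + 4 * (Z * x) + 8 * (Z * x)"
    proof -
      have "Z \<le> Z * x" using mult_left_mono[OF x1, of Z] Z1 by simp
      moreover have "Z * (8 * x) = 8 * (Z * x)" by simp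
      ultimately show ?thesis using Z1 by linarith
    qed
    then show ?thesis using Lnz by (simp add: mult_ac)
  qed
  finally have "exp (- (13 * x * Z)) < \<bar>Lam\<bar>" by (simp add: exp_minus field_simps)
  moreover have "Z \<le> real D1 * 16 ^ r * (2 * N0)"
  proof -
    have "Z = real D1 * (real r * real r * 4 ^ r) * 2 ^ m" unfolding Z_def bZ by simp
    also have "\<dots> \<le> real D1 * (2 ^ r * 2 ^ r * 4 ^ r) * (2 * N0)"
      using r2 m(2) N1 by (intro mult_mono) auto
    finally show ?thesis unfolding power_mult_distrib[symmetric] by simp
  qed
  then have "13 * x * Z \<le> 13 * x * (real D1 * 16 ^ r * (2 * N0))" using x1 by (intro mult_left_mono) auto
  then have "exp (- (13 * x * (real D1 * 16 ^ r * (2 * N0)))) \<le> exp (- (13 * x * Z))" by simp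
  ultimately show ?thesis unfolding x_def r_def by linarith
qed

section \<open>Sparse digit expansions\<close>

definition linear_form_bound :: "real \<Rightarrow> real \<Rightarrow> real \<Rightarrow> bool" where
  "linear_form_bound K H V \<longleftrightarrow> (\<forall>I a p0. linear_form I a p0 \<longrightarrow> square_independent I \<longrightarrow>
    (\<forall>\<alpha>\<in>I. \<bar>of_int (a \<alpha>)\<bar> \<le> H\<^sup>2) \<longrightarrow> real (card I) \<le> ln H \<longrightarrow>
    K ^ card I * (\<Prod>\<alpha>\<in>I. ln (real \<alpha>)) * V \<le> H \<longrightarrow>
    exp (- (K ^ card I * (\<Prod>\<alpha>\<in>I. ln (real \<alpha>)) * V)) \<le> \<bar>linear_form.Lam I a\<bar>)"

lemma linear_form_lower_bound:
  fixes \<delta> :: real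
  assumes \<delta>: "0 < \<delta>" "\<delta> \<le> 1"
  obtains K H0 :: real where "K \<ge> 2"
    "\<And>H. H \<ge> H0 \<Longrightarrow> linear_form_bound K H (H powr (2 * \<delta>))"
proof -
  define D1 where "D1 = nat \<lceil>320 / \<delta>\<rceil>"
  define K1 where "K1 = 4 * (real D1)\<^sup>2 * 1792 * 36 / \<delta>"
  define K where "K = 416 * (real D1)\<^sup>2 * K1"
  have D1: "320 / \<delta> \<le> real D1" unfolding D1_def using \<delta> by (simp add: real_nat_ceiling_ge)
  have "320 \<le> 320 / \<delta>" using \<delta> by (simp add: le_divide_eq)
  then have D1b: "320 \<le> real D1" using D1 by linarith
  have D1i: "1 / \<delta> \<le> real D1" using D1 \<delta> by (simp add: field_simps)
  have D1sq: "real D1 \<le> (real D1)\<^sup>2" using D1b by (simp add: power2_eq_square)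
  have K1b: "2 \<le> K1"
  proof -
    have "2 \<le> 4 * (real D1)\<^sup>2 * 1792 * 36" using D1sq D1b by linarith
    also have "\<dots> \<le> K1" unfolding K1_def using \<delta> by (simp add: le_divide_eq mult_left_le)
    finally show ?thesis .
  qed
  have K1K: "2 * K1 \<le> K"
  proof -
    have "2 \<le> 416 * (real D1)\<^sup>2" using D1sq D1b by linarith
    then show ?thesis unfolding K_def using K1b by (intro mult_right_mono) auto
  qed
  show ?thesis
  proof (rule that[of K "2 * real D1"])
    show "2 \<le> K" using K1K K1b by linarith
    fix H :: real assume H: "2 * real D1 \<le> H"
    show "linear_form_bound K H (H powr (2 * \<delta>))"
      unfolding linear_form_bound_def
    proof (intro allI impI)
      fix I a p0
      assume lf: "linear_form I a p0" and sq: "square_independent I"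
        and a: "\<forall>\<alpha>\<in>I. \<bar>of_int (a \<alpha>)\<bar> \<le> H\<^sup>2" and r: "real (card I) \<le> ln H"
        and small: "K ^ card I * (\<Prod>\<alpha>\<in>I. ln (real \<alpha>)) * H powr (2 * \<delta>) \<le> H"
      interpret linear_form I a p0 by (rule lf)
      define h where "h = (\<Prod>\<alpha>\<in>I. ln (real \<alpha>))"
      define r where "r = card I"
      define N0 where "N0 = h * exp (\<delta> * ln H) * K1 ^ card I"
      have r1: "r \<ge> 1" unfolding r_def using finI p0 by (metis Suc_leI card_gt_0_iff empty_iff One_nat_def)
      have H3: "3 \<le> H" using H D1b by linarith
      have h0: "h \<ge> 0" unfolding h_def using ge2 by (intro prod_nonneg) (auto intro!: ln_ge_zero dest!: ge2)
      have Hd: "exp (\<delta> * ln H) = H powr \<delta>" using H3 by (simp add: powr_def)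
      have Hd1: "1 \<le> H powr \<delta>" using H3 \<delta> by (simp add: ge_one_powr_ge_zero)
      have H2d: "H powr (2 * \<delta>) = H powr \<delta> * H powr \<delta>" by (simp flip: powr_add)
      have lnH: "ln H \<le> real D1 * H powr \<delta>"
      proof -
        have "ln H \<le> H powr \<delta> / \<delta>" using H3 \<delta> by (intro ln_powr_bound) auto
        also have "\<dots> = (1 / \<delta>) * H powr \<delta>" by simp
        also have "\<dots> \<le> real D1 * H powr \<delta>" using D1i by (intro mult_right_mono) auto
        finally show ?thesis .
      qed
      have lnH1: "1 \<le> ln H"
      proof -
        have "ln (exp 1) \<le> ln H" using exp_le H3 by (intro ln_mono) auto
        then show ?thesis by simp
      qed
      have B: "\<bar>a \<alpha>\<bar> \<le> int (nat \<lfloor>H\<^sup>2\<rfloor>)" if "\<alpha> \<in> I" for \<alpha>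
      proof -
        have "of_int \<bar>a \<alpha>\<bar> \<le> H\<^sup>2" using a that by simp
        then have "\<bar>a \<alpha>\<bar> \<le> \<lfloor>H\<^sup>2\<rfloor>" by (simp only: le_floor_iff)
        then show ?thesis by linarith
      qed
      have Hsq: "1 \<le> H\<^sup>2" using H3 by (simp add: one_le_power)
      have P: "K1 ^ r * 2 \<le> K ^ r"
      proof -
        have "K1 ^ r * 2 \<le> K1 ^ r * 2 ^ r" using r1 K1b self_le_power[of "2::real" r] by (intro mult_left_mono) auto
        also have "\<dots> = (2 * K1) ^ r" by (simp add: power_mult_distrib)
        also have "\<dots> \<le> K ^ r" using K1K K1b by (intro power_mono) auto
        finally show ?thesis .
      qed
      have small2: "2 * N0 \<le> H"
      proof -
        have "2 * N0 = (K1 ^ r * 2) * h * (H powr \<delta> * 1)" unfolding N0_def Hd r_def by simp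
        also have "\<dots> \<le> K ^ r * h * (H powr \<delta> * H powr \<delta>)"
          using P h0 Hd1 K1b K1K by (intro mult_mono mult_right_mono) auto
        also have "\<dots> \<le> H" using small unfolding h_def r_def H2d .
        finally show ?thesis .
      qed
      have "exp (- (13 * ln H * (real D1 * 16 ^ card I * (2 * N0)))) \<le> \<bar>Lam\<bar>"
        by (rule linear_form_params[OF lf sq B _ _ r \<delta> D1 _ lnH1 _ K1_def _ small2])
           (use Hsq H H3 D1b in \<open>auto simp: N0_def h_def le_nat_iff le_floor_iff\<close>)
      moreover have "13 * ln H * (real D1 * 16 ^ card I * (2 * N0)) \<le> K ^ r * h * H powr (2 * \<delta>)"
      proof -
        have "13 * ln H * (real D1 * 16 ^ card I * (2 * N0))
            = ln H * (26 * real D1 * 16 ^ r * K1 ^ r * h * H powr \<delta>)" unfolding N0_def Hd r_def by simp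
        also have "\<dots> \<le> (real D1 * H powr \<delta>) * (26 * real D1 * 16 ^ r * K1 ^ r * h * H powr \<delta>)"
          using lnH h0 K1b by (intro mult_right_mono) auto
        also have "\<dots> = (26 * (real D1)\<^sup>2) * 16 ^ r * K1 ^ r * h * H powr (2 * \<delta>)"
          unfolding H2d by (simp add: power2_eq_square)
        also have "\<dots> \<le> (26 * (real D1)\<^sup>2) ^ r * 16 ^ r * K1 ^ r * h * H powr (2 * \<delta>)"
        proof (intro mult_right_mono)
          have "1 \<le> 26 * (real D1)\<^sup>2" using D1sq D1b by linarith
          then show "26 * (real D1)\<^sup>2 \<le> (26 * (real D1)\<^sup>2) ^ r" using r1 by (intro self_le_power) auto
        qed (use h0 K1b in auto)
        also have "(26 * (real D1)\<^sup>2) ^ r * 16 ^ r * K1 ^ r = K ^ r"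
          unfolding K_def power_mult_distrib[symmetric] by simp
        finally show ?thesis .
      qed
      ultimately show "exp (- (K ^ card I * (\<Prod>\<alpha>\<in>I. ln (real \<alpha>)) * H powr (2 * \<delta>))) \<le> \<bar>Lam\<bar>"
        unfolding h_def[symmetric] r_def[symmetric] by (smt (verit) exp_le_cancel_iff)
    qed
  qed
qed

lemma prime_part_decomposition:
  fixes x :: nat
  assumes x: "x > 0" and Pr: "finite Pr" "\<And>q. q \<in> Pr \<Longrightarrow> prime q"
  shows "\<exists>x0. x = (\<Prod>q\<in>Pr. q ^ multiplicity q x) * x0 \<and> x0 > 0 \<and> (\<forall>q\<in>Pr. \<not> q dvd x0) \<and>
    (prime_factors x \<subseteq> Pr \<longrightarrow> x0 = 1)"
proof -
  define x0 where "x0 = (\<Prod>p\<in>prime_factors x - Pr. p ^ multiplicity p x)"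
  have fin: "finite (prime_factors x)" by simp
  have "x = (\<Prod>p\<in>prime_factors x. p ^ multiplicity p x)" using x by (rule prime_factorization_nat)
  also have "\<dots> = (\<Prod>p\<in>prime_factors x \<inter> Pr. p ^ multiplicity p x) * x0"
    unfolding x0_def by (rule prod.Int_Diff[OF fin])
  also have "(\<Prod>p\<in>prime_factors x \<inter> Pr. p ^ multiplicity p x) = (\<Prod>q\<in>Pr. q ^ multiplicity q x)"
  proof (intro prod.mono_neutral_left Pr ballI)
    fix q assume q: "q \<in> Pr - prime_factors x \<inter> Pr"
    then have "\<not> q dvd x" using Pr(2) x by (auto simp: prime_factors_dvd)
    then show "q ^ multiplicity q x = 1" by (simp add: not_dvd_imp_multiplicity_0)
  qed auto
  finally have 1: "x = (\<Prod>q\<in>Pr. q ^ multiplicity q x) * x0" .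
  have 2: "\<not> q dvd x0" if q: "q \<in> Pr" for q
  proof
    assume "q dvd x0"
    then have "\<exists>p\<in>prime_factors x - Pr. q dvd p ^ multiplicity p x"
      unfolding x0_def using prime_dvd_prod_iff[OF finite_Diff[OF fin, of Pr] Pr(2)[OF q], of "\<lambda>p. p ^ multiplicity p x"]
      by simp
    then obtain p where p: "p \<in> prime_factors x - Pr" "q dvd p ^ multiplicity p x" by (rule bexE)
    then have "q dvd p" using prime_dvd_power[OF Pr(2)[OF q] p(2)] by simp
    then have "q = p" using primes_dvd_imp_eq[OF Pr(2)[OF q]] p(1) by auto
    then show False using p q by auto
  qed
  have 4: "x0 = 1" if "prime_factors x \<subseteq> Pr"
    unfolding x0_def using that by (simp add: Diff_eq_empty_iff[THEN iffD2])
  have "x0 > 0" using 1 x by (cases "x0 = 0") auto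
  then show ?thesis using 1 2 4 by blast
qed

lemma nonsquare_root:
  fixes N :: nat
  assumes "N \<ge> 2"
  shows "\<exists>M e. N = M ^ (2 ^ e) \<and> M \<ge> 2 \<and> \<not> (\<exists>t. M = t\<^sup>2)"
  using assms
proof (induction N rule: less_induct)
  case (less N)
  show ?case
  proof (cases "\<exists>t. N = t\<^sup>2")
    case True
    then obtain t where t: "N = t\<^sup>2" by blast
    have t2: "t \<ge> 2" using t less.prems by (cases "t = 0 \<or> t = 1") auto
    then have "t < N" unfolding t by (simp add: power2_eq_square)
    then obtain M e where "t = M ^ (2 ^ e)" "M \<ge> 2" "\<not> (\<exists>t. M = t\<^sup>2)" using less.IH t2 by blast
    then show ?thesis using t by (intro exI[of _ M] exI[of _ "Suc e"]) (simp add: power_mult[symmetric] mult.commute)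
  next
    case False
    then show ?thesis using less.prems by (intro exI[of _ N] exI[of _ 0]) auto
  qed
qed

lemma square_independent_primes:
  assumes Pr: "finite Pr" "\<And>q. q \<in> Pr \<Longrightarrow> prime q"
    and M: "\<And>q. q \<in> Pr \<Longrightarrow> \<not> q dvd M" "M > 0" "\<not> (\<exists>t. M = t\<^sup>2)"
  shows "square_independent (insert M Pr)"
  unfolding square_independent_def
proof (intro allI impI notI)
  fix J assume J: "J \<subseteq> insert M Pr" "J \<noteq> {}" and "\<exists>t. \<Prod>J = t\<^sup>2"
  then obtain t where t: "\<Prod>J = t\<^sup>2" by blast
  have finJ: "finite J" using J Pr finite_subset by blast
  show False
  proof (cases "J \<inter> Pr = {}")
    case True
    then have "J = {M}" using J by auto
    then show False using t M by auto
  next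
    case False
    then obtain q where q: "q \<in> J" "q \<in> Pr" by auto
    have pq: "prime q" using Pr q by auto
    have "\<Prod>J = q * \<Prod>(J - {q})" using q finJ by (simp add: prod.remove)
    moreover have nd: "\<not> q dvd \<Prod>(J - {q})"
    proof
      assume "q dvd \<Prod>(J - {q})"
      then obtain y where y: "y \<in> J - {q}" "q dvd y"
        using prime_dvd_prod_iff[of "J - {q}" q "\<lambda>x. x"] finJ pq by auto
      show False
      proof (cases "y = M")
        case True
        then show False using y q M by auto
      next
        case False
        then have "prime y" using y J Pr by auto
        then show False using y pq by (metis DiffE insertI1 primes_dvd_imp_eq)
      qed
    qed
    ultimately have eq: "t\<^sup>2 = q * \<Prod>(J - {q})" using t by simp
    then have "q dvd t" using pq by (metis dvd_triv_left prime_dvd_power)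
    then obtain s where s: "t = q * s" by blast
    then have "q * (q * s\<^sup>2) = q * \<Prod>(J - {q})" using eq by (simp add: power2_eq_square mult_ac)
    then have "q * s\<^sup>2 = \<Prod>(J - {q})" using pq by (simp add: prime_gt_0_nat)
    then show False using nd by (metis dvd_triv_left)
  qed
qed

lemma exponent_le_ln:
  fixes v n q :: nat
  assumes "q \<ge> 2" "q ^ v \<le> n"
  shows "real v \<le> 2 * ln (real n)"
proof -
  have "2 ^ v \<le> q ^ v" using assms by (intro power_mono) auto
  then have "2 ^ v \<le> n" using assms by linarith
  then have "2 ^ v \<le> real n" by (metis of_nat_le_iff of_nat_numeral of_nat_power)
  then have "ln (2 ^ v) \<le> ln (real n)" by (intro ln_mono) auto
  then have "real v * ln 2 \<le> ln (real n)" by (simp add: ln_realpow)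
  moreover have "real v * (1 / 2) \<le> real v * ln 2" using ln2_half by (intro mult_left_mono) auto
  ultimately show ?thesis by linarith
qed

lemma ln_prime_part:
  assumes Pr: "finite Pr" "\<And>q. q \<in> Pr \<Longrightarrow> prime (q::nat)" and x: "x = (\<Prod>q\<in>Pr. q ^ multiplicity q x) * x0" "x0 > 0"
  shows "ln (real x) = (\<Sum>q\<in>Pr. real (multiplicity q x) * ln (real q)) + ln (real x0)"
proof -
  have pos: "q > 0" if "q \<in> Pr" for q using Pr(2)[OF that] by (rule prime_gt_0_nat)
  have "real x = (\<Prod>q\<in>Pr. real q ^ multiplicity q x) * real x0"
    by (subst x(1)) simp
  also have "ln \<dots> = ln (\<Prod>q\<in>Pr. real q ^ multiplicity q x) + ln (real x0)"
    using x(2) pos by (intro ln_mult_pos) (auto intro!: prod_pos)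
  also have "ln (\<Prod>q\<in>Pr. real q ^ multiplicity q x) = (\<Sum>q\<in>Pr. ln (real q ^ multiplicity q x))"
    using pos by (intro ln_prod Pr) auto
  also have "\<dots> = (\<Sum>q\<in>Pr. real (multiplicity q x) * ln (real q))"
    by (intro sum.cong refl ln_realpow)
  finally show ?thesis .
qed

lemma truncation_linear_form:
  fixes K H Hd :: real and n b j N :: nat
  assumes K: "K \<ge> 1" and Hd: "Hd \<ge> 0"
    and LB: "linear_form_bound K H Hd"
    and b: "b \<ge> 2" and n: "n > 0" and H: "H = ln (real n)" and N: "N \<ge> 1" and Nn: "N * b ^ j < n"
    and Pr: "Pr = prime_factors n \<union> prime_factors b"
    and s: "real (card Pr) + 1 \<le> ln H" and Hb: "2 * (real b + 1) \<le> H"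
    and Q: "Q = K ^ (card Pr + 1) * (\<Prod>q\<in>Pr. ln (real q)) * max 1 (ln (real N)) * Hd" "Q \<le> H"
  shows "exp (- Q) \<le> ln (real n / (real N * real b ^ j))"
proof -
  have finP: "finite Pr" and primeP: "\<And>q. q \<in> Pr \<Longrightarrow> prime q" unfolding Pr by auto
  have pge2: "q \<ge> 2" if "q \<in> Pr" for q using primeP[OF that] by (rule prime_ge_2_nat)
  define ld where "ld = ln (real n / (real N * real b ^ j))"
  have NB: "real N * real b ^ j < real n"
    using Nn by (metis of_nat_less_iff of_nat_mult of_nat_power)
  have NB0: "real N * real b ^ j > 0" using N b by simp
  have ldpos: "ld > 0" unfolding ld_def using NB NB0 by (intro ln_gt_zero) (simp add: less_divide_eq)
  have ldeq: "ld = ln (real n) - real j * ln (real b) - ln (real N)"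
    unfolding ld_def using NB0 N b n by (simp add: ln_div ln_mult_pos ln_realpow)
  obtain N0 where N0: "N = (\<Prod>q\<in>Pr. q ^ multiplicity q N) * N0" "N0 > 0" "\<forall>q\<in>Pr. \<not> q dvd N0"
    using prime_part_decomposition[OF _ finP primeP, of N] N by auto
  obtain n0 where n0: "n = (\<Prod>q\<in>Pr. q ^ multiplicity q n) * n0" "prime_factors n \<subseteq> Pr \<longrightarrow> n0 = 1"
    using prime_part_decomposition[OF n finP primeP] by blast
  have b_pos: "b > 0" using b by simp
  obtain b0 where b0: "b = (\<Prod>q\<in>Pr. q ^ multiplicity q b) * b0" "prime_factors b \<subseteq> Pr \<longrightarrow> b0 = 1"
    using prime_part_decomposition[OF b_pos finP primeP] by blast
  have n01: "n0 = 1" "b0 = 1" using n0(2) b0(2) Pr by auto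
  have lnn: "ln (real n) = (\<Sum>q\<in>Pr. real (multiplicity q n) * ln (real q))"
    using ln_prime_part[OF finP primeP n0(1)] n01 by simp
  have lnb: "ln (real b) = (\<Sum>q\<in>Pr. real (multiplicity q b) * ln (real q))"
    using ln_prime_part[OF finP primeP b0(1)] n01 by simp
  have lnN: "ln (real N) = (\<Sum>q\<in>Pr. real (multiplicity q N) * ln (real q)) + ln (real N0)"
    by (rule ln_prime_part[OF finP primeP N0(1,2)])
  define a0 where "a0 q = int (multiplicity q n) - int j * int (multiplicity q b) - int (multiplicity q N)" for q
  have suma: "(\<Sum>q\<in>Pr. of_int (a0 q) * ln (real q)) = ld + ln (real N0)"
    unfolding ldeq lnn lnb lnN
    by (simp add: a0_def sum_subtractf left_diff_distrib sum_distrib_left mult.assoc)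
  have "2 \<le> real b" using b by simp
  then have "2 * (2 + 1) \<le> 2 * (real b + 1)" by simp
  then have H4: "4 \<le> H" using Hb by simp
  have Nle: "N \<le> n"
  proof -
    have "N * 1 \<le> N * b ^ j" using b by (intro mult_le_mono2) simp
    then show ?thesis using Nn by linarith
  qed
  have jH: "real j \<le> 2 * H"
  proof -
    have "1 * b ^ j \<le> N * b ^ j" using N by (intro mult_le_mono1)
    then have "b ^ j \<le> n" using Nn by linarith
    then show ?thesis unfolding H using b by (intro exponent_le_ln)
  qed
  have mn: "real (multiplicity q x) \<le> 2 * H" if "q \<in> Pr" "x > 0" "x \<le> n" for q x
  proof -
    have "q ^ multiplicity q x \<le> x" using that(2) multiplicity_dvd[of q x] by (intro dvd_imp_le)
    then show ?thesis unfolding H using pge2[OF that(1)] that(3) by (intro exponent_le_ln) auto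
  qed
  have mb: "real (multiplicity q b) \<le> real b" if "q \<in> Pr" for q
  proof -
    have "multiplicity q b < 2 ^ multiplicity q b" by (rule less_exp)
    also have "\<dots> \<le> q ^ multiplicity q b" using pge2[OF that] by (intro power_mono) auto
    also have "\<dots> \<le> b" using b multiplicity_dvd[of q b] by (intro dvd_imp_le) auto
    finally show ?thesis by simp
  qed
  have HH: "2 * H * (real b + 1) \<le> H\<^sup>2"
    using mult_left_mono[OF Hb, of H] H4 by (simp add: power2_eq_square mult_ac)
  have "2 * H * 1 \<le> 2 * H * (real b + 1)" using H4 by (intro mult_left_mono) auto
  then have HH2: "2 * H \<le> H\<^sup>2" using HH by linarith
  have a0H: "\<bar>of_int (a0 q)\<bar> \<le> H\<^sup>2" if q: "q \<in> Pr" for q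
  proof -
    have "real j * real (multiplicity q b) \<le> 2 * H * real b" using jH mb[OF q] H4 by (intro mult_mono) auto
    moreover have "of_int (a0 q) = real (multiplicity q n) - real j * real (multiplicity q b) - real (multiplicity q N)"
      by (simp add: a0_def)
    moreover have "0 \<le> real j * real (multiplicity q b)" by simp
    moreover have "2 * H * (real b + 1) = 2 * H * real b + 2 * H" by (simp add: algebra_simps)
    ultimately show ?thesis using mn[OF q n] mn[OF q _ Nle] N HH HH2
      by (smt (verit) of_nat_0_le_iff le_eq_less_or_eq not_one_le_zero gr0I)
  qed
  have hP: "(\<Prod>q\<in>Pr. ln (real q)) \<ge> 0" using pge2 by (intro prod_nonneg) (force intro!: ln_ge_zero)
  show ?thesis
  proof (cases "N0 = 1")
    case True
    have "\<exists>q\<in>Pr. a0 q \<noteq> 0"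
    proof (rule ccontr)
      assume "\<not> ?thesis"
      then have "(\<Sum>q\<in>Pr. of_int (a0 q) * ln (real q)) = 0" by simp
      then show False using suma True ldpos by simp
    qed
    then obtain p0 where p0: "p0 \<in> Pr" "a0 p0 \<noteq> 0" by blast
    have lf: "linear_form Pr a0 p0" using finP pge2 p0 by unfold_locales auto
    have sq: "square_independent Pr"
    proof (rule square_independent_subset)
      show "square_independent (insert (SOME M. prime M \<and> M \<notin> Pr) Pr)"
      proof (rule square_independent_primes[OF finP primeP])
        have "\<exists>M. prime M \<and> M \<notin> Pr" using primes_infinite finP by (metis finite_subset mem_Collect_eq subsetI)
        then have M: "prime (SOME M. prime M \<and> M \<notin> Pr)" "(SOME M. prime M \<and> M \<notin> Pr) \<notin> Pr"
          using someI_ex[of "\<lambda>M. prime M \<and> M \<notin> Pr"] by auto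
        show "\<not> q dvd (SOME M. prime M \<and> M \<notin> Pr)" if "q \<in> Pr" for q
          using M primeP[OF that] that by (metis primes_dvd_imp_eq)
        show "(SOME M. prime M \<and> M \<notin> Pr) > 0" using M(1) by (rule prime_gt_0_nat)
        show "\<not> (\<exists>t. (SOME M. prime M \<and> M \<notin> Pr) = t\<^sup>2)" using M(1) by (metis prime_power_iff power2_eq_square prime_product numeral_eq_one_iff semiring_norm(85))
      qed
    qed auto
    have Lam: "linear_form.Lam Pr a0 = ld" using suma True by (simp add: linear_form.Lam_def[OF lf])
    have le: "K ^ card Pr * (\<Prod>q\<in>Pr. ln (real q)) * Hd \<le> Q"
    proof -
      have "K ^ card Pr * (\<Prod>q\<in>Pr. ln (real q)) * 1 * Hd \<le> Q"
        unfolding Q(1) using K Hd hP by (intro mult_right_mono mult_mono power_increasing) auto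
      then show ?thesis by simp
    qed
    have "exp (- (K ^ card Pr * (\<Prod>q\<in>Pr. ln (real q)) * Hd)) \<le> \<bar>linear_form.Lam Pr a0\<bar>"
      using LB lf sq a0H le Q(2) s unfolding linear_form_bound_def by force
    moreover have "exp (- Q) \<le> exp (- (K ^ card Pr * (\<Prod>q\<in>Pr. ln (real q)) * Hd))" using le by simp
    ultimately show ?thesis using Lam ldpos unfolding ld_def by linarith
  next
    case False
    then have "N0 \<ge> 2" using N0(2) by simp
    then obtain M e where M: "N0 = M ^ (2 ^ e)" "M \<ge> 2" "\<not> (\<exists>t. M = t\<^sup>2)" using nonsquare_root by blast
    have Mnd: "\<not> q dvd M" if "q \<in> Pr" for q
      using bspec[OF N0(3) that] M(1) by (metis dvd_power dvd_trans pos2 zero_less_power)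
    then have MP: "M \<notin> Pr" using dvd_refl by blast
    define a where "a q = (if q = M then - (2 ^ e) else a0 q)" for q
    have lf: "linear_form (insert M Pr) a M" using finP pge2 M by unfold_locales (auto simp: a_def)
    have sq: "square_independent (insert M Pr)"
      using M by (intro square_independent_primes[OF finP primeP Mnd]) auto
    have aeq: "(\<Sum>q\<in>Pr. of_int (a q) * ln (real q)) = (\<Sum>q\<in>Pr. of_int (a0 q) * ln (real q))"
      using MP by (intro sum.cong) (auto simp: a_def)
    have "ln (real N0) = 2 ^ e * ln (real M)" unfolding M(1) using M(2) by (simp add: ln_realpow)
    then have Lam: "linear_form.Lam (insert M Pr) a = ld"
      unfolding linear_form.Lam_def[OF lf] using MP finP aeq suma by (simp add: a_def)
    have N0N: "N0 \<le> N" using N0(1) N by (metis dvd_imp_le dvd_triv_right less_le_trans zero_less_one)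
    have eH: "(2::real) ^ e \<le> 2 * H"
    proof -
      have "M ^ (2 ^ e) \<le> n" using M(1) N0N Nle by simp
      then have "real (2 ^ e) \<le> 2 * H" unfolding H using M(2) by (intro exponent_le_ln)
      then show ?thesis by simp
    qed
    have aH: "\<bar>of_int (a q)\<bar> \<le> H\<^sup>2" if "q \<in> insert M Pr" for q
    proof (cases "q = M")
      case True
      then show ?thesis using eH HH2 by (simp add: a_def)
    next
      case False
      then show ?thesis using a0H[of q] that by (simp add: a_def)
    qed
    have cardI: "card (insert M Pr) = card Pr + 1" using MP finP by simp
    have prI: "(\<Prod>q\<in>insert M Pr. ln (real q)) = ln (real M) * (\<Prod>q\<in>Pr. ln (real q))" using MP finP by simp
    have lnM: "ln (real M) \<le> max 1 (ln (real N))"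
    proof -
      have "M \<le> N0" unfolding M(1) using M(2) by (intro self_le_power) auto
      then have "ln (real M) \<le> ln (real N)" using N0N M(2) by (intro ln_mono) auto
      then show ?thesis by simp
    qed
    have le: "K ^ card (insert M Pr) * (\<Prod>q\<in>insert M Pr. ln (real q)) * Hd \<le> Q"
    proof -
      have "K ^ (card Pr + 1) * (\<Prod>q\<in>Pr. ln (real q)) * ln (real M) * Hd \<le> Q"
        unfolding Q(1) using K Hd hP lnM by (intro mult_right_mono mult_left_mono) auto
      then show ?thesis unfolding cardI prI by (simp add: mult_ac)
    qed
    have "exp (- (K ^ card (insert M Pr) * (\<Prod>q\<in>insert M Pr. ln (real q)) * Hd)) \<le> \<bar>linear_form.Lam (insert M Pr) a\<bar>"
      using LB lf sq aH le Q(2) s cardI unfolding linear_form_bound_def by (smt (verit) of_nat_add of_nat_1)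
    moreover have "exp (- Q) \<le> exp (- (K ^ card (insert M Pr) * (\<Prod>q\<in>insert M Pr. ln (real q)) * Hd))" using le by simp
    ultimately show ?thesis using Lam ldpos unfolding ld_def by linarith
  qed
qed

lemma mod_power_digits_zero:
  assumes "c \<le> d" "\<And>i. c \<le> i \<Longrightarrow> i < d \<Longrightarrow> digit b n i = 0"
  shows "n mod b ^ d = n mod b ^ c"
  using assms
proof (induction d rule: dec_induct)
  case (step d)
  have "n mod b ^ Suc d = b ^ d * (n div b ^ d mod b) + n mod b ^ d"
    unfolding power_Suc2 by (rule mod_mult2_eq)
  also have "n div b ^ d mod b = 0" using step by (simp add: digit_def)
  finally show ?case using step by simp
qed simp

lemma less_power_self: "(b::nat) \<ge> 2 \<Longrightarrow> n < b ^ n"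
proof -
  assume b: "b \<ge> 2"
  have "n < 2 ^ n" by (rule less_exp)
  also have "\<dots> \<le> b ^ n" using b by (intro power_mono) auto
  finally show ?thesis .
qed

lemma nonzero_digits:
  assumes b: "b \<ge> 2" and n: "n > 0"
  defines "D \<equiv> {i. digit b n i \<noteq> 0}"
  shows "finite D" "D \<noteq> {}" "b ^ Max D \<le> n" "n < b ^ (Max D + 1)"
proof -
  have lt: "i < n" if "i \<in> D" for i
  proof (rule ccontr)
    assume "\<not> i < n"
    then have "b ^ n \<le> b ^ i" using b by (intro power_increasing) auto
    then have "n < b ^ i" using less_power_self[OF b, of n] by linarith
    then show False using that by (simp add: D_def digit_def)
  qed
  then have "D \<subseteq> {..<n}" by auto
  then show fin: "finite D" by (rule finite_subset) simp
  show ne: "D \<noteq> {}"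
  proof
    assume "D = {}"
    then have "n mod b ^ n = n mod b ^ 0" by (intro mod_power_digits_zero) (auto simp: D_def)
    then show False using less_power_self[OF b, of n] n by simp
  qed
  have mD: "Max D \<in> D" using fin ne by simp
  moreover have "\<forall>i\<in>D. digit b n i \<noteq> 0" by (simp add: D_def)
  ultimately have "digit b n (Max D) \<noteq> 0" by blast
  then have "n div b ^ Max D \<noteq> 0" by (intro notI) (simp add: digit_def)
  then show "b ^ Max D \<le> n" by (meson div_less not_le)
  have "n mod b ^ n = n mod b ^ (Max D + 1)"
  proof (rule mod_power_digits_zero)
    show "Max D + 1 \<le> n" using lt[OF mD] by simp
    show "digit b n i = 0" if "Max D + 1 \<le> i" for i
      using that Max_ge[OF fin, of i] by (auto simp: D_def)
  qed
  then have "n = n mod b ^ (Max D + 1)" using less_power_self[OF b, of n] by simp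
  also have "\<dots> < b ^ (Max D + 1)" using b by (intro mod_less_divisor) simp
  finally show "n < b ^ (Max D + 1)" .
qed

lemma iterate_gap:
  fixes A :: real and D :: "nat set"
  assumes fin: "finite D" and A: "A \<ge> 1"
    and gap: "\<And>i j. i \<in> D \<Longrightarrow> j \<in> D \<Longrightarrow> j < i \<Longrightarrow> (\<And>k. k \<in> D \<Longrightarrow> j < k \<Longrightarrow> i \<le> k) \<Longrightarrow>
      real (Max D - j) + 1 \<le> A * (real (Max D - i) + 1)"
    and "j \<in> D"
  shows "real (Max D - j) + 1 \<le> A ^ card {i \<in> D. j < i}"
  using assms(4)
proof (induction "card {i \<in> D. j < i}" arbitrary: j rule: less_induct)
  case less
  show ?case
  proof (cases "{i \<in> D. j < i} = {}")
    case True
    then have "Max D = j" using less.prems fin by (intro Max_eqI) force+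
    then show ?thesis unfolding True by simp
  next
    case False
    define i where "i = Min {i \<in> D. j < i}"
    have iD: "i \<in> {i \<in> D. j < i}" unfolding i_def using fin False by (intro Min_in) auto
    have imin: "i \<le> k" if "k \<in> D" "j < k" for k unfolding i_def using fin that by (intro Min_le) auto
    have eq: "{k \<in> D. j < k} = insert i {k \<in> D. i < k}" using iD imin by force
    then have card: "card {k \<in> D. j < k} = Suc (card {k \<in> D. i < k})" using fin by simp
    have "real (Max D - j) + 1 \<le> A * (real (Max D - i) + 1)"
      using iD less.prems imin by (intro gap) auto
    also have "\<dots> \<le> A * A ^ card {k \<in> D. i < k}"
      using less.hyps[of i] card iD A by (intro mult_left_mono) auto
    finally show ?thesis by (simp add: card)
  qed
qed

lemma digit_gap:
  fixes K H Hd A :: real and n b i j :: nat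
  assumes K: "K \<ge> 1" and Hd: "Hd \<ge> 0"
    and LB: "linear_form_bound K H Hd"
    and b: "b \<ge> 2" and n: "n > 0" and H: "H = ln (real n)"
    and Pr: "Pr = prime_factors n \<union> prime_factors b"
    and s: "real (card Pr) + 1 \<le> ln H" and Hb: "2 * (real b + 1) \<le> H"
    and D: "D = {i. digit b n i \<noteq> 0}" and ij: "i \<in> D" "j \<in> D" "j < i" "\<And>k. k \<in> D \<Longrightarrow> j < k \<Longrightarrow> i \<le> k"
    and A: "A = 2 * (K ^ (card Pr + 1) * (\<Prod>q\<in>Pr. ln (real q)) * Hd) + 2"
  shows "real (Max D - j) + 1 \<le> A * (real (Max D - i) + 1)"
proof -
  note nd = nonzero_digits[OF b n, folded D]
  define m where "m = Max D"
  have im: "i \<le> m" unfolding m_def using nd ij by simp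
  define N where "N = n div b ^ i"
  have bpos: "b > 0" using b by simp
  have Nlow: "b ^ (m - i) \<le> N"
  proof -
    have "b ^ (m - i) = b ^ m div b ^ i" using im bpos by (simp add: power_diff)
    also have "\<dots> \<le> N" unfolding N_def m_def using nd(3) by (rule div_le_mono)
    finally show ?thesis .
  qed
  have N1: "N \<ge> 1" using Nlow bpos by (metis One_nat_def Suc_leI less_le_trans zero_less_power)
  have Nup: "N < b ^ (m - i + 1)"
  proof -
    have "m - i + 1 + i = m + 1" using im by simp
    then have "b ^ (m - i + 1) * b ^ i = b ^ (m + 1)" by (simp only: power_add[symmetric])
    then have "n < b ^ (m - i + 1) * b ^ i" using nd(4) by (simp only: m_def)
    then show ?thesis unfolding N_def by (rule less_mult_imp_div_less)
  qed
  have nmod: "n mod b ^ i = n mod b ^ Suc j"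
  proof (rule mod_power_digits_zero)
    show "Suc j \<le> i" using ij by simp
    show "digit b n k = 0" if "Suc j \<le> k" "k < i" for k
      using ij(4)[of k] that by (auto simp: D)
  qed
  have mlt: "n mod b ^ i < b ^ Suc j" unfolding nmod using bpos by (intro mod_less_divisor) simp
  have mnz: "n mod b ^ i \<noteq> 0"
  proof
    assume "n mod b ^ i = 0"
    then obtain t where "n = b ^ Suc j * t" unfolding nmod by blast
    then have "n = b ^ j * (b * t)" by simp
    then have "n div b ^ j = b * t" using bpos by simp
    then show False using ij(2) by (simp add: D digit_def)
  qed
  have nN: "n = N * b ^ i + n mod b ^ i" unfolding N_def by (rule div_mult_mod_eq[symmetric])
  have Nn: "N * b ^ i < n" using nN mnz by linarith
  define h where "h = (\<Prod>q\<in>Pr. ln (real q))"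
  define Q where "Q = K ^ (card Pr + 1) * h * max 1 (ln (real N)) * Hd"
  define d where "d = real (m - i) + 1"
  have d1: "d \<ge> 1" by (simp add: d_def)
  have h0: "h \<ge> 0" unfolding h_def
  proof (rule prod_nonneg)
    fix q assume "q \<in> Pr"
    then have "q \<ge> 2" unfolding Pr using prime_ge_2_nat by auto
    then show "0 \<le> ln (real q)" by (intro ln_ge_zero) auto
  qed
  have lnb: "1 / 2 \<le> ln (real b)"
  proof -
    have "ln 2 \<le> ln (real b)" using b by simp
    then show ?thesis using ln2_half by linarith
  qed
  have lnN: "max 1 (ln (real N)) \<le> 2 * d * ln (real b)"
  proof -
    have "real N \<le> real (b ^ (m - i + 1))" using Nup by (simp only: of_nat_le_iff)
    then have "ln (real N) \<le> ln (real b ^ (m - i + 1))" using N1 by (intro ln_mono) auto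
    also have "\<dots> = d * ln (real b)" by (simp only: ln_realpow d_def) simp
    finally have 1: "ln (real N) \<le> d * ln (real b)" .
    have 2: "1 * (1 / 2) \<le> d * ln (real b)" using d1 lnb by (intro mult_mono) auto
    show ?thesis using 1 2 by (simp add: max_def)
  qed
  define C where "C = K ^ (card Pr + 1) * h * Hd"
  have C0: "C \<ge> 0" unfolding C_def using K h0 Hd by simp
  have "Q = C * max 1 (ln (real N))" by (simp add: Q_def C_def)
  also have "\<dots> \<le> C * (2 * d * ln (real b))" using lnN C0 by (intro mult_left_mono)
  finally have QC: "Q \<le> (2 * C * d) * ln (real b)" by (simp add: mult_ac)
  have key: "real m \<le> 2 * C * d + 1 + real j"
  proof (cases "Q \<le> H")
    case True
    have "exp (- Q) \<le> ln (real n / (real N * real b ^ i))"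
      using truncation_linear_form[OF K Hd LB b n H N1 Nn Pr s Hb _ True] unfolding Q_def h_def by blast
    also have "real n / (real N * real b ^ i) = 1 + real (n mod b ^ i) / (real N * real b ^ i)"
    proof -
      have "real n = real N * real b ^ i + real (n mod b ^ i)"
        by (subst nN) (simp only: of_nat_add of_nat_mult of_nat_power)
      moreover have "real N * real b ^ i > 0" using N1 b by simp
      ultimately show ?thesis using N1 b by (simp only: add_divide_distrib) simp
    qed
    also have "ln \<dots> \<le> real (n mod b ^ i) / (real N * real b ^ i)"
      by (rule ln_add_one_self_le_self) simp
    also have "\<dots> \<le> real b ^ Suc j / real b ^ m"
    proof (rule frac_le)
      have "real (n mod b ^ i) \<le> real (b ^ Suc j)" using mlt by (simp only: of_nat_le_iff)
      then show "real (n mod b ^ i) \<le> real b ^ Suc j" by simp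
      have "b ^ m = b ^ (m - i) * b ^ i" using im by (simp flip: power_add)
      then have "b ^ m \<le> N * b ^ i" using Nlow by simp
      then show "real b ^ m \<le> real N * real b ^ i" by (metis of_nat_le_iff of_nat_mult of_nat_power)
    qed (use b in auto)
    finally have "exp (- Q) \<le> real b ^ Suc j / real b ^ m" .
    then have "ln (exp (- Q)) \<le> ln (real b ^ Suc j / real b ^ m)" by (intro ln_mono) auto
    also have "\<dots> = real (Suc j) * ln (real b) - real m * ln (real b)"
      using b by (subst ln_div) (auto simp: ln_realpow simp del: power_Suc of_nat_Suc)
    finally have "(real m - real (Suc j)) * ln (real b) \<le> Q" by (simp add: algebra_simps)
    also have "\<dots> \<le> (2 * C * d) * ln (real b)" by (rule QC)
    finally have "real m - real (Suc j) \<le> 2 * C * d" using lnb by (simp add: mult_le_cancel_right)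
    then show ?thesis by simp
  next
    case False
    have "real b ^ m \<le> real n" using nd(3) unfolding m_def by (metis of_nat_le_iff of_nat_power)
    then have "ln (real b ^ m) \<le> ln (real n)" using b by (intro ln_mono) auto
    then have "real m * ln (real b) \<le> H" unfolding H by (simp add: ln_realpow)
    then have "real m * ln (real b) \<le> (2 * C * d) * ln (real b)" using False QC by linarith
    then have "real m \<le> 2 * C * d" using lnb by (simp add: mult_le_cancel_right)
    then show ?thesis by simp
  qed
  have jm: "j < m" using ij im by linarith
  then have "real (m - j) + 1 \<le> 2 * C * d + 2" using key by (simp add: of_nat_diff)
  also have "\<dots> \<le> 2 * C * d + 2 * d" using d1 by simp
  also have "\<dots> = A * d" unfolding A C_def h_def by (simp add: algebra_simps)
  finally show ?thesis by (simp add: m_def d_def)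
qed

lemma ln_ge_one_minus_inverse: "(y::real) > 0 \<Longrightarrow> 1 - 1 / y \<le> ln y"
  using ln_le_minus_one[of "1 / y"] by (simp add: ln_div)

lemma Max_prime_factors:
  fixes n :: nat
  assumes "n \<ge> 2"
  shows "Max (prime_factors n) \<in> prime_factors n" "Max (prime_factors n) \<ge> 2"
proof -
  obtain p where "prime p" "p dvd n" using prime_factor_nat[of n] assms by auto
  then have "p \<in> prime_factors n" using assms by (simp add: in_prime_factors_iff)
  then show 1: "Max (prime_factors n) \<in> prime_factors n" by (intro Max_in) (auto simp del: set_mset_eq_empty_iff)
  then show "Max (prime_factors n) \<ge> 2" by (meson in_prime_factors_imp_prime prime_ge_2_nat)
qed

lemma ln_nat_le_digit_product:
  fixes K H Hd P :: real and n b k :: nat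
  assumes K: "K \<ge> 2" and Hd: "Hd \<ge> 1" and LB: "linear_form_bound K H Hd"
    and b: "b \<ge> 2" and n: "n \<ge> 2" and nb: "\<not> b dvd n" and k: "num_nonzero_digits b n = k" and H: "H = ln (real n)"
    and s: "real (num_prime_factors n) + real b + 1 \<le> ln H" and Hb: "2 * (real b + 1) \<le> H"
    and P: "P = real (greatest_prime_factor n)"
  shows "H \<le> (4 * (K ^ (b + 1) * real b ^ b) * (K * ln P) ^ num_prime_factors n * Hd) ^ (k - 1) * ln (real b)"
proof -
  define w where "w = num_prime_factors n"
  define D where "D = {i. digit b n i \<noteq> 0}"
  define Pr where "Pr = prime_factors n \<union> prime_factors b"
  define h where "h = (\<Prod>q\<in>Pr. ln (real q))"
  define A where "A = 2 * (K ^ (card Pr + 1) * h * Hd) + 2"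
  have n0: "n > 0" and b0: "b > 0" using n b by auto
  have Pmax: "P = real (Max (prime_factors n))" using n by (simp add: P greatest_prime_factor_def)
  have qP: "real q \<le> P" if "q \<in> prime_factors n" for q
    unfolding Pmax using that by (simp add: Max_ge)
  have q2: "2 \<le> q" if "q \<in> Pr" for q using that unfolding Pr_def using prime_ge_2_nat by auto
  have ln0: "0 \<le> ln (real q)" if "q \<in> Pr" for q using q2[OF that] by (intro ln_ge_zero) auto
  have pfb: "prime_factors b \<subseteq> {1..b}"
  proof
    fix q assume q: "q \<in> prime_factors b"
    then have "q dvd b" "prime q" by auto
    then show "q \<in> {1..b}" using b0 dvd_imp_le[of q b] prime_gt_0_nat[of q] by auto
  qed
  then have cb: "card (prime_factors b) \<le> b" using card_mono[OF _ pfb] by simp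
  have cPr: "card Pr \<le> w + b"
    using card_Un_le[of "prime_factors n" "prime_factors b"] cb unfolding Pr_def w_def num_prime_factors_def by linarith
  have lnP: "1 / 2 \<le> ln P"
  proof -
    have "ln 2 \<le> ln P" unfolding Pmax using Max_prime_factors(2)[OF n] by simp
    then show ?thesis using ln2_half by linarith
  qed
  have hle: "h \<le> ln P ^ w * real b ^ b"
  proof -
    have "h = (\<Prod>q\<in>prime_factors n. ln (real q)) * (\<Prod>q\<in>prime_factors b - prime_factors n. ln (real q))"
      unfolding h_def Pr_def Un_Diff_cancel[symmetric, of "prime_factors n" "prime_factors b"]
      by (intro prod.union_disjoint) auto
    also have "\<dots> \<le> (\<Prod>q\<in>prime_factors n. ln P) * (\<Prod>q\<in>prime_factors b - prime_factors n. real b)"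
    proof (intro mult_mono prod_mono conjI)
      fix q assume q: "q \<in> prime_factors n"
      then show "ln (real q) \<le> ln P" using qP[OF q] q2[of q] by (intro ln_mono) (auto simp: Pr_def)
      show "0 \<le> ln (real q)" using q by (intro ln0) (auto simp: Pr_def)
    next
      fix q assume q: "q \<in> prime_factors b - prime_factors n"
      then have "q \<le> b" using pfb by auto
      moreover have "ln (real q) \<le> real q" using q2[of q] q ln_le_minus_one[of "real q"] by (auto simp: Pr_def)
      ultimately show "ln (real q) \<le> real b" by linarith
      show "0 \<le> ln (real q)" using q by (intro ln0) (auto simp: Pr_def)
    qed (use lnP in \<open>auto intro!: prod_nonneg ln0 simp: Pr_def\<close>)
    also have "\<dots> = ln P ^ w * real b ^ card (prime_factors b - prime_factors n)"
      by (simp add: w_def num_prime_factors_def)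
    also have "\<dots> \<le> ln P ^ w * real b ^ b"
    proof (intro mult_left_mono power_increasing)
      show "card (prime_factors b - prime_factors n) \<le> b"
        using cb card_mono[of "prime_factors b" "prime_factors b - prime_factors n"] by auto
    qed (use b lnP in auto)
    finally show ?thesis .
  qed
  define Xb where "Xb = K ^ (b + 1) * real b ^ b * (K * ln P) ^ w * Hd"
  have CX: "K ^ (card Pr + 1) * h * Hd \<le> Xb"
  proof -
    have "K ^ (card Pr + 1) * h * Hd \<le> K ^ (w + b + 1) * (ln P ^ w * real b ^ b) * Hd"
      using K hle cPr Hd lnP ln0 unfolding h_def
      by (intro mult_right_mono mult_mono power_increasing) (auto intro!: prod_nonneg)
    also have "\<dots> = Xb" unfolding Xb_def by (simp add: power_add power_mult_distrib)
    finally show ?thesis .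
  qed
  have "1 \<le> Xb"
  proof -
    have "2 * (1 / 2) \<le> K * ln P" using K lnP by (intro mult_mono) auto
    then have "1 \<le> (K * ln P) ^ w" by (intro one_le_power) simp
    moreover have "1 \<le> K ^ (b + 1)" using K by (intro one_le_power) simp
    moreover have "1 \<le> real b ^ b" using b by (intro one_le_power) simp
    ultimately have "1 * 1 * 1 * 1 \<le> Xb" unfolding Xb_def using Hd K by (intro mult_mono) auto
    then show ?thesis by simp
  qed
  then have AX: "A \<le> 4 * Xb" unfolding A_def using CX by linarith
  have A1: "A \<ge> 1"
  proof -
    have "0 \<le> K ^ (card Pr + 1) * h * Hd" using K Hd ln0 unfolding h_def by (intro mult_nonneg_nonneg prod_nonneg) auto
    then show ?thesis unfolding A_def by linarith
  qed
  note nd = nonzero_digits[OF b n0, folded D_def]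
  have "digit b n 0 \<noteq> 0" using nb by (simp add: digit_def dvd_eq_mod_eq_0)
  then have D0: "0 \<in> D" by (simp add: D_def)
  have sPr: "real (card Pr) + 1 \<le> ln H" using s cPr unfolding w_def by linarith
  have "real (Max D - 0) + 1 \<le> A ^ card {i \<in> D. 0 < i}"
  proof (rule iterate_gap[OF nd(1) A1 _ D0])
    fix i j assume ij: "i \<in> D" "j \<in> D" "j < i" "\<And>k. k \<in> D \<Longrightarrow> j < k \<Longrightarrow> i \<le> k"
    show "real (Max D - j) + 1 \<le> A * (real (Max D - i) + 1)"
      by (rule digit_gap[OF _ _ LB b n0 H Pr_def sPr Hb D_def ij A_def[unfolded h_def]]) (use K Hd in auto)
  qed
  also have "card {i \<in> D. 0 < i} = k - 1"
  proof -
    have "{i \<in> D. 0 < i} = D - {0}" by auto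
    then show ?thesis using D0 nd(1) k by (simp add: num_nonzero_digits_def D_def)
  qed
  also have "A ^ (k - 1) \<le> (4 * Xb) ^ (k - 1)" using AX A1 by (intro power_mono) auto
  finally have mX: "real (Max D) + 1 \<le> (4 * Xb) ^ (k - 1)" by simp
  have "real n \<le> real (b ^ (Max D + 1))" using nd(4) by (simp only: of_nat_le_iff)
  then have "H \<le> ln (real b ^ (Max D + 1))" unfolding H using n by (intro ln_mono) auto
  also have "\<dots> = (real (Max D) + 1) * ln (real b)" by (simp only: ln_realpow) simp
  also have "\<dots> \<le> (4 * Xb) ^ (k - 1) * ln (real b)" using mX b by (intro mult_right_mono) auto
  finally show ?thesis by (simp add: Xb_def w_def mult.assoc)
qed

lemma total_recursive_const: "total_recursive n (\<lambda>_. j)"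
proof (induction j)
  case (Suc j)
  have "total_recursive n (\<lambda>xs. (\<lambda>xs. Suc (hd xs)) (map (\<lambda>f. f xs) [\<lambda>_. j]))"
    by (rule total_recursive.comp) (use Suc total_recursive.succ in auto)
  then show ?case by simp
qed (rule total_recursive.zero)

lemma computable_real_nat: "computable_real (real j)"
  unfolding computable_real_def
  by (rule exI[of _ "\<lambda>_. j"], rule exI[of _ "\<lambda>_. 0"], rule exI[of _ "\<lambda>_. 0"])
     (simp add: total_recursive_const)

lemma computable_real_fun_nat: "computable_real_fun (\<lambda>_. real j)"
  unfolding computable_real_fun_def
  by (rule exI[of _ "\<lambda>_. j"], rule exI[of _ "\<lambda>_. 0"], rule exI[of _ "\<lambda>_. 0"])
     (simp add: total_recursive_const)

lemma lnln_lower_bound: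
  fixes k :: nat and P :: real
  assumes "k \<ge> 2" "P \<ge> 2"
  shows "- 4 \<le> ln (ln (real k * ln P))"
proof -
  have "1 / 8 \<le> ln (8 / 7 :: real)" using ln_ge_one_minus_inverse[of "8 / 7"] by simp
  moreover have "5 * ln (8 / 7 :: real) = ln ((8 / 7) ^ 5)" by (simp add: ln_realpow)
  moreover have "ln ((8 / 7 :: real) ^ 5) \<le> ln 2" by (intro ln_mono) (auto simp: power_divide)
  ultimately have "5 / 8 \<le> ln (2::real)" by linarith
  also have "ln 2 \<le> ln P" using assms by simp
  finally have "5 / 8 \<le> ln P" .
  then have "2 * (5 / 8) \<le> real k * ln P" using assms by (intro mult_mono) auto
  then have "ln (5 / 4) \<le> ln (real k * ln P)" by (intro ln_mono) auto
  moreover have "1 / 5 \<le> ln (5 / 4 :: real)" using ln_ge_one_minus_inverse[of "5 / 4"] by simp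
  ultimately have "1 / 5 \<le> ln (real k * ln P)" by linarith
  then have "ln (1 / 5) \<le> ln (ln (real k * ln P))" by (intro ln_mono) auto
  then show ?thesis using ln_ge_one_minus_inverse[of "1 / 5"] by simp
qed

lemma digit_bound_main:
  fixes b k :: nat
  assumes b: "b \<ge> 2" and k: "k \<ge> 2"
  shows "\<forall>\<^sub>F n in sequentially. \<not> b dvd n \<longrightarrow> num_nonzero_digits b n = k \<longrightarrow>
    ln (ln (real n)) / real k \<le> real (num_prime_factors n) * (2 + ln (ln (real (greatest_prime_factor n))))"
proof -
  define \<delta> :: real where "\<delta> = 1 / (8 * (real k)\<^sup>2)"
  have k2: "2 \<le> real k" using k by simp
  have ksq: "1 \<le> (real k)\<^sup>2" using k2 by (simp add: one_le_power)
  have "1 \<le> 8 * (real k)\<^sup>2" using ksq by linarith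
  then have \<delta>: "0 < \<delta>" "\<delta> \<le> 1" unfolding \<delta>_def using k by (auto simp: divide_le_eq_1)
  obtain K H0 where K: "K \<ge> 2" and LB: "\<And>H. H \<ge> H0 \<Longrightarrow> linear_form_bound K H (H powr (2 * \<delta>))"
    using linear_form_lower_bound[OF \<delta>] by metis
  define Cb where "Cb = K ^ (b + 1) * real b ^ b"
  define C' where "C' = (real k - 1) * ln (4 * Cb) + ln (real b)"
  define P0 where "P0 = exp (exp (4 * real k * ln K))"
  define X0 where "X0 = max (2 * (real b + 1)) (2 * real k * (real k * P0 * ln K + C') + 1)"
  define Hm where "Hm = max H0 (exp X0)"
  have lnK: "ln K > 0" using K by simp
  have Cb1: "Cb \<ge> 1"
  proof -
    have "1 * 1 \<le> Cb" unfolding Cb_def using K b by (intro mult_mono one_le_power) auto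
    then show ?thesis by simp
  qed
  have bound: "ln (ln (real n)) / real k \<le> real (num_prime_factors n) * (2 + ln (ln (real (greatest_prime_factor n))))"
    if nH: "Hm \<le> ln (real n)" and n2: "n \<ge> 2" and nb: "\<not> b dvd n" and kn: "num_nonzero_digits b n = k" for n
  proof (rule ccontr)
    define H where "H = ln (real n)"
    define x where "x = ln H"
    define w where "w = real (num_prime_factors n)"
    define P where "P = real (greatest_prime_factor n)"
    define p where "p = ln (ln P)"
    define l where "l = ln K"
    assume "\<not> ?thesis"
    then have neg: "w * (2 + p) < x / real k" unfolding w_def p_def P_def x_def H_def by simp
    have HX: "exp X0 \<le> H" "H0 \<le> H" using nH unfolding Hm_def H_def by auto
    have Hpos: "H > 0" using HX(1) by (meson exp_gt_zero less_le_trans)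
    have "ln (exp X0) \<le> ln H" using HX by (intro ln_mono) auto
    then have xX: "X0 \<le> x" by (simp add: x_def)
    have X0b: "2 * (real b + 1) \<le> X0" "2 * real k * (real k * P0 * ln K + C') + 1 \<le> X0" unfolding X0_def by auto
    have "X0 \<le> exp X0" using exp_ge_add_one_self[of X0] by linarith
    then have Hb: "2 * (real b + 1) \<le> H" using X0b HX by linarith
    have x4: "x \<ge> 2 * (real b + 1)" using xX X0b by linarith
    have x0: "x \<ge> 0" using x4 by (meson add_nonneg_nonneg mult_nonneg_nonneg of_nat_0_le_iff order_trans zero_le_numeral zero_le_one)
    have Pmax: "P = real (Max (prime_factors n))" using n2 by (simp add: P_def greatest_prime_factor_def)
    have P2: "P \<ge> 2" unfolding Pmax using Max_prime_factors(2)[OF n2] by simp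
    have lnP: "1 / 2 \<le> ln P"
    proof -
      have "ln 2 \<le> ln P" using P2 by simp
      then show ?thesis using ln2_half by linarith
    qed
    have pge: "- 1 \<le> p"
    proof -
      have "ln (1 / 2) \<le> p" unfolding p_def using lnP by (intro ln_mono) auto
      moreover have "- 1 \<le> ln (1 / 2 :: real)" using ln_ge_one_minus_inverse[of "1 / 2"] by simp
      ultimately show ?thesis by linarith
    qed
    have w0: "w \<ge> 0" by (simp add: w_def)
    have wP: "w \<le> P"
    proof -
      have "prime_factors n \<subseteq> {1..Max (prime_factors n)}"
      proof
        fix q assume q: "q \<in> prime_factors n"
        then have "q \<ge> 1" by (meson in_prime_factors_imp_prime prime_ge_1_nat)
        then show "q \<in> {1..Max (prime_factors n)}" using q by (simp add: Max_ge)
      qed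
      then have "card (prime_factors n) \<le> Max (prime_factors n)"
        using card_mono[of "{1..Max (prime_factors n)}" "prime_factors n"] by simp
      then show ?thesis unfolding w_def num_prime_factors_def Pmax by simp
    qed
    have "w * 1 \<le> w * (2 + p)" using w0 pge by (intro mult_left_mono) auto
    moreover have "x / real k \<le> x / 2" using k2 x0 by (intro divide_left_mono) auto
    ultimately have "w \<le> x / 2" using neg by linarith
    moreover have "2 * real b + 2 \<le> x" using x4 by (simp add: algebra_simps)
    ultimately have s: "w + real b + 1 \<le> ln H" unfolding x_def by linarith
    define Hd where "Hd = H powr (2 * \<delta>)"
    have Hge1: "H \<ge> 1" using Hb by (smt (verit) of_nat_0_le_iff)
    have Hd1: "Hd \<ge> 1" unfolding Hd_def using Hge1 \<delta> by (simp add: ge_one_powr_ge_zero)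
    have lb: "linear_form_bound K H Hd" unfolding Hd_def by (rule LB[OF HX(2)])
    have main: "H \<le> (4 * Cb * (K * ln P) ^ num_prime_factors n * Hd) ^ (k - 1) * ln (real b)"
      unfolding Cb_def
      by (rule ln_nat_le_digit_product[OF K Hd1 lb b n2 nb kn H_def _ Hb P_def]) (use s in \<open>simp add: w_def\<close>)
    define A where "A = 4 * Cb * (K * ln P) ^ num_prime_factors n * Hd"
    have KP: "K * ln P > 0" using K lnP by simp
    have Apos: "A > 0" unfolding A_def using Cb1 KP Hd1 by simp
    have lnA: "ln A = ln (4 * Cb) + w * (l + p) + 2 * \<delta> * x"
    proof -
      have "ln A = ln (4 * Cb) + ln ((K * ln P) ^ num_prime_factors n) + ln Hd"
      proof -
        have "4 * Cb > 0" "(K * ln P) ^ num_prime_factors n > 0" "Hd > 0"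
          using Cb1 Hd1 zero_less_power[OF KP] by auto
        then show ?thesis unfolding A_def by (simp only: ln_mult_pos mult_pos_pos)
      qed
      also have "ln ((K * ln P) ^ num_prime_factors n) = w * (l + p)"
        unfolding w_def l_def p_def using K lnP by (simp only: ln_realpow) (simp add: ln_mult_pos)
      also have "ln Hd = 2 * \<delta> * x" unfolding Hd_def x_def using Hpos by (simp add: ln_powr)
      finally show ?thesis .
    qed
    have lnb: "ln (real b) > 0" using b by simp
    have xle: "x \<le> (real k - 1) * ln A + ln (real b)"
    proof -
      have "x \<le> ln (A ^ (k - 1) * ln (real b))" unfolding x_def using main Hpos unfolding A_def[symmetric] by (intro ln_mono) auto
      also have "\<dots> = real (k - 1) * ln A + ln (ln (real b))"
        using Apos lnb by (simp add: ln_mult_pos ln_realpow)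
      also have "ln (ln (real b)) \<le> ln (real b)" using ln_le_minus_one[OF lnb] by linarith
      finally show ?thesis using k by (simp add: of_nat_diff)
    qed
    have d: "(real k - 1) * (2 * \<delta> * x) \<le> x / (4 * real k)"
    proof -
      have "(real k - 1) * (2 * \<delta> * x) \<le> real k * (2 * \<delta> * x)" using \<delta> x0 by (intro mult_right_mono) auto
      also have "\<dots> = x / (4 * real k)" unfolding \<delta>_def using k2 by (simp add: power2_eq_square field_simps)
      finally show ?thesis .
    qed
    have e1: "(real k - 1) * (w * p) \<le> x - x / real k"
    proof -
      have "w * p \<le> x / real k" using neg w0 by (simp add: algebra_simps)
      then have "(real k - 1) * (w * p) \<le> (real k - 1) * (x / real k)" using k2 by (intro mult_left_mono) auto
      also have "\<dots> = x - x / real k" using k2 by (simp add: field_simps)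
      finally show ?thesis .
    qed
    have e2: "(real k - 1) * (w * l) \<le> real k * (w * l)"
      using w0 lnK by (intro mult_right_mono) (auto simp: l_def)
    have "(real k - 1) * ln A = (real k - 1) * ln (4 * Cb) + (real k - 1) * (w * l) + (real k - 1) * (w * p) + (real k - 1) * (2 * \<delta> * x)"
      unfolding lnA by (simp add: algebra_simps)
    then have "x \<le> C' + real k * (w * l) + (x - x / real k) + x / (4 * real k)"
      using xle d e1 e2 unfolding C'_def by linarith
    moreover have x4k: "x / (4 * real k) = x / real k / 4" by simp
    ultimately have "x \<le> C' + real k * (w * l) + (x - x / real k) + x / real k / 4" by (simp only: x4k)
    moreover have "3 * z / 4 \<le> v + c" if "x \<le> c + v + (x - z) + z / 4" for z v c :: real
      using that by linarith
    ultimately have key: "3 * (x / real k) / 4 \<le> real k * (w * l) + C'" by blast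
    have l0: "l > 0" using lnK by (simp add: l_def)
    have kPl: "0 \<le> real k * P0 * l" unfolding P0_def using l0 by simp
    have "2 * real k * (real k * P0 * l + C') < x" using xX X0b(2) unfolding l_def by linarith
    then have big: "2 * (real k * P0 * l + C') < x / real k" using k2 by (simp add: field_simps)
    have xk0: "x / real k \<ge> 0" using x0 by simp
    define y where "y = x / real k"
    define v where "v = real k * (w * l)"
    define q where "q = w * (2 + p)"
    define kP where "kP = real k * P0 * l"
    have facts: "q < y" "3 * y / 4 \<le> v + C'" "2 * kP + 2 * C' < y" "0 \<le> y" "0 \<le> kP"
      using neg key big xk0 kPl unfolding y_def v_def q_def kP_def by (simp_all only: distrib_left)
    show False
    proof (cases "P \<ge> P0")
      case True
      have "exp (4 * real k * l) \<le> ln P"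
      proof -
        have "ln P0 \<le> ln P" using True by (intro ln_mono) (auto simp: P0_def)
        then show ?thesis by (simp add: P0_def l_def)
      qed
      then have "ln (exp (4 * real k * l)) \<le> p" unfolding p_def by (intro ln_mono) auto
      then have "4 * real k * l \<le> 2 + p" by simp
      then have "w * (4 * real k * l) \<le> w * (2 + p)" using w0 by (intro mult_left_mono) auto
      then have "4 * v \<le> q" unfolding v_def q_def by (simp add: mult_ac)
      then show False using facts by linarith
    next
      case False
      then have "w \<le> P0" using wP by linarith
      then have "v \<le> kP" unfolding v_def kP_def mult.assoc using l0 by (intro mult_left_mono mult_right_mono) auto
      then show False using facts by linarith
    qed
  qed
  have "\<forall>\<^sub>F n :: nat in sequentially. Hm \<le> ln (real n)"
    using filterlim_compose[OF ln_at_top filterlim_real_sequentially] by (simp add: filterlim_at_top)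
  then show ?thesis
    using eventually_ge_at_top[of 2] by eventually_elim (use bound in auto)
qed

theorem theorem1p2:
  "\<exists>(c :: nat \<Rightarrow> real) (C :: real). computable_real_fun c \<and> computable_real C \<and>
     (\<forall>(b :: nat) (k :: nat). b \<ge> 2 \<longrightarrow> k \<ge> 2 \<longrightarrow>
       (\<forall>\<^sub>F n :: nat in sequentially.
          n > 0 \<longrightarrow> \<not> b dvd n \<longrightarrow> num_nonzero_digits b n = k \<longrightarrow>
            ln (ln (real n)) / real k
              \<le> c b + ln (real k)
                + real (num_prime_factors n) * (C + ln (ln (real (greatest_prime_factor n))))
                + ln (ln (real k * ln (real (greatest_prime_factor n))))))"
proof (rule exI[of _ "\<lambda>_. real 4"], rule exI[of _ "real 2"], intro conjI allI impI)
  show "computable_real_fun (\<lambda>_. real 4)" by (rule computable_real_fun_nat)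
  show "computable_real (real 2)" by (rule computable_real_nat)
  fix b k :: nat assume b: "b \<ge> 2" and k: "k \<ge> 2"
  show "\<forall>\<^sub>F n :: nat in sequentially.
          n > 0 \<longrightarrow> \<not> b dvd n \<longrightarrow> num_nonzero_digits b n = k \<longrightarrow>
            ln (ln (real n)) / real k
              \<le> real 4 + ln (real k)
                + real (num_prime_factors n) * (real 2 + ln (ln (real (greatest_prime_factor n))))
                + ln (ln (real k * ln (real (greatest_prime_factor n))))"
    using digit_bound_main[OF b k] eventually_ge_at_top[of 2]
  proof eventually_elim
    case (elim n)
    have "2 \<le> real (greatest_prime_factor n)" using elim(2) Max_prime_factors(2)[of n] by (simp add: greatest_prime_factor_def)
    then have "- 4 \<le> ln (ln (real k * ln (real (greatest_prime_factor n))))"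
      using k by (intro lnln_lower_bound)
    moreover have "0 \<le> ln (real k)" using k by simp
    ultimately have nonneg: "0 \<le> 4 + ln (real k) + ln (ln (real k * ln (real (greatest_prime_factor n))))" by linarith
    show ?case
    proof (intro impI)
      assume "\<not> b dvd n" "num_nonzero_digits b n = k"
      then have "ln (ln (real n)) / real k
          \<le> real (num_prime_factors n) * (real 2 + ln (ln (real (greatest_prime_factor n))))"
        using elim(1) by simp
      then show "ln (ln (real n)) / real k \<le> real 4 + ln (real k)
          + real (num_prime_factors n) * (real 2 + ln (ln (real (greatest_prime_factor n))))
          + ln (ln (real k * ln (real (greatest_prime_factor n))))"
        using nonneg by simp
    qed
  qed
qed

end
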